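(* Assume the Strong Exponential-Time Hypothesis (SETH). Then there is no fixed $\varepsilon>0$ for which some algorithm solves the \textsc{All-Pairs Max-Flow} problem in undirected graphs with $n$ nodes, $O(n)$ edges and integer node capacities in $\{1,\dots,O(n^2)\}$ in time $O(n^{3-\varepsilon})$.
   Context: SETH: for every fixed $\varepsilon>0$ there is an integer $k\ge 3$ such that $k$-SAT on $n$ variables and $m$ clauses cannot be solved in time $2^{(1-\varepsilon)n}m^{O(1)}$. \textsc{All-Pairs Max-Flow}: given a graph, output for every pair of nodes $s,t$ the value of a maximum $st$-flow. In a node-capacitated undirected graph, a feasible $st$-flow is a flow along undirected edges (edges themselves are uncapacitated) such that the total flow passing through every node other than $s$ and $t$ is at most that node's capacity; the capacities of $s$ and $t$ themselves do not constrain the flow. *)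

theory Defs
  imports
    Complex_Main
    "HOL-Library.Log_Nat"
    "HOL-Library.Extended_Real"
    "HOL-Library.Landau_Symbols"
begin

section \<open>Random access machine with logarithmic cost\<close>

text \<open>
  A deterministic, uniform RAM, presented as a structured language instead of a list of
  instructions with jumps (the two translate into each other with constant overhead).
  A program addresses a fixed number of registers directly and an unbounded memory of natural
  numbers indirectly. Every operation is charged the bit lengths of the numbers it handles,
  including memory addresses. Up to polylogarithmic factors in the running time this agrees with a
  word RAM whose words have logarithmically many bits, but no word size has to be chosen (for an
  exponential-time algorithm the word size could not be logarithmic in the input length).
\<close>

datatype arith_op = Plus | Monus | Times | Div | Mod

fun arith :: "arith_op \<Rightarrow> nat \<Rightarrow> nat \<Rightarrow> nat" where
  "arith Plus x y = x + y"
| "arith Monus x y = x - y"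
| "arith Times x y = x * y"
| "arith Div x y = x div y"
| "arith Mod x y = x mod y"

datatype program =
    Skip
  | Const nat nat               \<comment> \<open>\<open>Const i k\<close>: register i := k\<close>
  | Arith arith_op nat nat nat  \<comment> \<open>\<open>Arith f i j k\<close>: register i := f (register j) (register k)\<close>
  | Load nat nat                \<comment> \<open>\<open>Load i j\<close>: register i := memory at address (register j)\<close>
  | Store nat nat               \<comment> \<open>\<open>Store i j\<close>: memory at address (register i) := register j\<close>
  | Seq program program
  | Cond nat program program    \<comment> \<open>\<open>Cond i P Q\<close>: P if register i is nonzero, otherwise Q\<close>
  | While nat program           \<comment> \<open>\<open>While i P\<close>: repeat P as long as register i is nonzero\<close>

record state =
  reg :: "nat \<Rightarrow> nat"
  mem :: "nat \<Rightarrow> nat"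

definition bits :: "nat \<Rightarrow> nat" where
  "bits x = max 1 (floorlog 2 x)"

text \<open>\<open>exec P s t s'\<close>: started in \<open>s\<close>, the program \<open>P\<close> halts in \<open>s'\<close> at total cost \<open>t\<close>.\<close>

inductive exec :: "program \<Rightarrow> state \<Rightarrow> nat \<Rightarrow> state \<Rightarrow> bool" where
  Skip: "exec Skip s 1 s"
| Const: "exec (Const i k) s (bits k) (s\<lparr>reg := (reg s)(i := k)\<rparr>)"
| Arith: "exec (Arith f i j k) s (bits (reg s j) + bits (reg s k))
            (s\<lparr>reg := (reg s)(i := arith f (reg s j) (reg s k))\<rparr>)"
| Load: "exec (Load i j) s (bits (reg s j) + bits (mem s (reg s j)))
           (s\<lparr>reg := (reg s)(i := mem s (reg s j))\<rparr>)"
| Store: "exec (Store i j) s (bits (reg s i) + bits (reg s j))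
            (s\<lparr>mem := (mem s)(reg s i := reg s j)\<rparr>)"
| Seq: "exec P s t1 s1 \<Longrightarrow> exec Q s1 t2 s2 \<Longrightarrow> exec (Seq P Q) s (t1 + t2) s2"
| CondTrue: "reg s i \<noteq> 0 \<Longrightarrow> exec P s t s' \<Longrightarrow> exec (Cond i P Q) s (bits (reg s i) + t) s'"
| CondFalse: "reg s i = 0 \<Longrightarrow> exec Q s t s' \<Longrightarrow> exec (Cond i P Q) s (bits (reg s i) + t) s'"
| WhileTrue: "reg s i \<noteq> 0 \<Longrightarrow> exec P s t1 s1 \<Longrightarrow> exec (While i P) s1 t2 s2 \<Longrightarrow>
    exec (While i P) s (bits (reg s i) + t1 + t2) s2"
| WhileFalse: "reg s i = 0 \<Longrightarrow> exec (While i P) s (bits (reg s i)) s"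

text \<open>
  The input is a list of numbers placed at the memory addresses \<open>0, 1, \<dots>\<close>, its length being stored
  in register 0; everything else is initially 0. The output is read off the final memory.
\<close>

definition initial_state :: "nat list \<Rightarrow> state" where
  "initial_state xs =
     \<lparr>reg = (\<lambda>i. if i = 0 then length xs else 0),
      mem = (\<lambda>i. if i < length xs then xs ! i else 0)\<rparr>"

definition computes_within :: "program \<Rightarrow> nat list \<Rightarrow> real \<Rightarrow> ((nat \<Rightarrow> nat) \<Rightarrow> bool) \<Rightarrow> bool" where
  "computes_within P xs T correct \<longleftrightarrow>
     (\<exists>t s. exec P (initial_state xs) t s \<and> real t \<le> T \<and> correct (mem s))"


section \<open>Satisfiability and the Strong Exponential-Time Hypothesis\<close>

text \<open>The literal \<open>(x, True)\<close> is the variable \<open>x\<close>, and \<open>(x, False)\<close> is its negation.\<close>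

type_synonym literal = "nat \<times> bool"
type_synonym clause = "literal list"
type_synonym cnf = "clause list"

definition k_cnf :: "nat \<Rightarrow> nat \<Rightarrow> cnf \<Rightarrow> bool" where
  "k_cnf k n F \<longleftrightarrow> (\<forall>C\<in>set F. length C \<le> k \<and> (\<forall>(x, b)\<in>set C. x < n))"

definition satisfiable :: "cnf \<Rightarrow> bool" where
  "satisfiable F \<longleftrightarrow> (\<exists>\<sigma> :: nat \<Rightarrow> bool. \<forall>C\<in>set F. \<exists>(x, b)\<in>set C. \<sigma> x = b)"

definition encode_clause :: "clause \<Rightarrow> nat list" where
  "encode_clause C = length C # map (\<lambda>(x, b). 2 * x + of_bool b) C"

definition encode_cnf :: "nat \<Rightarrow> cnf \<Rightarrow> nat list" where
  "encode_cnf n F = n # length F # concat (map encode_clause F)"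

definition solves_k_sat :: "nat \<Rightarrow> program \<Rightarrow> (nat \<Rightarrow> nat \<Rightarrow> real) \<Rightarrow> bool" where
  "solves_k_sat k P T \<longleftrightarrow>
     (\<forall>n F. k_cnf k n F \<and> F \<noteq> [] \<longrightarrow>
        computes_within P (encode_cnf n F) (T n (length F))
          (\<lambda>M. M 0 = of_bool (satisfiable F)))"

definition SETH :: bool where
  "SETH \<longleftrightarrow>
     (\<forall>\<epsilon>::real. \<epsilon> > 0 \<longrightarrow>
        (\<exists>k\<ge>3. \<not> (\<exists>P (K::real) (d::nat).
           solves_k_sat k P (\<lambda>n m. K * 2 powr ((1 - \<epsilon>) * real n) * real m ^ d))))"


section \<open>Flows in node-capacitated undirected graphs\<close>

text \<open>
  \<open>f u v\<close> is the amount of flow sent from \<open>u\<close> to \<open>v\<close> along the undirected edge \<open>{u, v}\<close>. By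
  conservation, the flow passing through an inner node is its total inflow.
\<close>

definition is_flow ::
  "'a set \<Rightarrow> 'a set set \<Rightarrow> ('a \<Rightarrow> real) \<Rightarrow> 'a \<Rightarrow> 'a \<Rightarrow> ('a \<Rightarrow> 'a \<Rightarrow> real) \<Rightarrow> bool" where
  "is_flow V E c s t f \<longleftrightarrow>
     (\<forall>u v. 0 \<le> f u v) \<and>
     (\<forall>u v. {u, v} \<notin> E \<longrightarrow> f u v = 0) \<and>
     (\<forall>v\<in>V - {s, t}. (\<Sum>u\<in>V. f u v) = (\<Sum>u\<in>V. f v u) \<and> (\<Sum>u\<in>V. f u v) \<le> c v)"

definition flow_value :: "'a set \<Rightarrow> 'a \<Rightarrow> ('a \<Rightarrow> 'a \<Rightarrow> real) \<Rightarrow> real" where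
  "flow_value V s f = (\<Sum>v\<in>V. f s v) - (\<Sum>v\<in>V. f v s)"

text \<open>
  The value is \<open>\<infinity>\<close> exactly when \<open>s\<close> and \<open>t\<close> are adjacent, since edges are uncapacitated;
  otherwise the supremum is attained.
\<close>

definition max_flow :: "'a set \<Rightarrow> 'a set set \<Rightarrow> ('a \<Rightarrow> real) \<Rightarrow> 'a \<Rightarrow> 'a \<Rightarrow> ereal" where
  "max_flow V E c s t = (SUP f\<in>{f. is_flow V E c s t f}. ereal (flow_value V s f))"


section \<open>All-Pairs Max-Flow\<close>

text \<open>
  An instance consists of the number \<open>n\<close> of nodes \<open>0, \<dots>, n - 1\<close>, a list of the edges (each edge
  once, in either orientation), and the list of the \<open>n\<close> node capacities.
\<close>

definition edge_set :: "(nat \<times> nat) list \<Rightarrow> nat set set" where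
  "edge_set es = (\<lambda>(u, v). {u, v}) ` set es"

definition simple_graph :: "nat \<Rightarrow> (nat \<times> nat) list \<Rightarrow> bool" where
  "simple_graph n es \<longleftrightarrow>
     (\<forall>(u, v)\<in>set es. u < n \<and> v < n \<and> u \<noteq> v) \<and> distinct (map (\<lambda>(u, v). {u, v}) es)"

definition encode_network :: "nat \<Rightarrow> (nat \<times> nat) list \<Rightarrow> nat list \<Rightarrow> nat list" where
  "encode_network n es cs = n # length es # cs @ concat (map (\<lambda>(u, v). [u, v]) es)"

fun decode_value :: "nat \<Rightarrow> ereal" where
  "decode_value 0 = \<infinity>"
| "decode_value (Suc x) = ereal (real x)"

definition all_pairs_output :: "nat \<Rightarrow> (nat \<times> nat) list \<Rightarrow> nat list \<Rightarrow> (nat \<Rightarrow> nat) \<Rightarrow> bool" where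
  "all_pairs_output n es cs M \<longleftrightarrow>
     (\<forall>s<n. \<forall>t<n. s \<noteq> t \<longrightarrow>
        decode_value (M (s * n + t)) =
          max_flow {..<n} (edge_set es) (\<lambda>v. real (cs ! v)) s t)"

text \<open>
  \<open>P\<close> solves the problem within \<open>T n\<close> steps on all graphs with \<open>n\<close> nodes, at most \<open>a * n\<close> edges
  and capacities in \<open>{1..b * n\<^sup>2}\<close>; it need not do anything sensible on other inputs.
\<close>

definition solves_all_pairs_max_flow :: "nat \<Rightarrow> nat \<Rightarrow> program \<Rightarrow> (nat \<Rightarrow> real) \<Rightarrow> bool" where
  "solves_all_pairs_max_flow a b P T \<longleftrightarrow>
     (\<forall>n es cs.
        simple_graph n es \<and> length es \<le> a * n \<and>
        length cs = n \<and> set cs \<subseteq> {1..b * n\<^sup>2} \<longrightarrow>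
        computes_within P (encode_network n es cs) (T n) (all_pairs_output n es cs))"

end

theory Submission
  imports Defs "HOL-Real_Asymp.Real_Asymp"
begin

text \<open>
  Split the variables into three blocks of about \<open>n / 3\<close> and let \<open>N = 2 ^ q\<close> be the number of
  assignments of a block. The network has a source node for every assignment \<open>a\<close> of the first block,
  a sink node for every assignment \<open>g\<close> of the second, a node of capacity \<open>2 * N\<close> for every
  assignment \<open>b\<close> of the third, and a node of capacity \<open>2 * N\<^sup>2\<close> for every clause. The sources are
  joined to the clauses that they satisfy, the sinks and the middle nodes to the clauses that they
  violate, and a hub joins every source to every middle node. In the flow from \<open>a\<close> to \<open>g\<close>, a clause
  satisfied by \<open>a\<close> but not by \<open>g\<close> is saturated by a path of length two. A middle node \<open>b\<close> can
  contribute its \<open>2 * N\<close> units, through the hub and a clause violated by \<open>a\<close>, \<open>b\<close> and \<open>g\<close>, exactly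
  when the three assignments together do not satisfy the formula. All other sources and sinks have
  capacity 1, so they can divert less than \<open>2 * N\<close> units in total, and the flow value tells whether
  every \<open>b\<close> contributes. The network has \<open>O(N m)\<close> nodes and edges for \<open>m\<close> clauses, so an algorithm
  with running time \<open>O(n powr (3 - \<epsilon>))\<close> yields one for SAT with running time
  \<open>2 powr ((1 - \<epsilon> / 3) * n)\<close> up to polynomial factors.
\<close>

section \<open>Compiling expressions and loops with bounds on the logarithmic cost\<close>

text \<open>The hub, and any single clause, may have to carry the contributions of all
  \<open>N\<close> middle nodes at once, \<open>2 * N\<close> units each; this is the origin of the
  capacity \<open>2 * N * N\<close>. The same capacity makes the direct paths contribute a known
  amount, \<open>2 * N * N\<close> per directly usable clause, so the threshold for a pair is
  computable from two bit masks. The main obstacle is that the reduction must itself be a program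
  with a proved logarithmic cost. Numbers are unbounded, so the whole input fits into one variable
  of at most \<open>B\<close> bits, where \<open>B\<close> is polynomial in the input size;
  straight-line code then costs a constant times \<open>B\<close>, and each loop over the input
  contributes one more factor \<open>B\<close>. The constants must depend on the program text only,
  so they are computed from it by functions such as \<open>cost\<close>. The time bound in SETH
  allows a power of \<open>m\<close> but none of \<open>n\<close>. The factor
  \<open>(n + 1) ^ 8\<close> caused by the bit lengths is therefore absorbed into the exponential,
  which gives up half of the saving, while the power of \<open>k\<close> disappears in the
  constant.\<close>

datatype exp = Var nat | Num nat | Op arith_op exp exp

abbreviation exp_plus (infixl "\<oplus>" 65) where "a \<oplus> b \<equiv> Op Plus a b"
abbreviation exp_monus (infixl "\<ominus>" 65) where "a \<ominus> b \<equiv> Op Monus a b"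
abbreviation exp_times (infixl "\<otimes>" 70) where "a \<otimes> b \<equiv> Op Times a b"
abbreviation exp_div (infixl "\<oslash>" 70) where "a \<oslash> b \<equiv> Op Div a b"
abbreviation exp_mod (infixl "\<odot>" 70) where "a \<odot> b \<equiv> Op Mod a b"

primrec val :: "exp \<Rightarrow> (nat \<Rightarrow> nat) \<Rightarrow> nat" where
  "val (Var i) v = v i"
| "val (Num k) v = k"
| "val (Op f a b) v = arith f (val a v) (val b v)"

primrec exp_vars :: "exp \<Rightarrow> nat set" where
  "exp_vars (Var i) = {i}"
| "exp_vars (Num k) = {}"
| "exp_vars (Op f a b) = exp_vars a \<union> exp_vars b"

primrec depth :: "exp \<Rightarrow> nat" where
  "depth (Var i) = 1"
| "depth (Num k) = 1"
| "depth (Op f a b) = Suc (max (depth a) (depth b))"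

text \<open>Evaluation on a stack of registers: the value ends up in register \<open>t\<close>, and
  only the registers from \<open>t\<close> to \<open>t + depth e - 1\<close> are written. Adding
  zero serves as the missing move instruction.\<close>

primrec exp_code :: "exp \<Rightarrow> nat \<Rightarrow> program" where
  "exp_code (Var i) t = Seq (Const t 0) (Arith Plus t i t)"
| "exp_code (Num k) t = Const t k"
| "exp_code (Op f a b) t = Seq (exp_code a t) (Seq (exp_code b (Suc t)) (Arith f t t (Suc t)))"

text \<open>Bit lengths are tracked as multiples of a common unit \<open>B\<close>: variable \<open>i\<close> is below
  \<open>2 ^ (\<mu> i * B)\<close>.\<close>

primrec exp_bits :: "exp \<Rightarrow> (nat \<Rightarrow> nat) \<Rightarrow> nat" where
  "exp_bits (Var i) \<mu> = \<mu> i"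
| "exp_bits (Num k) \<mu> = bits k"
| "exp_bits (Op f a b) \<mu> = exp_bits a \<mu> + exp_bits b \<mu>"

primrec exp_cost :: "exp \<Rightarrow> (nat \<Rightarrow> nat) \<Rightarrow> nat" where
  "exp_cost (Var i) \<mu> = 2 + \<mu> i"
| "exp_cost (Num k) \<mu> = bits k"
| "exp_cost (Op f a b) \<mu> = exp_cost a \<mu> + exp_cost b \<mu> + exp_bits a \<mu> + exp_bits b \<mu>"

lemma bits_le: "x < 2 ^ n \<Longrightarrow> 1 \<le> n \<Longrightarrow> bits x \<le> n"
  unfolding bits_def by (simp add: floorlog_leI)

lemma less_two_power_bits: "x < 2 ^ bits x"
proof (cases "x = 0")
  case False
  then have "x < 2 ^ floorlog 2 x"
    using floorlog_bounds[of x 2] by simp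
  also have "\<dots> \<le> 2 ^ bits x"
    unfolding bits_def by (intro power_increasing) auto
  finally show ?thesis .
qed simp

lemma bits_ge_1: "1 \<le> bits x"
  unfolding bits_def by simp

lemma bits_0 [simp]: "bits 0 = 1"
  unfolding bits_def by (simp add: floorlog_def)

lemma bits_1 [simp]: "bits (Suc 0) = 1"
  unfolding bits_def by (simp add: floorlog_def)

text \<open>Only sum and product can exceed their operands, and
  \<open>2 ^ a + 2 ^ b \<le> 2 ^ a * 2 ^ b\<close> once both powers are at least 2. Hence a single
  rule, adding bit lengths, serves all five operations.\<close>

lemma arith_less:
  assumes "x < 2 ^ a" "y < 2 ^ b" "1 \<le> a" "1 \<le> b"
  shows "arith f x y < 2 ^ (a + b)"
proof -
  have a: "(2::nat) ^ a \<le> 2 ^ (a + b)" by (intro power_increasing) auto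
  have p: "(2::nat) \<le> 2 ^ a" "(2::nat) \<le> 2 ^ b"
    using power_increasing[of 1 a "2::nat"] power_increasing[of 1 b "2::nat"] assms by auto
  have "x + y < 2 ^ (a + b)"
  proof -
    have "x + y < 2 ^ a + 2 ^ b" using assms by simp
    also obtain c d where "(2::nat) ^ a = 2 + c" "(2::nat) ^ b = 2 + d"
      using p by (metis le_iff_add)
    then have "(2::nat) ^ a + 2 ^ b \<le> 2 ^ (a + b)"
      by (simp add: power_add algebra_simps)
    finally show ?thesis .
  qed
  moreover have "x * y < 2 ^ (a + b)"
    unfolding power_add using assms by (intro mult_strict_mono') auto
  moreover have "x - y \<le> x" "x div y \<le> x" "x mod y \<le> x" by auto
  ultimately show ?thesis using a assms(1) by (cases f; simp; linarith)
qed

lemma exp_bits_ge_1: "(\<And>i. 1 \<le> \<mu> i) \<Longrightarrow> 1 \<le> exp_bits e \<mu>"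
  by (induction e) (auto simp: bits_ge_1[simplified] trans_le_add1)

lemma val_less:
  assumes "1 \<le> B" "\<And>i. 1 \<le> \<mu> i" "\<And>i. i \<in> exp_vars e \<Longrightarrow> v i < 2 ^ (\<mu> i * B)"
  shows "val e v < 2 ^ (exp_bits e \<mu> * B)"
  using assms(3)
proof (induction e)
  case (Num k)
  have "k < 2 ^ bits k" by (rule less_two_power_bits)
  also have "\<dots> \<le> 2 ^ (bits k * B)" using assms(1) by (intro power_increasing) auto
  finally show ?case by simp
next
  case (Op f a b)
  have "1 \<le> exp_bits a \<mu> * B" "1 \<le> exp_bits b \<mu> * B"
    using exp_bits_ge_1[of \<mu>] assms(1,2) by (simp_all add: Suc_le_eq)
  then show ?case using Op arith_less[of "val a v" "exp_bits a \<mu> * B" "val b v" "exp_bits b \<mu> * B" f]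
    by (simp add: add_mult_distrib)
qed simp

lemma val_cong: "(\<And>i. i \<in> exp_vars e \<Longrightarrow> v i = w i) \<Longrightarrow> val e v = val e w"
  by (induction e) auto

text \<open>Variables lie below 30 and temporaries at or above it, so computing the first operand
  does not disturb the second; \<open>t + depth e \<le> 60\<close> keeps the temporaries away from
  the registers of the called algorithm.\<close>

lemma exec_exp_code:
  assumes "1 \<le> B" "\<And>i. 1 \<le> \<mu> i"
  shows "exp_vars e \<subseteq> {..<30} \<Longrightarrow> 30 \<le> t \<Longrightarrow> t + depth e \<le> 60 \<Longrightarrow>
    (\<And>i. i \<in> exp_vars e \<Longrightarrow> reg s i < 2 ^ (\<mu> i * B)) \<Longrightarrow>
    \<exists>c s'. exec (exp_code e t) s c s' \<and> c \<le> exp_cost e \<mu> * B \<and> reg s' t = val e (reg s) \<and>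
      (\<forall>i. i < t \<or> 60 \<le> i \<longrightarrow> reg s' i = reg s i) \<and> mem s' = mem s"
proof (induction e arbitrary: t s)
  case (Var j)
  let ?s = "s\<lparr>reg := (reg s)(t := 0)\<rparr>"
  have "exec (exp_code (Var j) t) s (bits 0 + (bits (reg ?s j) + bits (reg ?s t)))
      (?s\<lparr>reg := (reg ?s)(t := arith Plus (reg ?s j) (reg ?s t))\<rparr>)"
    unfolding exp_code.simps by (rule exec.Seq[OF exec.Const exec.Arith])
  moreover have "bits (reg s j) \<le> \<mu> j * B"
    using Var(4)[of j] assms by (intro bits_le) (auto simp: Suc_le_eq)
  ultimately show ?case using Var(1,2,3) assms(1)
    by (intro exI conjI) (assumption, auto simp: algebra_simps)
next
  case (Num k)
  have "exec (exp_code (Num k) t) s (bits k) (s\<lparr>reg := (reg s)(t := k)\<rparr>)"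
    unfolding exp_code.simps by (rule exec.Const)
  then show ?case using Num assms
    by (intro exI conjI) (assumption, auto)
next
  case (Op f a b)
  have "\<exists>c s'. exec (exp_code a t) s c s' \<and> c \<le> exp_cost a \<mu> * B \<and> reg s' t = val a (reg s) \<and>
      (\<forall>i. i < t \<or> 60 \<le> i \<longrightarrow> reg s' i = reg s i) \<and> mem s' = mem s"
    using Op.prems by (intro Op.IH(1)) auto
  then obtain c1 s1 where 1: "exec (exp_code a t) s c1 s1" "c1 \<le> exp_cost a \<mu> * B"
    "reg s1 t = val a (reg s)" "\<forall>i. i < t \<or> 60 \<le> i \<longrightarrow> reg s1 i = reg s i" "mem s1 = mem s"
    by blast
  have rb: "reg s1 i = reg s i" if "i \<in> exp_vars b" for i
  proof -
    have "i < 30" using that Op.prems(1) by auto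
    then show ?thesis using 1(4) Op.prems(2) by auto
  qed
  then have b: "val b (reg s1) = val b (reg s)" by (rule val_cong)
  have "\<exists>c s'. exec (exp_code b (Suc t)) s1 c s' \<and> c \<le> exp_cost b \<mu> * B \<and>
      reg s' (Suc t) = val b (reg s1) \<and>
      (\<forall>i. i < Suc t \<or> 60 \<le> i \<longrightarrow> reg s' i = reg s1 i) \<and> mem s' = mem s1"
    using Op.prems by (intro Op.IH(2)) (auto simp: rb)
  then obtain c2 s2 where 2: "exec (exp_code b (Suc t)) s1 c2 s2" "c2 \<le> exp_cost b \<mu> * B"
    "reg s2 (Suc t) = val b (reg s)" "\<forall>i. i < Suc t \<or> 60 \<le> i \<longrightarrow> reg s2 i = reg s1 i"
    "mem s2 = mem s1" unfolding b by blast
  have t: "reg s2 t = val a (reg s)" using 1 2 by simp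
  have ex: "exec (exp_code (Op f a b) t) s
      (c1 + (c2 + (bits (reg s2 t) + bits (reg s2 (Suc t)))))
      (s2\<lparr>reg := (reg s2)(t := arith f (reg s2 t) (reg s2 (Suc t)))\<rparr>)"
    unfolding exp_code.simps by (rule exec.Seq[OF 1(1) exec.Seq[OF 2(1) exec.Arith]])
  have "val a (reg s) < 2 ^ (exp_bits a \<mu> * B)" "val b (reg s) < 2 ^ (exp_bits b \<mu> * B)"
    using Op.prems assms by (auto intro!: val_less)
  moreover have "1 \<le> exp_bits a \<mu> * B" "1 \<le> exp_bits b \<mu> * B"
    using exp_bits_ge_1[of \<mu>] assms(1,2) by (simp_all add: Suc_le_eq)
  ultimately have "bits (reg s2 t) \<le> exp_bits a \<mu> * B" "bits (reg s2 (Suc t)) \<le> exp_bits b \<mu> * B"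
    using t 2(3) by (auto intro: bits_le)
  then have "c1 + (c2 + (bits (reg s2 t) + bits (reg s2 (Suc t)))) \<le> exp_cost (Op f a b) \<mu> * B"
    using 1 2 by (simp add: add_mult_distrib)
  with ex show ?case using 1 2 t Op.prems
    by (intro exI conjI) (assumption, auto)
qed

text \<open>Registers below 30 hold program variables, those from 30 to 59 intermediate results, and those
  from 60 on belong to the algorithm that the reduction calls.\<close>

definition vars :: "state \<Rightarrow> nat \<Rightarrow> nat" where
  "vars s i = (if i < 30 then reg s i else 0)"

lemma exp_code_vars:
  assumes "1 \<le> B" "\<And>i. 1 \<le> \<mu> i" "\<forall>i\<in>exp_vars e. i < 30" "depth e \<le> 20" "30 \<le> t" "t \<le> 40"
    "\<And>i. i \<in> exp_vars e \<Longrightarrow> vars s i < 2 ^ (\<mu> i * B)"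
  obtains c s' where "exec (exp_code e t) s c s'" "c \<le> exp_cost e \<mu> * B"
    "reg s' t = val e (vars s)" "bits (reg s' t) \<le> exp_bits e \<mu> * B"
    "\<forall>i. i < t \<or> 60 \<le> i \<longrightarrow> reg s' i = reg s i" "vars s' = vars s" "mem s' = mem s"
proof -
  have i: "vars s i = reg s i" if "i \<in> exp_vars e" for i
    using assms(3) that by (simp add: vars_def)
  have "\<exists>c s'. exec (exp_code e t) s c s' \<and> c \<le> exp_cost e \<mu> * B \<and> reg s' t = val e (reg s) \<and>
      (\<forall>i. i < t \<or> 60 \<le> i \<longrightarrow> reg s' i = reg s i) \<and> mem s' = mem s"
    using assms(3-6) assms(7)[unfolded i] by (intro exec_exp_code assms(1,2)) (auto simp: i)
  then obtain c s' where 1: "exec (exp_code e t) s c s'" "c \<le> exp_cost e \<mu> * B"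
    "reg s' t = val e (reg s)" "\<forall>i. i < t \<or> 60 \<le> i \<longrightarrow> reg s' i = reg s i" "mem s' = mem s"
    by blast
  have "vars s' = vars s" using 1(4) assms(5) by (auto simp: vars_def fun_eq_iff)
  moreover have v: "val e (reg s) = val e (vars s)" by (rule val_cong) (simp add: i)
  moreover have "bits (val e (vars s)) \<le> exp_bits e \<mu> * B"
    using val_less[OF assms(1,2,7), of e] exp_bits_ge_1[of \<mu> e] assms(1,2)
    by (intro bits_le) (auto simp: Suc_le_eq)
  ultimately show ?thesis using 1 by (intro that[of c s']) auto
qed

text \<open>A total-correctness triple with a cost bound, for exact initial values of variables and
  memory. Temporaries are unconstrained, whereas registers from 60 on are preserved: the called
  algorithm will need them to be still zero.\<close>

definition runs :: "program \<Rightarrow> (nat \<Rightarrow> nat) \<Rightarrow> (nat \<Rightarrow> nat) \<Rightarrow> nat \<Rightarrow>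
    ((nat \<Rightarrow> nat) \<Rightarrow> (nat \<Rightarrow> nat) \<Rightarrow> bool) \<Rightarrow> bool" where
  "runs P v m c Q \<longleftrightarrow> (\<forall>s. vars s = v \<and> mem s = m \<longrightarrow>
     (\<exists>t s'. exec P s t s' \<and> t \<le> c \<and> (\<forall>i\<ge>60. reg s' i = reg s i) \<and> Q (vars s') (mem s')))"

lemma runs_mono:
  assumes "runs P v m c Q" "c \<le> c'" "\<And>v' m'. Q v' m' \<Longrightarrow> Q' v' m'"
  shows "runs P v m c' Q'"
  unfolding runs_def
proof (intro allI impI)
  fix s assume "vars s = v \<and> mem s = m"
  then obtain t s' where "exec P s t s'" "t \<le> c" "\<forall>i\<ge>60. reg s' i = reg s i"
    "Q (vars s') (mem s')" using assms(1) unfolding runs_def by blast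
  then show "\<exists>t s'. exec P s t s' \<and> t \<le> c' \<and> (\<forall>i\<ge>60. reg s' i = reg s i) \<and>
      Q' (vars s') (mem s')"
    using assms(2,3) by (intro exI[of _ t] exI[of _ s']) auto
qed

lemma runs_Seq:
  assumes "runs P v m c Q" "\<And>v' m'. Q v' m' \<Longrightarrow> runs P' v' m' c' Q'"
  shows "runs (Seq P P') v m (c + c') Q'"
  unfolding runs_def
proof (intro allI impI)
  fix s assume "vars s = v \<and> mem s = m"
  then obtain t s1 where 1: "exec P s t s1" "t \<le> c" "\<forall>i\<ge>60. reg s1 i = reg s i"
    "Q (vars s1) (mem s1)" using assms(1) unfolding runs_def by blast
  then obtain t' s2 where "exec P' s1 t' s2" "t' \<le> c'" "\<forall>i\<ge>60. reg s2 i = reg s1 i"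
    "Q' (vars s2) (mem s2)" using assms(2) unfolding runs_def by blast
  then show "\<exists>t s'. exec (Seq P P') s t s' \<and> t \<le> c + c' \<and> (\<forall>i\<ge>60. reg s' i = reg s i) \<and>
      Q' (vars s') (mem s')"
    using 1 exec.Seq[of P s t s1 P' t' s2] by (metis add_mono)
qed

datatype stmt = Assign nat exp (infix "::=" 60) | Put exp exp

text \<open>The value is built in register 30 and copied to \<open>x\<close> only at the end, so
  \<open>e\<close> may read \<open>x\<close>.\<close>

primrec stmt_code :: "stmt \<Rightarrow> program" where
  "stmt_code (x ::= e) = Seq (exp_code e 30) (Seq (Const 31 0) (Arith Plus x 30 31))"
| "stmt_code (Put a e) = Seq (exp_code a 30) (Seq (exp_code e 31) (Store 30 31))"

primrec stmt_okay :: "stmt \<Rightarrow> bool" where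
  "stmt_okay (x ::= e) \<longleftrightarrow> x < 30 \<and> (\<forall>i\<in>exp_vars e. i < 30) \<and> depth e \<le> 20"
| "stmt_okay (Put a e) \<longleftrightarrow> (\<forall>i\<in>exp_vars a. i < 30) \<and> (\<forall>i\<in>exp_vars e. i < 30) \<and>
     depth a \<le> 20 \<and> depth e \<le> 20"

fun block :: "stmt list \<Rightarrow> program" where
  "block [] = Skip"
| "block (c # cs) = Seq (stmt_code c) (block cs)"

fun final_vars :: "stmt list \<Rightarrow> (nat \<Rightarrow> nat) \<Rightarrow> nat \<Rightarrow> nat" where
  "final_vars [] v = v"
| "final_vars ((x ::= e) # cs) v = final_vars cs (v(x := val e v))"
| "final_vars (Put a e # cs) v = final_vars cs v"

fun final_mem :: "stmt list \<Rightarrow> (nat \<Rightarrow> nat) \<Rightarrow> (nat \<Rightarrow> nat) \<Rightarrow> nat \<Rightarrow> nat" where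
  "final_mem [] v m = m"
| "final_mem ((x ::= e) # cs) v m = final_mem cs (v(x := val e v)) m"
| "final_mem (Put a e # cs) v m = final_mem cs v (m(val a v := val e v))"

fun live :: "stmt list \<Rightarrow> nat set" where
  "live [] = {}"
| "live ((x ::= e) # cs) = exp_vars e \<union> (live cs - {x})"
| "live (Put a e # cs) = exp_vars a \<union> exp_vars e \<union> live cs"

text \<open>Only the variables that are read before they are written need a bound at the entry of a
  straight-line block: each operation at most adds the bit lengths of its operands.\<close>

fun weighted_cost :: "stmt list \<Rightarrow> (nat \<Rightarrow> nat) \<Rightarrow> nat" where
  "weighted_cost [] \<mu> = 1"
| "weighted_cost ((x ::= e) # cs) \<mu> =
     exp_cost e \<mu> + exp_bits e \<mu> + 2 + weighted_cost cs (\<mu>(x := exp_bits e \<mu>))"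
| "weighted_cost (Put a e # cs) \<mu> =
     exp_cost a \<mu> + exp_cost e \<mu> + exp_bits a \<mu> + exp_bits e \<mu> + weighted_cost cs \<mu>"

text \<open>With weight 1 for every variable at entry, the cost is a number fixed by the program
  text; this is what makes all later bounds constants times powers of \<open>B\<close>.\<close>

definition cost :: "stmt list \<Rightarrow> nat" where
  "cost cs = weighted_cost cs (\<lambda>_. 1)"

lemma vars_write: "30 \<le> i \<Longrightarrow> vars (s\<lparr>reg := r(i := k)\<rparr>) = vars (s\<lparr>reg := r\<rparr>)"
  by (auto simp: vars_def fun_eq_iff)

lemma vars_write_var: "i < 30 \<Longrightarrow> vars (s\<lparr>reg := r(i := k)\<rparr>) = (vars (s\<lparr>reg := r\<rparr>))(i := k)"
  by (auto simp: vars_def fun_eq_iff)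

lemma vars_mem [simp]: "vars (s\<lparr>mem := m\<rparr>) = vars s"
  by (auto simp: vars_def fun_eq_iff)

lemma runs_assign:
  assumes "1 \<le> B" "\<And>i. 1 \<le> \<mu> i" "stmt_okay (x ::= e)" "\<And>i. i \<in> exp_vars e \<Longrightarrow> v i < 2 ^ (\<mu> i * B)"
  shows "runs (stmt_code (x ::= e)) v m ((exp_cost e \<mu> + exp_bits e \<mu> + 2) * B)
    (\<lambda>v' m'. v' = v(x := val e v) \<and> m' = m)"
  unfolding runs_def
proof (intro allI impI)
  fix s assume s: "vars s = v \<and> mem s = m"
  obtain c s1 where 1: "exec (exp_code e 30) s c s1" "c \<le> exp_cost e \<mu> * B"
    "reg s1 30 = val e (vars s)" "bits (reg s1 30) \<le> exp_bits e \<mu> * B"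
    "\<forall>i. i < 30 \<or> 60 \<le> i \<longrightarrow> reg s1 i = reg s i" "vars s1 = vars s" "mem s1 = mem s"
    using exp_code_vars[of B \<mu> e 30 s] assms s by auto
  let ?s = "s1\<lparr>reg := (reg s1)(31 := 0)\<rparr>"
  have "exec (stmt_code (x ::= e)) s (c + (bits 0 + (bits (reg ?s 30) + bits (reg ?s 31))))
      (?s\<lparr>reg := (reg ?s)(x := arith Plus (reg ?s 30) (reg ?s 31))\<rparr>)"
    unfolding stmt_code.simps by (rule exec.Seq[OF 1(1) exec.Seq[OF exec.Const exec.Arith]])
  then show "\<exists>t s'. exec (stmt_code (x ::= e)) s t s' \<and>
      t \<le> (exp_cost e \<mu> + exp_bits e \<mu> + 2) * B \<and> (\<forall>i\<ge>60. reg s' i = reg s i) \<and>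
      vars s' = v(x := val e v) \<and> mem s' = m"
    using 1 s assms(1,3)
    by (intro exI conjI) (assumption, auto simp: add_mult_distrib vars_write vars_write_var)
qed

lemma runs_put:
  assumes "1 \<le> B" "\<And>i. 1 \<le> \<mu> i" "stmt_okay (Put a e)"
    "\<And>i. i \<in> exp_vars a \<union> exp_vars e \<Longrightarrow> v i < 2 ^ (\<mu> i * B)"
  shows "runs (stmt_code (Put a e)) v m
    ((exp_cost a \<mu> + exp_cost e \<mu> + exp_bits a \<mu> + exp_bits e \<mu>) * B)
    (\<lambda>v' m'. v' = v \<and> m' = m(val a v := val e v))"
  unfolding runs_def
proof (intro allI impI)
  fix s assume s: "vars s = v \<and> mem s = m"
  obtain c s1 where 1: "exec (exp_code a 30) s c s1" "c \<le> exp_cost a \<mu> * B"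
    "reg s1 30 = val a (vars s)" "bits (reg s1 30) \<le> exp_bits a \<mu> * B"
    "\<forall>i. i < 30 \<or> 60 \<le> i \<longrightarrow> reg s1 i = reg s i" "vars s1 = vars s" "mem s1 = mem s"
    using exp_code_vars[of B \<mu> a 30 s] assms s by auto
  obtain c' s2 where 2: "exec (exp_code e 31) s1 c' s2" "c' \<le> exp_cost e \<mu> * B"
    "reg s2 31 = val e (vars s1)" "bits (reg s2 31) \<le> exp_bits e \<mu> * B"
    "\<forall>i. i < 31 \<or> 60 \<le> i \<longrightarrow> reg s2 i = reg s1 i" "vars s2 = vars s1" "mem s2 = mem s1"
    using exp_code_vars[of B \<mu> e 31 s1] assms s 1(6) by auto
  have "exec (stmt_code (Put a e)) s (c + (c' + (bits (reg s2 30) + bits (reg s2 31))))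
      (s2\<lparr>mem := (mem s2)(reg s2 30 := reg s2 31)\<rparr>)"
    unfolding stmt_code.simps by (rule exec.Seq[OF 1(1) exec.Seq[OF 2(1) exec.Store]])
  then show "\<exists>t s'. exec (stmt_code (Put a e)) s t s' \<and>
      t \<le> (exp_cost a \<mu> + exp_cost e \<mu> + exp_bits a \<mu> + exp_bits e \<mu>) * B \<and>
      (\<forall>i\<ge>60. reg s' i = reg s i) \<and> vars s' = v \<and> mem s' = m(val a v := val e v)"
    using 1 2 s by (intro exI conjI) (assumption, auto simp: add_mult_distrib)
qed

lemma runs_block_weighted:
  assumes "1 \<le> B"
  shows "(\<And>i. 1 \<le> \<mu> i) \<Longrightarrow> \<forall>c\<in>set cs. stmt_okay c \<Longrightarrow> (\<And>i. i \<in> live cs \<Longrightarrow> v i < 2 ^ (\<mu> i * B)) \<Longrightarrow>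
    runs (block cs) v m (weighted_cost cs \<mu> * B) (\<lambda>v' m'. v' = final_vars cs v \<and> m' = final_mem cs v m)"
proof (induction cs arbitrary: v m \<mu>)
  case Nil
  have "exec Skip s 1 s" for s by (rule exec.Skip)
  then show ?case using assms unfolding runs_def by fastforce
next
  case (Cons c cs)
  show ?case
  proof (cases c)
    case [simp]: (Assign x e)
    have *: "val e v < 2 ^ (exp_bits e \<mu> * B)" using Cons.prems assms by (auto intro!: val_less)
    have "runs (block (c # cs)) v m ((exp_cost e \<mu> + exp_bits e \<mu> + 2) * B +
        weighted_cost cs (\<mu>(x := exp_bits e \<mu>)) * B)
        (\<lambda>v' m'. v' = final_vars (c # cs) v \<and> m' = final_mem (c # cs) v m)"
      unfolding block.simps Assign
    proof (rule runs_Seq, rule runs_assign[OF assms Cons.prems(1)])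
      fix v' m' assume "v' = v(x := val e v) \<and> m' = m"
      moreover have "runs (block cs) (v(x := val e v)) m (weighted_cost cs (\<mu>(x := exp_bits e \<mu>)) * B)
        (\<lambda>v' m'. v' = final_vars cs (v(x := val e v)) \<and> m' = final_mem cs (v(x := val e v)) m)"
        using Cons.prems exp_bits_ge_1[of \<mu> e] * by (intro Cons.IH) auto
      ultimately show "runs (block cs) v' m' (weighted_cost cs (\<mu>(x := exp_bits e \<mu>)) * B)
        (\<lambda>v' m'. v' = final_vars ((x ::= e) # cs) v \<and> m' = final_mem ((x ::= e) # cs) v m)"
        by simp
    qed (use Cons.prems in auto)
    then show ?thesis by (rule runs_mono) (simp_all add: algebra_simps)
  next
    case [simp]: (Put a e)
    have "runs (block (c # cs)) v m
        ((exp_cost a \<mu> + exp_cost e \<mu> + exp_bits a \<mu> + exp_bits e \<mu>) * B + weighted_cost cs \<mu> * B)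
        (\<lambda>v' m'. v' = final_vars (c # cs) v \<and> m' = final_mem (c # cs) v m)"
      unfolding block.simps Put
    proof (rule runs_Seq, rule runs_put[OF assms Cons.prems(1)])
      fix v' m' assume "v' = v \<and> m' = m(val a v := val e v)"
      moreover have "runs (block cs) v (m(val a v := val e v)) (weighted_cost cs \<mu> * B)
        (\<lambda>v' m'. v' = final_vars cs v \<and> m' = final_mem cs v (m(val a v := val e v)))"
        using Cons.prems by (intro Cons.IH) auto
      ultimately show "runs (block cs) v' m' (weighted_cost cs \<mu> * B)
        (\<lambda>v' m'. v' = final_vars (Put a e # cs) v \<and> m' = final_mem (Put a e # cs) v m)"
        by simp
    qed (use Cons.prems in auto)
    then show ?thesis by (rule runs_mono) (simp_all add: algebra_simps)
  qed
qed

lemma runs_block: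
  assumes "1 \<le> B" "\<forall>c\<in>set cs. stmt_okay c" "\<forall>i\<in>live cs. v i < 2 ^ B"
    "Q (final_vars cs v) (final_mem cs v m)"
  shows "runs (block cs) v m (cost cs * B) Q"
  unfolding cost_def
  by (rule runs_mono[OF runs_block_weighted[OF assms(1), where \<mu> = "\<lambda>_. 1"]]) (use assms in auto)

text \<open>Kept apart from expressions and statements because the bit length of a memory cell does
  not follow from those of the operands; each use has to supply a bound for the cell.\<close>

definition fetch :: "nat \<Rightarrow> exp \<Rightarrow> program" where
  "fetch x e = Seq (exp_code e 30) (Seq (Load 30 30) (Seq (Const 31 0) (Arith Plus x 30 31)))"

definition fetch_cost :: "exp \<Rightarrow> nat" where
  "fetch_cost e = exp_cost e (\<lambda>_. 1) + exp_bits e (\<lambda>_. 1) + 4"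

lemma runs_fetch:
  assumes "1 \<le> B" "stmt_okay (x ::= e)" "\<forall>i\<in>exp_vars e. v i < 2 ^ B" "m (val e v) < 2 ^ B"
    "Q (v(x := m (val e v))) m"
  shows "runs (fetch x e) v m (fetch_cost e * B) Q"
  unfolding runs_def
proof (intro allI impI)
  fix s assume s: "vars s = v \<and> mem s = m"
  let ?\<mu> = "\<lambda>_::nat. 1 :: nat"
  obtain c s1 where 1: "exec (exp_code e 30) s c s1" "c \<le> exp_cost e ?\<mu> * B"
    "reg s1 30 = val e (vars s)" "bits (reg s1 30) \<le> exp_bits e ?\<mu> * B"
    "\<forall>i. i < 30 \<or> 60 \<le> i \<longrightarrow> reg s1 i = reg s i" "vars s1 = vars s" "mem s1 = mem s"
    using exp_code_vars[of B ?\<mu> e 30 s] assms s by auto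
  let ?s1 = "s1\<lparr>reg := (reg s1)(30 := mem s1 (reg s1 30))\<rparr>"
  let ?s2 = "?s1\<lparr>reg := (reg ?s1)(31 := 0)\<rparr>"
  have "exec (fetch x e) s (c + ((bits (reg s1 30) + bits (mem s1 (reg s1 30))) +
      (bits 0 + (bits (reg ?s2 30) + bits (reg ?s2 31)))))
      (?s2\<lparr>reg := (reg ?s2)(x := arith Plus (reg ?s2 30) (reg ?s2 31))\<rparr>)"
    unfolding fetch_def
    by (rule exec.Seq[OF 1(1) exec.Seq[OF exec.Load exec.Seq[OF exec.Const exec.Arith]]])
  moreover have "bits (m (val e v)) \<le> B" using assms by (intro bits_le)
  ultimately show "\<exists>t s'. exec (fetch x e) s t s' \<and>
      t \<le> fetch_cost e * B \<and> (\<forall>i\<ge>60. reg s' i = reg s i) \<and> Q (vars s') (mem s')"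
    using 1 s assms(1,2,5)
    by (intro exI conjI)
      (assumption, auto simp: add_mult_distrib fetch_cost_def vars_write vars_write_var)
qed

definition loop :: "nat \<Rightarrow> program \<Rightarrow> program" where
  "loop x P = While x (Seq P (stmt_code (x ::= Var x \<ominus> Num 1)))"

lemma runs_While_step:
  assumes "v x \<noteq> 0" "x < 30" "v x < 2 ^ B" "1 \<le> B" "runs P v m c Q"
    "\<And>v' m'. Q v' m' \<Longrightarrow> runs (While x P) v' m' c' Q'"
  shows "runs (While x P) v m (B + c + c') Q'"
  unfolding runs_def
proof (intro allI impI)
  fix s assume s: "vars s = v \<and> mem s = m"
  then have x: "reg s x = v x" using assms(2) by (auto simp: vars_def)
  obtain t s1 where 1: "exec P s t s1" "t \<le> c" "\<forall>i\<ge>60. reg s1 i = reg s i" "Q (vars s1) (mem s1)"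
    using assms(5) s unfolding runs_def by blast
  obtain t' s2 where 2: "exec (While x P) s1 t' s2" "t' \<le> c'" "\<forall>i\<ge>60. reg s2 i = reg s1 i"
    "Q' (vars s2) (mem s2)" using assms(6)[OF 1(4)] unfolding runs_def by blast
  have "exec (While x P) s (bits (reg s x) + t + t') s2"
    using assms(1) x 1 2 by (intro exec.WhileTrue) auto
  moreover have "bits (reg s x) \<le> B" using x assms by (intro bits_le) auto
  ultimately show "\<exists>t s'. exec (While x P) s t s' \<and> t \<le> B + c + c' \<and>
      (\<forall>i\<ge>60. reg s' i = reg s i) \<and> Q' (vars s') (mem s')"
    using 1 2 by (metis add_mono)
qed

text \<open>\<open>I j\<close> is the invariant with \<open>j\<close> rounds left. The body
  establishes it for the state with the counter already lowered, since \<open>loop\<close> appends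
  the decrement. Per round, \<open>12 * B\<close> covers the test (\<open>B\<close>) and the
  decrement (\<open>10 * B\<close>).\<close>

lemma runs_loop:
  assumes "1 \<le> B" "x < 30"
    and step: "\<And>k v m. k < n \<Longrightarrow> I (Suc k) v m \<Longrightarrow> v x = Suc k \<Longrightarrow>
      runs P v m c (\<lambda>v' m'. v' x = Suc k \<and> I k (v'(x := k)) m')"
    and "I n v m" "v x = n" "n < 2 ^ B"
  shows "runs (loop x P) v m (n * (c + 12 * B) + B) (\<lambda>v' m'. v' x = 0 \<and> I 0 v' m')"
  using step assms(4-6)
proof (induction n arbitrary: v m)
  case 0
  have "exec (loop x P) s (bits (reg s x)) s" if "reg s x = 0" for s
    unfolding loop_def using that by (rule exec.WhileFalse)
  moreover have "reg s x = vars s x" for s using assms(2) by (simp add: vars_def)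
  moreover have "bits 0 \<le> B" using assms(1) by simp
  ultimately show ?case using 0 unfolding runs_def by (metis trans_le_add2)
next
  case (Suc n)
  let ?body = "Seq P (stmt_code (x ::= Var x \<ominus> Num 1))"
  have c: "(exp_cost (Var x \<ominus> Num 1) (\<lambda>_. 1) + exp_bits (Var x \<ominus> Num 1) (\<lambda>_. 1) + 2) * B = 10 * B"
    by (simp add: bits_def floorlog_def)
  have "runs ?body v m (c + 10 * B) (\<lambda>v' m'. v' x = n \<and> I n v' m')"
  proof (rule runs_Seq)
    show "runs P v m c (\<lambda>v' m'. v' x = Suc n \<and> I n (v'(x := n)) m')"
      using Suc.prems by blast
    fix v' m' assume v': "v' x = Suc n \<and> I n (v'(x := n)) m'"
    show "runs (stmt_code (x ::= Var x \<ominus> Num 1)) v' m' (10 * B) (\<lambda>v' m'. v' x = n \<and> I n v' m')"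
      by (rule runs_mono[OF runs_assign[where \<mu> = "\<lambda>_. 1", OF assms(1)]])
        (use v' assms Suc.prems in \<open>auto simp: c[simplified]\<close>)
  qed
  then have "runs (While x ?body) v m (B + (c + 10 * B) + (n * (c + 12 * B) + B))
      (\<lambda>v' m'. v' x = 0 \<and> I 0 v' m')"
  proof (rule runs_While_step[rotated 4])
    fix v' m' assume v': "v' x = n \<and> I n v' m'"
    show "runs (While x ?body) v' m' (n * (c + 12 * B) + B) (\<lambda>v' m'. v' x = 0 \<and> I 0 v' m')"
      unfolding loop_def[symmetric]
    proof (rule Suc.IH)
      show "runs P v m c (\<lambda>v' m'. v' x = Suc k \<and> I k (v'(x := k)) m')"
        if "k < n" "I (Suc k) v m" "v x = Suc k" for k v m
        using that by (intro Suc.prems(1)) auto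
    qed (use v' Suc.prems in auto)
  qed (use Suc.prems assms(1,2) in auto)
  then show ?case unfolding loop_def by (rule runs_mono) (use assms in auto)
qed

section \<open>Running another program in shifted registers on the same memory\<close>

primrec shift :: "program \<Rightarrow> program" where
  "shift Skip = Skip"
| "shift (Const i k) = Const (i + 60) k"
| "shift (Arith f i j k) = Arith f (i + 60) (j + 60) (k + 60)"
| "shift (Load i j) = Load (i + 60) (j + 60)"
| "shift (Store i j) = Store (i + 60) (j + 60)"
| "shift (Seq P Q) = Seq (shift P) (shift Q)"
| "shift (Cond i P Q) = Cond (i + 60) (shift P) (shift Q)"
| "shift (While i P) = While (i + 60) (shift P)"

definition embeds :: "state \<Rightarrow> state \<Rightarrow> bool" where
  "embeds S s \<longleftrightarrow> (\<forall>i. reg S (i + 60) = reg s i) \<and> mem S = mem s"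

text \<open>A step-by-step simulation at equal cost, as costs depend on register contents and not on
  register numbers. The variables of the reduction, below 60, survive the call.\<close>

lemma exec_shift:
  assumes "exec P s t s'" "embeds S s"
  shows "\<exists>S'. exec (shift P) S t S' \<and> embeds S' s' \<and> (\<forall>i<60. reg S' i = reg S i)"
  using assms
proof (induction arbitrary: S rule: exec.induct)
  case (Skip s)
  then show ?case using exec.Skip[of S] by auto
next
  case (Const i k s)
  show ?case unfolding shift.simps
    by (rule exI, rule conjI, rule exec.Const) (use Const in \<open>auto simp: embeds_def\<close>)
next
  case (Arith f i j k s)
  have "exec (Arith f (i + 60) (j + 60) (k + 60)) S (bits (reg s j) + bits (reg s k))
      (S\<lparr>reg := (reg S)(i + 60 := arith f (reg S (j + 60)) (reg S (k + 60)))\<rparr>)"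
    using exec.Arith[of f "i + 60" "j + 60" "k + 60" S] Arith by (simp add: embeds_def)
  then show ?case unfolding shift.simps
    by (intro exI conjI, assumption) (use Arith in \<open>auto simp: embeds_def\<close>)
next
  case (Load i j s)
  have "exec (Load (i + 60) (j + 60)) S (bits (reg s j) + bits (mem s (reg s j)))
      (S\<lparr>reg := (reg S)(i + 60 := mem S (reg S (j + 60)))\<rparr>)"
    using exec.Load[of "i + 60" "j + 60" S] Load by (simp add: embeds_def)
  then show ?case unfolding shift.simps
    by (intro exI conjI, assumption) (use Load in \<open>auto simp: embeds_def\<close>)
next
  case (Store i j s)
  have "exec (Store (i + 60) (j + 60)) S (bits (reg s i) + bits (reg s j))
      (S\<lparr>mem := (mem S)(reg S (i + 60) := reg S (j + 60))\<rparr>)"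
    using exec.Store[of "i + 60" "j + 60" S] Store by (simp add: embeds_def)
  then show ?case unfolding shift.simps
    by (intro exI conjI, assumption) (use Store in \<open>auto simp: embeds_def\<close>)
next
  case (Seq P s t1 s1 Q t2 s2)
  obtain S1 where "exec (shift P) S t1 S1" "embeds S1 s1" "\<forall>i<60. reg S1 i = reg S i"
    using Seq.IH(1)[OF Seq.prems] by blast
  moreover then obtain S2 where "exec (shift Q) S1 t2 S2" "embeds S2 s2"
    "\<forall>i<60. reg S2 i = reg S1 i" using Seq.IH(2) by blast
  ultimately show ?case by (auto intro!: exI[of _ S2] intro: exec.Seq)
next
  case (CondTrue s i P t s' Q)
  obtain S1 where "exec (shift P) S t S1" "embeds S1 s'" "\<forall>i<60. reg S1 i = reg S i"
    using CondTrue.IH[OF CondTrue.prems] by blast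
  moreover have "reg S (i + 60) = reg s i" using CondTrue.prems by (simp add: embeds_def)
  ultimately show ?case using CondTrue.hyps exec.CondTrue[of S "i + 60"]
    by (intro exI[of _ S1]) auto
next
  case (CondFalse s i Q t s' P)
  obtain S1 where "exec (shift Q) S t S1" "embeds S1 s'" "\<forall>i<60. reg S1 i = reg S i"
    using CondFalse.IH[OF CondFalse.prems] by blast
  moreover have "reg S (i + 60) = reg s i" using CondFalse.prems by (simp add: embeds_def)
  ultimately show ?case using CondFalse.hyps exec.CondFalse[of S "i + 60" "shift Q" t S1]
    by (intro exI[of _ S1]) auto
next
  case (WhileTrue s i P t1 s1 t2 s2)
  obtain S1 where 1: "exec (shift P) S t1 S1" "embeds S1 s1" "\<forall>i<60. reg S1 i = reg S i"
    using WhileTrue.IH(1)[OF WhileTrue.prems] by blast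
  then obtain S2 where 2: "exec (shift (While i P)) S1 t2 S2" "embeds S2 s2"
    "\<forall>i<60. reg S2 i = reg S1 i" using WhileTrue.IH(2) by blast
  have "reg S (i + 60) = reg s i" using WhileTrue.prems by (simp add: embeds_def)
  with 1 2 WhileTrue.hyps exec.WhileTrue[of S "i + 60" "shift P" t1 S1 t2 S2] show ?case
    by (intro exI[of _ S2]) auto
next
  case (WhileFalse s i P)
  have "reg S (i + 60) = reg s i" using WhileFalse.prems by (simp add: embeds_def)
  with WhileFalse exec.WhileFalse[of S "i + 60" "shift P"] show ?case
    by (intro exI[of _ S]) auto
qed

section \<open>Cuts and path packings\<close>

text \<open>Summing conservation over \<open>S\<close> turns the flow value into the net outflow of
  \<open>S\<close>: flow inside \<open>S\<close> cancels, flow back into \<open>S\<close> only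
  lowers it, and whatever leaves \<open>S\<close> must enter \<open>X\<close>, whose inflow is
  bounded by capacities because \<open>X\<close> avoids \<open>s\<close> and
  \<open>t\<close>.\<close>

lemma flow_value_le_cut:
  assumes "finite V" and flow: "is_flow V E c s t f"
    and S: "S \<subseteq> V" "s \<in> S" "t \<notin> S" and X: "X \<subseteq> V - {s, t}"
    and closed: "\<And>u v. u \<in> S \<Longrightarrow> v \<in> V \<Longrightarrow> {u, v} \<in> E \<Longrightarrow> v \<in> S \<union> X"
  shows "flow_value V s f \<le> sum c X"
proof -
  have nonneg: "0 \<le> f u v" for u v using flow by (auto simp: is_flow_def)
  have fin: "finite S" "finite X" using assms(1) S X by (auto intro: finite_subset)
  \<comment> \<open>Each node of \<open>S\<close> other than \<open>s\<close> is an inner node, as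
    \<open>t\<close> is outside \<open>S\<close>, and so has net outflow zero.\<close>
  have "flow_value V s f = (\<Sum>u\<in>S. if u = s then flow_value V s f else 0)"
    using S fin by simp
  also have "\<dots> = (\<Sum>u\<in>S. (\<Sum>v\<in>V. f u v) - (\<Sum>v\<in>V. f v u))"
  proof (rule sum.cong)
    fix u assume "u \<in> S"
    then have "u \<noteq> s \<Longrightarrow> u \<in> V - {s, t}" using S by auto
    then show "(if u = s then flow_value V s f else 0) = (\<Sum>v\<in>V. f u v) - (\<Sum>v\<in>V. f v u)"
      using flow unfolding is_flow_def flow_value_def by auto
  qed simp
  also have "\<dots> = (\<Sum>u\<in>S. (\<Sum>v\<in>S. f u v) + (\<Sum>v\<in>V - S. f u v)) -
      (\<Sum>u\<in>S. (\<Sum>v\<in>S. f v u) + (\<Sum>v\<in>V - S. f v u))"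
    using assms(1) S(1) by (simp add: sum_subtractf sum.subset_diff add.commute)
  also have "\<dots> = (\<Sum>u\<in>S. \<Sum>v\<in>V - S. f u v) - (\<Sum>u\<in>S. \<Sum>v\<in>V - S. f v u)"
    using sum.swap[of f S S] by (simp add: sum.distrib)
  also have "\<dots> \<le> (\<Sum>u\<in>S. \<Sum>v\<in>V - S. f u v)"
    using nonneg by (simp add: sum_nonneg)
  also have "\<dots> \<le> (\<Sum>u\<in>S. \<Sum>v\<in>X. f u v)"
  proof (rule sum_mono)
    fix u assume u: "u \<in> S"
    have "(\<Sum>v\<in>V - S. f u v) = (\<Sum>v\<in>(V - S) \<inter> X. f u v)"
    proof (rule sum.mono_neutral_right)
      show "\<forall>v\<in>V - S - (V - S) \<inter> X. f u v = 0"
        using closed[OF u] flow unfolding is_flow_def by blast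
    qed (use assms(1) in auto)
    also have "\<dots> \<le> (\<Sum>v\<in>X. f u v)"
      using fin nonneg by (intro sum_mono2) auto
    finally show "(\<Sum>v\<in>V - S. f u v) \<le> (\<Sum>v\<in>X. f u v)" .
  qed
  also have "\<dots> = (\<Sum>v\<in>X. \<Sum>u\<in>S. f u v)" by (rule sum.swap)
  also have "\<dots> \<le> (\<Sum>v\<in>X. \<Sum>u\<in>V. f u v)"
    using assms(1) S nonneg by (intro sum_mono sum_mono2) auto
  also have "\<dots> \<le> sum c X"
    using flow X unfolding is_flow_def by (intro sum_mono) auto
  finally show ?thesis .
qed

abbreviation steps :: "'a list \<Rightarrow> ('a \<times> 'a) set" where
  "steps p \<equiv> set (zip p (tl p))"

text \<open>On a path without repetitions a node has at most one predecessor, and only the first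
  node has none.\<close>

lemma sum_steps_into:
  assumes "finite V" "distinct p" "set p \<subseteq> V"
  shows "(\<Sum>u\<in>V. of_bool ((u, v) \<in> steps p)) = (of_bool (v \<in> set (tl p)) :: real)"
  using assms(2,3)
proof (induction p rule: induct_list012)
  case (3 x y zs)
  have n: "(u, y) \<notin> set (zip (y # zs) zs)" for u
    using 3(3) by (auto dest: set_zip_rightD)
  have "(\<Sum>u\<in>V. of_bool ((u, v) \<in> steps (x # y # zs))) =
      (\<Sum>u\<in>V. (if u = x then of_bool (v = y) else 0) + of_bool ((u, v) \<in> steps (y # zs)) :: real)"
    using n by (intro sum.cong) auto
  also have "\<dots> = of_bool (v = y) + of_bool (v \<in> set zs)"
    using 3 assms(1) by (simp add: sum.distrib)
  also have "\<dots> = of_bool (v \<in> set (tl (x # y # zs)))" using 3(3) by auto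
  finally show ?case .
qed auto

lemma sum_steps_out_of:
  assumes "finite V" "distinct p" "set p \<subseteq> V"
  shows "(\<Sum>u\<in>V. of_bool ((v, u) \<in> steps p)) = (of_bool (v \<in> set (butlast p)) :: real)"
  using assms(2,3)
proof (induction p rule: induct_list012)
  case (3 x y zs)
  have n: "(x, u) \<notin> set (zip (y # zs) zs)" for u
    using 3(3) by (auto dest: set_zip_leftD)
  have "(\<Sum>u\<in>V. of_bool ((v, u) \<in> steps (x # y # zs))) =
      (\<Sum>u\<in>V. (if u = y then of_bool (v = x) else 0) + of_bool ((v, u) \<in> steps (y # zs)) :: real)"
    using n by (intro sum.cong) auto
  also have "\<dots> = of_bool (v = x) + of_bool (v \<in> set (butlast (y # zs)))"
    using 3 assms(1) by (simp add: sum.distrib)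
  also have "\<dots> = of_bool (v \<in> set (butlast (x # y # zs)))"
    using 3(3) in_set_butlastD[of v "y # zs"] by auto
  finally show ?case .
qed auto

text \<open>The flow is the superposition of the paths with weights \<open>w\<close>. An inner node
  of a simple path lies both in its tail and in its \<open>butlast\<close>, which gives conservation
  and identifies the inflow with the weight of the paths through the node.\<close>

lemma path_packing_le_max_flow:
  fixes w :: "'i \<Rightarrow> real"
  assumes "finite V" "finite I" "s \<noteq> t"
    and w: "\<And>i. i \<in> I \<Longrightarrow> 0 \<le> w i"
    and path: "\<And>i. i \<in> I \<Longrightarrow> distinct (p i) \<and> set (p i) \<subseteq> V \<and> p i \<noteq> [] \<and>
      hd (p i) = s \<and> last (p i) = t \<and> (\<forall>(u, v)\<in>steps (p i). {u, v} \<in> E)"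
    and capacity: "\<And>v. v \<in> V - {s, t} \<Longrightarrow> (\<Sum>i\<in>I. if v \<in> set (p i) then w i else 0) \<le> c v"
  shows "ereal (sum w I) \<le> max_flow V E c s t"
proof -
  define f where "f u v = (\<Sum>i\<in>I. w i * of_bool ((u, v) \<in> steps (p i)))" for u v
  have into: "(\<Sum>u\<in>V. f u v) = (\<Sum>i\<in>I. w i * of_bool (v \<in> set (tl (p i))))" for v
    unfolding f_def using path
    by (subst sum.swap)
      (auto simp only: sum_distrib_left[symmetric] sum_steps_into[OF assms(1)] intro!: sum.cong)
  have out: "(\<Sum>u\<in>V. f v u) = (\<Sum>i\<in>I. w i * of_bool (v \<in> set (butlast (p i))))" for v
    unfolding f_def using path
    by (subst sum.swap)
      (auto simp only: sum_distrib_left[symmetric] sum_steps_out_of[OF assms(1)] intro!: sum.cong)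
  have split: "\<exists>q. p i = s # q @ [t]" if "i \<in> I" for i
  proof -
    note i = path[OF that]
    obtain q where q: "p i = s # q" using i by (cases "p i") auto
    then have "q \<noteq> []" using i assms(3) by auto
    then show ?thesis using q i by (cases q rule: rev_cases) auto
  qed
  have "is_flow V E c s t f"
    unfolding is_flow_def
  proof (intro conjI allI impI ballI)
    show "0 \<le> f u v" for u v unfolding f_def using w by (auto intro: sum_nonneg)
    show "f u v = 0" if "{u, v} \<notin> E" for u v
      unfolding f_def using that path by (intro sum.neutral) fastforce
  next
    fix v assume v: "v \<in> V - {s, t}"
    then have *: "v \<in> set (tl (p i)) \<longleftrightarrow> v \<in> set (p i)" "v \<in> set (butlast (p i)) \<longleftrightarrow> v \<in> set (p i)"
      if "i \<in> I" for i using split[OF that] by (auto simp: butlast_append)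
    have **: "w i * of_bool b = (if b then w i else 0)" for i b by simp
    show "(\<Sum>u\<in>V. f u v) = (\<Sum>u\<in>V. f v u)" unfolding into out using * by simp
    show "(\<Sum>u\<in>V. f u v) \<le> c v"
      unfolding into using * capacity[OF v] by (simp add: ** cong: sum.cong if_cong)
  qed
  moreover have "flow_value V s f = sum w I"
  proof -
    have "s \<in> set (butlast (p i)) \<and> s \<notin> set (tl (p i))" if "i \<in> I" for i
    proof -
      obtain q where q: "p i = s # q @ [t]" using split[OF \<open>i \<in> I\<close>] by blast
      moreover have "distinct (p i)" using path[OF that] by blast
      ultimately show ?thesis by (simp add: butlast_append)
    qed
    then show ?thesis unfolding flow_value_def into out by simp
  qed
  ultimately show ?thesis unfolding max_flow_def by (metis (mono_tags) SUP_upper mem_Collect_eq)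
qed

lemma max_flow_le_cut:
  assumes "finite V" "S \<subseteq> V" "s \<in> S" "t \<notin> S" "X \<subseteq> V - {s, t}"
    and "\<And>u v. u \<in> S \<Longrightarrow> v \<in> V \<Longrightarrow> {u, v} \<in> E \<Longrightarrow> v \<in> S \<union> X"
  shows "max_flow V E c s t \<le> ereal (sum c X)"
  unfolding max_flow_def
  by (rule SUP_least) (use flow_value_le_cut[OF assms(1) _ assms(2-)] in auto)

section \<open>The network\<close>

text \<open>
  The nodes below \<open>N\<close> are the sources, those in \<open>{N..<2 * N}\<close> the sinks, those in
  \<open>{2 * N..<3 * N}\<close> the middle nodes, followed by \<open>M\<close> columns, namely the clauses and the hub.
  So that the position of every edge in the list is a fixed arithmetic expression, a row is joined
  to a leaf of its own in place of every column to which it is not joined.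
\<close>

locale network =
  fixes N M :: nat and sat :: "nat \<Rightarrow> nat \<Rightarrow> bool" and hub :: nat
  assumes N: "1 \<le> N" and hub: "hub < M" and sat_hub: "\<And>x. x < 3 * N \<Longrightarrow> sat x hub \<longleftrightarrow> x < 2 * N"
begin

text \<open>The hub counts as one more clause, satisfied exactly by sources and sinks. The rule for
  clauses then produces its edges without a special case: it is joined to sources and middle nodes
  but to no sink.\<close>

definition wired :: "nat \<Rightarrow> nat \<Rightarrow> bool" where
  "wired x j \<longleftrightarrow> (if x < N then sat x j else \<not> sat x j)"

definition target :: "nat \<Rightarrow> nat \<Rightarrow> nat" where
  "target x j = (if wired x j then 3 * N + j else 3 * N + M + (x * M + j))"

definition edges :: "(nat \<times> nat) list" where
  "edges = concat (map (\<lambda>x. map (\<lambda>j. (x, target x j)) [0..<M]) [0..<3 * N])"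

definition nodes :: nat where
  "nodes = 3 * N + M + 3 * N * M"

definition caps :: "nat list" where
  "caps = replicate (2 * N) 1 @ replicate N (2 * N) @ replicate (M + 3 * N * M) (2 * N * N)"

lemma row_col_less: "x < X \<Longrightarrow> j < M \<Longrightarrow> x * M + j < X * M"
proof -
  assume "x < X" "j < M"
  then have "x * M + j < Suc x * M" by simp
  also have "\<dots> \<le> X * M" using \<open>x < X\<close> by (intro mult_le_mono) auto
  finally show ?thesis .
qed

lemma length_edges: "length edges = 3 * N * M"
  by (simp add: edges_def length_concat comp_def sum_list_triv)

lemma length_caps: "length caps = nodes"
  by (simp add: caps_def nodes_def)

lemma nth_caps: "v < nodes \<Longrightarrow>
    caps ! v = (if v < 2 * N then 1 else if v < 3 * N then 2 * N else 2 * N * N)"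
  by (auto simp: caps_def nodes_def nth_append)

lemma set_caps: "set caps \<subseteq> {1..1 * nodes\<^sup>2}"
proof -
  have n: "2 * N \<le> nodes" by (simp add: nodes_def)
  then have "2 * N * N \<le> nodes * nodes" by (intro mult_le_mono) auto
  moreover have "2 * N * 1 \<le> 2 * N * N" using N by (intro mult_le_mono) auto
  moreover have "1 \<le> 2 * N * 1" using N by simp
  ultimately have "1 \<le> nodes * nodes" "2 * N \<le> nodes * nodes" "2 * N * N \<le> nodes * nodes"
    "1 \<le> 2 * N" "1 \<le> 2 * N * N" by linarith+
  then show ?thesis by (auto simp: caps_def power2_eq_square)
qed

lemma edges_le_nodes: "length edges \<le> 1 * nodes"
  by (simp add: length_edges nodes_def)

lemma target_range: "x < 3 * N \<Longrightarrow> j < M \<Longrightarrow> 3 * N \<le> target x j \<and> target x j < nodes"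
  using row_col_less[of x "3 * N" j] by (auto simp: target_def nodes_def)

lemma mem_edges: "e \<in> set edges \<longleftrightarrow> (\<exists>x<3 * N. \<exists>j<M. e = (x, target x j))"
proof -
  have "set edges = (\<Union>x\<in>{..<3 * N}. (\<lambda>j. (x, target x j)) ` {..<M})"
    by (simp add: edges_def atLeast0LessThan)
  then show ?thesis by blast
qed

lemma target_inj: "j < M \<Longrightarrow> j' < M \<Longrightarrow> target x j = target x j' \<Longrightarrow> j = j'"
  by (auto simp: target_def split: if_splits)

lemma simple: "simple_graph nodes edges"
proof -
  have "x < nodes \<and> target x j < nodes \<and> x \<noteq> target x j" if "x < 3 * N" "j < M" for x j
    using target_range[OF that] that by auto
  moreover have "distinct (map (\<lambda>(u, v). {u, v}) edges)"
  proof -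
    have "edges = map (\<lambda>(x, j). (x, target x j)) (List.product [0..<3 * N] [0..<M])"
      unfolding edges_def product_concat_map map_concat map_map comp_def by simp
    moreover have "inj_on (\<lambda>(x, j). (x, target x j)) (set (List.product [0..<3 * N] [0..<M]))"
      by (rule inj_onI) (auto dest: target_inj)
    ultimately have "distinct edges" by (simp add: distinct_map distinct_product)
    \<comment> \<open>Edges are listed with the row first, and every target is at least
      \<open>3 * N\<close>, so the unordered edge determines its orientation.\<close>
    moreover have "inj_on (\<lambda>(u, v). {u, v}) (set edges)"
    proof (rule inj_onI)
      fix e e' assume "e \<in> set edges" "e' \<in> set edges"
        and eq: "(\<lambda>(u, v). {u, v}) e = (\<lambda>(u, v). {u, v}) e'"
      then obtain x j x' j' where "x < 3 * N" "j < M" "x' < 3 * N" "j' < M"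
        "e = (x, target x j)" "e' = (x', target x' j')" by (auto simp: mem_edges)
      then show "e = e'" using eq target_range[of x j] target_range[of x' j']
        by (auto simp: doubleton_eq_iff)
    qed
    ultimately show ?thesis by (simp add: distinct_map)
  qed
  ultimately show ?thesis by (auto simp: simple_graph_def mem_edges)
qed

abbreviation flow_between :: "nat \<Rightarrow> nat \<Rightarrow> ereal" where
  "flow_between \<equiv> max_flow {..<nodes} (edge_set edges) (\<lambda>v. real (caps ! v))"

definition direct :: "nat \<Rightarrow> nat \<Rightarrow> nat set" where
  "direct a g = {j. j < M \<and> sat a j \<and> \<not> sat g j}"

definition good :: "nat \<Rightarrow> nat \<Rightarrow> nat \<Rightarrow> bool" where
  "good a g b \<longleftrightarrow> (\<forall>j<M. sat a j \<or> sat g j \<or> sat b j)"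

text \<open>The saturated direct columns together with \<open>N\<close> middle nodes that contribute
  \<open>2 * N\<close> units each.\<close>

definition threshold :: "nat \<Rightarrow> nat \<Rightarrow> nat" where
  "threshold a g = 2 * N * N * (card (direct a g) + 1)"

lemma finite_direct [simp]: "finite (direct a g)"
  by (simp add: direct_def)

lemma mem_edge_set: "e \<in> edge_set edges \<longleftrightarrow> (\<exists>x<3 * N. \<exists>j<M. e = {x, target x j})"
  by (force simp: edge_set_def mem_edges)

text \<open>The cut consists of the direct columns, the middle nodes that are not good, and all
  other sources and sinks. A good middle node needs no cutting: each column it violates is satisfied
  by \<open>g\<close>, hence not joined to \<open>g\<close>, or else is direct and already
  cut.\<close>

lemma flow_le_cut:
  assumes a: "a < N" and g: "N \<le> g" "g < 2 * N"
  shows "flow_between a g \<le> ereal (real (2 * N * N * card (direct a g) +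
    2 * N * card {b. 2 * N \<le> b \<and> b < 3 * N \<and> \<not> good a g b} + (2 * N - 2)))"
proof -
  \<comment> \<open>The part reachable without crossing the cut, enlarged by the leaves of all rows
    but \<open>g\<close> so that membership needs no case distinction on reachability. The hub
    belongs to it because \<open>g\<close> satisfies the hub column.\<close>
  define S where "S = {v. v < nodes \<and>
    (if v < 3 * N then v = a \<or> 2 * N \<le> v \<and> good a g v
     else if v < 3 * N + M then sat g (v - 3 * N)
     else (v - (3 * N + M)) div M \<noteq> g)}"
  define U where "U = {b. 2 * N \<le> b \<and> b < 3 * N \<and> \<not> good a g b}"
  define X where "X = (\<lambda>j. 3 * N + j) ` direct a g \<union> U \<union> ({..<2 * N} - {a, g})"
  have nodes: "3 * N + M \<le> nodes" by (simp add: nodes_def)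
  have "flow_between a g \<le> ereal (\<Sum>v\<in>X. real (caps ! v))"
  proof (rule max_flow_le_cut)
    show "S \<subseteq> {..<nodes}" "a \<in> S" "g \<notin> S" using a g nodes by (auto simp: S_def)
    show "X \<subseteq> {..<nodes} - {a, g}" using a g nodes by (auto simp: X_def U_def direct_def)
    fix u v assume u: "u \<in> S" and "v \<in> {..<nodes}" "{u, v} \<in> edge_set edges"
    then obtain x j where x: "x < 3 * N" "j < M" "{u, v} = {x, target x j}"
      by (auto simp: mem_edge_set)
    have leaf: "(3 * N + M + (x * M + j) - (3 * N + M)) div M = x" using x(2) by simp
    have S_leaf: "3 * N + M + (x * M + j) \<in> S \<longleftrightarrow> x \<noteq> g"
      using x row_col_less[OF x(1,2)] leaf by (simp add: S_def nodes_def)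
    have S_col: "3 * N + j \<in> S \<longleftrightarrow> sat g j" using x(2) nodes by (auto simp: S_def)
    have S_row: "x \<in> S \<longleftrightarrow> x = a \<or> 2 * N \<le> x \<and> good a g x" using x(1) nodes by (auto simp: S_def)
    have X_col: "3 * N + j \<in> X \<longleftrightarrow> sat a j \<and> \<not> sat g j"
      using x(2) by (auto simp: X_def U_def direct_def)
    have X_row: "x \<in> X \<longleftrightarrow> 2 * N \<le> x \<and> \<not> good a g x \<or> x < 2 * N \<and> x \<noteq> a \<and> x \<noteq> g"
      using x(1) by (auto simp: X_def U_def direct_def)
    from x(3) consider "u = x" "v = target x j" | "v = x" "u = target x j"
      by (auto simp: doubleton_eq_iff)
    then show "v \<in> S \<union> X"
    proof cases
      case 1
      then have "x \<noteq> g" using u S_row a g by auto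
      then show ?thesis
        using 1 u a x(2) unfolding Un_iff target_def
        by (auto simp: S_row S_col X_col S_leaf wired_def good_def split: if_splits)
    next
      case 2
      show ?thesis
      proof (cases "wired x j")
        case True
        \<comment> \<open>The sink \<open>g\<close> is wired only to columns that it violates, and
          these lie outside \<open>S\<close>; hence the edge cannot end in \<open>g\<close>, and
          every other row is in \<open>S\<close> or in \<open>X\<close>.\<close>
        then have "sat g j" using u 2 S_col by (simp add: target_def)
        then have "x \<noteq> g" using True a g by (auto simp: wired_def)
        then show ?thesis using 2(1) by (auto simp: S_row X_row)
      next
        case False
        then have "x \<noteq> g" using u 2 S_leaf by (simp add: target_def)
        then show ?thesis using 2(1) by (auto simp: S_row X_row)
      qed
    qed
  qed simp
  also have "(\<Sum>v\<in>X. real (caps ! v)) \<le> real (2 * N * N * card (direct a g) + 2 * N * card U + (2 * N - 2))"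
  proof -
    have fin: "finite U" by (auto simp: U_def)
    have c: "card ({..<2 * N} - {a, g}) = 2 * N - 2"
      using a g by (subst card_Diff_subset) auto
    have "(\<Sum>v\<in>X. caps ! v) = (\<Sum>v\<in>(\<lambda>j. 3 * N + j) ` direct a g. caps ! v) +
        (\<Sum>v\<in>U. caps ! v) + (\<Sum>v\<in>{..<2 * N} - {a, g}. caps ! v)"
      unfolding X_def using fin by (subst sum.union_disjoint; (subst sum.union_disjoint)?)
        (auto simp: U_def direct_def)
    also have "(\<Sum>v\<in>(\<lambda>j. 3 * N + j) ` direct a g. caps ! v) = (\<Sum>j\<in>direct a g. 2 * N * N)"
      using nodes by (subst sum.reindex) (auto simp: inj_on_def direct_def nth_caps intro!: sum.cong)
    also have "(\<Sum>v\<in>U. caps ! v) = (\<Sum>v\<in>U. 2 * N)"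
      using nodes by (intro sum.cong) (auto simp: U_def nth_caps)
    also have "(\<Sum>v\<in>{..<2 * N} - {a, g}. caps ! v) = (\<Sum>v\<in>{..<2 * N} - {a, g}. 1)"
      using nodes by (intro sum.cong) (auto simp: nth_caps)
    finally have "(\<Sum>v\<in>X. caps ! v) = 2 * N * N * card (direct a g) + 2 * N * card U + (2 * N - 2)"
      using c by simp
    then show ?thesis by (metis of_nat_sum order_refl)
  qed
  finally show ?thesis by (simp add: U_def)
qed

text \<open>One path of length two per direct column and one of length four per middle node
  \<open>b\<close>, through the hub and a column \<open>k b\<close> violated by all three rows. The
  two kinds never compete for a column: \<open>k b\<close> is violated by \<open>a\<close> and the
  hub is satisfied by \<open>g\<close>, so neither is direct.\<close>

lemma flow_ge_threshold:
  assumes a: "a < N" and g: "N \<le> g" "g < 2 * N"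
    and bad: "\<And>b. 2 * N \<le> b \<Longrightarrow> b < 3 * N \<Longrightarrow> \<not> good a g b"
  shows "ereal (real (threshold a g)) \<le> flow_between a g"
proof -
  obtain k where k: "\<And>b. 2 * N \<le> b \<Longrightarrow> b < 3 * N \<Longrightarrow>
      k b < M \<and> \<not> sat a (k b) \<and> \<not> sat g (k b) \<and> \<not> sat b (k b)"
    using bad unfolding good_def by metis
  have nodes: "3 * N + M \<le> nodes" by (simp add: nodes_def)
  define I :: "(nat + nat) set" where "I = direct a g <+> {2 * N..<3 * N}"
  define p where "p = case_sum (\<lambda>j. [a, 3 * N + j, g]) (\<lambda>b. [a, 3 * N + hub, b, 3 * N + k b, g])"
  define w where "w = case_sum (\<lambda>j::nat. real (2 * N * N)) (\<lambda>b::nat. real (2 * N))"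
  have E: "{x, 3 * N + j} \<in> edge_set edges \<and> {3 * N + j, x} \<in> edge_set edges"
    if "x < 3 * N" "j < M" "wired x j" for x j
    using that unfolding mem_edge_set target_def by (auto simp: insert_commute)
  have sum_I: "sum h I = (\<Sum>j\<in>direct a g. h (Inl j)) + (\<Sum>b=2 * N..<3 * N. h (Inr b))"
    for h :: "nat + nat \<Rightarrow> real"
    unfolding I_def by (simp add: sum.Plus)
  have "ereal (sum w I) \<le> flow_between a g"
  proof (rule path_packing_le_max_flow)
    show "a \<noteq> g" using a g by simp
    show "0 \<le> w i" for i by (auto simp: w_def split: sum.split)
    fix i assume "i \<in> I"
    then consider j where "i = Inl j" "j \<in> direct a g" | b where "i = Inr b" "2 * N \<le> b" "b < 3 * N"
      by (auto simp: I_def)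
    then show "distinct (p i) \<and> set (p i) \<subseteq> {..<nodes} \<and> p i \<noteq> [] \<and> hd (p i) = a \<and> last (p i) = g \<and>
        (\<forall>(u, v)\<in>steps (p i). {u, v} \<in> edge_set edges)"
    proof cases
      case 1
      then have "j < M" "wired a j" "wired g j" using a g by (auto simp: direct_def wired_def)
      then show ?thesis using 1 a g nodes E[of a j] E[of g j] by (auto simp: p_def)
    next
      case 2
      then have "wired a hub" "wired b hub" using a sat_hub[of a] sat_hub[of b] by (auto simp: wired_def)
      moreover have kb: "k b < M" "wired b (k b)" "wired g (k b)" "hub \<noteq> k b"
        using k[of b] 2 g sat_hub[of a] a by (auto simp: wired_def)
      ultimately show ?thesis
        using 2 a g nodes hub E[of a hub] E[of b hub] E[of b "k b"] E[of g "k b"]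
        by (auto simp: p_def)
    qed
  next
    fix v assume v: "v \<in> {..<nodes} - {a, g}"
    define A where "A = (\<Sum>j\<in>direct a g. if v = 3 * N + j then real (2 * N * N) else 0)"
    define B where "B = (\<Sum>b=2 * N..<3 * N.
      if v = 3 * N + hub \<or> v = b \<or> v = 3 * N + k b then real (2 * N) else 0)"
    have AB: "(\<Sum>i\<in>I. if v \<in> set (p i) then w i else 0) = A + B"
      using v unfolding sum_I A_def B_def
      by (intro arg_cong2[where f = plus] sum.cong) (auto simp: p_def w_def)
    have B_le: "B \<le> (\<Sum>b=2 * N..<3 * N. real (2 * N))"
      unfolding B_def by (intro sum_mono) auto
    \<comment> \<open>Other sources and sinks lie on no path, a middle node on exactly one, a direct
      column only on its own. Any remaining node lies at worst on all \<open>N\<close> long paths, a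
      load of \<open>2 * N * N\<close>.\<close>
    consider "v < 2 * N" | "2 * N \<le> v" "v < 3 * N" | j where "v = 3 * N + j" "j \<in> direct a g" |
      "3 * N \<le> v" "v - 3 * N \<notin> direct a g"
      by (metis le_add_diff_inverse not_le)
    then have "A + B \<le> real (caps ! v)"
    proof cases
      case 1
      then show ?thesis unfolding A_def B_def by (auto intro!: sum_nonpos simp: add_nonpos_nonpos)
    next
      case 2
      then have "A = 0" unfolding A_def by (intro sum.neutral) auto
      moreover have "B = (\<Sum>b=2 * N..<3 * N. if v = b then real (2 * N) else 0)"
        unfolding B_def using 2 by (intro sum.cong) auto
      ultimately show ?thesis using 2 nodes by (simp add: nth_caps)
    next
      case 3
      then have "A = real (2 * N * N)" by (simp add: A_def)
      moreover have "B = 0"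
        unfolding B_def
      proof (intro sum.neutral ballI)
        fix b assume b: "b \<in> {2 * N..<3 * N}"
        have "j \<noteq> hub" using 3 g sat_hub[of g] by (auto simp: direct_def)
        moreover have "j \<noteq> k b" using 3 k[of b] b by (auto simp: direct_def)
        ultimately show "(if v = 3 * N + hub \<or> v = b \<or> v = 3 * N + k b then real (2 * N) else 0) = 0"
          using 3 b by auto
      qed
      ultimately show ?thesis using 3 nodes by (auto simp: nth_caps direct_def)
    next
      case 4
      then have "A = 0" unfolding A_def by (intro sum.neutral) auto
      then show ?thesis using B_le 4 v by (simp add: nth_caps mult.commute)
    qed
    then show "(\<Sum>i\<in>I. if v \<in> set (p i) then w i else 0) \<le> real (caps ! v)"
      using AB by simp
  qed (auto simp: I_def)
  moreover have "sum w I = real (threshold a g)"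
    unfolding sum_I by (simp add: w_def threshold_def algebra_simps)
  ultimately show ?thesis by simp
qed

text \<open>A good middle node lowers the cut by \<open>2 * N\<close>, while the other sources and
  sinks add only \<open>2 * N - 2\<close>, so the flow drops at least 2 below the threshold. As
  \<open>Suc d\<close> encodes the value \<open>d\<close>, the test
  \<open>c \<le> threshold a g\<close> means that the flow is strictly smaller. The second claim
  bounds the number that has to be read from memory.\<close>

theorem decode_flow:
  assumes "a < N" "N \<le> g" "g < 2 * N" "decode_value c = flow_between a g"
  shows "c \<le> threshold a g \<longleftrightarrow> (\<exists>b. 2 * N \<le> b \<and> b < 3 * N \<and> good a g b)"
    and "c \<le> threshold a g + 2 * N"
proof -
  define u where "u = card {b. 2 * N \<le> b \<and> b < 3 * N \<and> \<not> good a g b}"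
  have le: "flow_between a g \<le> ereal (real (2 * N * N * card (direct a g) + 2 * N * u + (2 * N - 2)))"
    using flow_le_cut[OF assms(1-3)] by (simp add: u_def)
  \<comment> \<open>The code 0 would mean an infinite value, which the cut excludes.\<close>
  then obtain d where c: "c = Suc d" using assms(4) by (cases c) auto
  have d: "d \<le> 2 * N * N * card (direct a g) + 2 * N * u + (2 * N - 2)"
  proof -
    have "ereal (real d) \<le> ereal (real (2 * N * N * card (direct a g) + 2 * N * u + (2 * N - 2)))"
      using le assms(4) c by simp
    then show ?thesis by (simp only: ereal_less_eq of_nat_le_iff)
  qed
  have t: "threshold a g = 2 * N * N * card (direct a g) + 2 * N * N"
    by (simp add: threshold_def)
  have "u \<le> card {2 * N..<3 * N}" unfolding u_def by (intro card_mono) auto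
  then have "2 * N * u \<le> 2 * N * N" by (intro mult_le_mono) auto
  then have "d \<le> 2 * N * N * card (direct a g) + 2 * N * N + (2 * N - 2)"
    using d by (meson add_le_mono le_refl order_trans)
  then have "d \<le> threshold a g + (2 * N - 2)" unfolding t .
  then show "c \<le> threshold a g + 2 * N" using c N by simp
  show "c \<le> threshold a g \<longleftrightarrow> (\<exists>b. 2 * N \<le> b \<and> b < 3 * N \<and> good a g b)"
  proof
    assume "c \<le> threshold a g"
    show "\<exists>b. 2 * N \<le> b \<and> b < 3 * N \<and> good a g b"
    proof (rule ccontr)
      assume "\<nexists>b. 2 * N \<le> b \<and> b < 3 * N \<and> good a g b"
      then have "ereal (real (threshold a g)) \<le> ereal (real d)"
        using flow_ge_threshold[OF assms(1-3)] assms(4) c by auto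
      then have "threshold a g \<le> d" by (simp only: ereal_less_eq of_nat_le_iff)
      then show False using \<open>c \<le> threshold a g\<close> c by simp
    qed
  next
    assume "\<exists>b. 2 * N \<le> b \<and> b < 3 * N \<and> good a g b"
    then obtain b where b: "2 * N \<le> b" "b < 3 * N" "good a g b" by blast
    have "u \<le> card ({2 * N..<3 * N} - {b})"
      unfolding u_def using b(3) by (intro card_mono) auto
    also have "\<dots> < N" using b N by (subst card_Diff_singleton) auto
    finally have "u < N" .
    then have "2 * N * (u + 1) \<le> 2 * N * N" by (intro mult_le_mono) auto
    then have "2 * N * u + 2 * N \<le> 2 * N * N" by (simp only: distrib_left mult_1_right)
    moreover have "d + 2 \<le> X + Z" if "d \<le> X + Y + (2 * N - 2)" "Y + 2 * N \<le> Z" for X Y Z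
      using that N by linarith
    ultimately have "d + 2 \<le> 2 * N * N * card (direct a g) + 2 * N * N"
      using d by blast
    then show "c \<le> threshold a g" using t c by simp
  qed
qed

end

section \<open>Partial assignments as rows of the network\<close>

text \<open>A partial assignment is a pair of masks: bit \<open>y\<close> of \<open>pos\<close>
  makes variable \<open>y\<close> true and bit \<open>y\<close> of \<open>neg\<close> makes it
  false. If neither bit is set, both literals of \<open>y\<close> are false.\<close>

definition lit_true :: "nat \<Rightarrow> nat \<Rightarrow> literal \<Rightarrow> bool" where
  "lit_true pos neg = (\<lambda>(y, b). odd ((if b then pos else neg) div 2 ^ y))"

definition clause_true :: "nat \<Rightarrow> nat \<Rightarrow> clause \<Rightarrow> bool" where
  "clause_true pos neg C \<longleftrightarrow> (\<exists>l\<in>set C. lit_true pos neg l)"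

text \<open>The bit of weight \<open>2 ^ j\<close> belongs to the \<open>j\<close>-th clause from the end, and \<open>h\<close> ends up above
  the bits of all clauses.\<close>

definition clause_mask :: "nat \<Rightarrow> nat \<Rightarrow> nat \<Rightarrow> cnf \<Rightarrow> nat" where
  "clause_mask pos neg h F = foldl (\<lambda>S C. 2 * S + of_bool (clause_true pos neg C)) h F"

lemma clause_mask_Nil [simp]: "clause_mask pos neg h [] = h"
  by (simp add: clause_mask_def)

lemma clause_mask_snoc [simp]:
  "clause_mask pos neg h (F @ [C]) = 2 * clause_mask pos neg h F + of_bool (clause_true pos neg C)"
  by (simp add: clause_mask_def)

lemma clause_mask_less: "h \<le> 1 \<Longrightarrow> clause_mask pos neg h F < 2 ^ (length F + 1)"
proof (induction F rule: rev_induct)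
  case (snoc C F)
  then have "clause_mask pos neg h F + 1 \<le> 2 ^ (length F + 1)" by simp
  then have "2 * clause_mask pos neg h F + 1 < 2 * 2 ^ (length F + 1)" by linarith
  then show ?case by auto
qed simp

lemma clause_mask_hub: "clause_mask pos neg h F div 2 ^ length F = h"
proof (induction F rule: rev_induct)
  case (snoc C F)
  have "clause_mask pos neg h (F @ [C]) div 2 ^ length (F @ [C]) =
      clause_mask pos neg h (F @ [C]) div 2 div 2 ^ length F"
    by (simp add: div_mult2_eq)
  also have "clause_mask pos neg h (F @ [C]) div 2 = clause_mask pos neg h F" by simp
  finally show ?case using snoc by simp
qed simp

lemma clause_mask_bit:
  "j < length F \<Longrightarrow> odd (clause_mask pos neg h F div 2 ^ j) \<longleftrightarrow> clause_true pos neg (rev F ! j)"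
proof (induction F arbitrary: j rule: rev_induct)
  case (snoc C F)
  show ?case
  proof (cases j)
    case (Suc i)
    have "clause_mask pos neg h (F @ [C]) div 2 ^ j = clause_mask pos neg h (F @ [C]) div 2 div 2 ^ i"
      by (simp add: Suc div_mult2_eq)
    also have "clause_mask pos neg h (F @ [C]) div 2 = clause_mask pos neg h F" by simp
    finally show ?thesis using snoc Suc by simp
  qed simp
qed simp

text \<open>Row \<open>x\<close> stands for the assignment with the bits of \<open>x mod N\<close> to the variables of block
  \<open>x div N\<close>. Shifting these bits and their complements into the position of the block makes the
  literals over other blocks false.\<close>

definition row_pos :: "nat \<Rightarrow> nat \<Rightarrow> nat" where
  "row_pos N x = (x mod N) * N ^ (x div N)"

definition row_neg :: "nat \<Rightarrow> nat \<Rightarrow> nat" where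
  "row_neg N x = (N - 1 - x mod N) * N ^ (x div N)"

text \<open>The initial value becomes the bit of the hub, above all clauses:
  \<open>1 - x div N div 2\<close> is 1 for blocks 0 and 1 (sources and sinks) and 0 for block 2
  (middle nodes).\<close>

definition row_mask :: "nat \<Rightarrow> cnf \<Rightarrow> nat \<Rightarrow> nat" where
  "row_mask N F x = clause_mask (row_pos N x) (row_neg N x) (1 - x div N div 2) F"

definition row_sat :: "nat \<Rightarrow> cnf \<Rightarrow> nat \<Rightarrow> nat \<Rightarrow> bool" where
  "row_sat N F x j \<longleftrightarrow> odd (row_mask N F x div 2 ^ j)"

text \<open>The \<open>q\<close> bits of \<open>u\<close> are moved to the positions of block
  \<open>i\<close>; positions below see the zeros shifted in, positions above exceed the length of
  the number.\<close>

lemma odd_shifted: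
  fixes u :: nat
  assumes "u < 2 ^ q" "1 \<le> q"
  shows "odd (u * 2 ^ (q * i) div 2 ^ y) \<longleftrightarrow> y div q = i \<and> odd (u div 2 ^ (y mod q))"
proof -
  consider "y < q * i" | "q * i \<le> y" "y < q * i + q" | "q * i + q \<le> y" by linarith
  then show ?thesis
  proof cases
    case 1
    then obtain d where d: "q * i = y + Suc d" by (metis add_Suc_right less_imp_Suc_add)
    have "u * 2 ^ (q * i) div 2 ^ y = u * 2 ^ Suc d"
      unfolding d power_add by (simp add: mult.left_commute)
    moreover have "y div q < i" using 1 assms(2) by (simp add: div_less_iff_less_mult mult.commute)
    ultimately show ?thesis by simp
  next
    case 2
    then obtain d where d: "y = q * i + d" "d < q" by (metis add_less_cancel_left le_iff_add)
    have "u * 2 ^ (q * i) div 2 ^ y = u div 2 ^ d"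
      unfolding d power_add by (simp add: div_mult2_eq)
    moreover have "y div q = i" "y mod q = d" using d by auto
    ultimately show ?thesis by simp
  next
    case 3
    then obtain d where d: "y = q * i + (q + d)" by (metis add.assoc le_iff_add)
    have "u * 2 ^ (q * i) div 2 ^ y = u div 2 ^ (q + d)"
      unfolding d power_add by (simp add: div_mult2_eq)
    also have "\<dots> = 0" using assms(1) by (simp add: power_add div_mult2_eq)
    moreover have "i < y div q" using 3 assms(2)
      by (simp add: less_eq_div_iff_mult_less_eq Suc_le_eq[symmetric] mult.commute add.commute)
    ultimately show ?thesis by simp
  qed
qed

text \<open>\<open>2 ^ q - 1 - u\<close> is the bitwise complement of \<open>u\<close>. Its quotient
  by \<open>2 ^ k\<close> is \<open>A - 1 - w\<close>, where \<open>w\<close> is that of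
  \<open>u\<close> and \<open>A = 2 ^ (q - k)\<close> is even because \<open>k < q\<close>; so the
  parity flips.\<close>

lemma odd_complement:
  fixes u :: nat
  assumes "u < 2 ^ q" "k < q"
  shows "odd ((2 ^ q - 1 - u) div 2 ^ k) \<longleftrightarrow> even (u div 2 ^ k)"
proof -
  define A K w r :: nat where "A = 2 ^ (q - k)" and "K = 2 ^ k" and "w = u div K" and "r = u mod K"
  have K: "0 < K" "r < K" by (simp_all add: K_def r_def)
  have q: "2 ^ q = K * A" using assms(2) by (simp add: K_def A_def power_add[symmetric])
  have "w < A" using assms(1) q K by (simp add: w_def div_less_iff_less_mult mult.commute)
  then obtain d where d: "A = w + Suc d" by (metis add_Suc_right less_imp_Suc_add)
  obtain e where e: "K = r + Suc e" using K by (metis add_Suc_right less_imp_Suc_add)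
  have "u = K * w + r" by (simp add: w_def r_def)
  then have "2 ^ q - 1 - u = K * d + e" unfolding q d using e by (simp add: distrib_left)
  moreover have "(K * d + e) div K = d" using e by (intro div_nat_eqI) auto
  ultimately have "(2 ^ q - 1 - u) div K = d" by simp
  moreover have "even A" using assms(2) by (simp add: A_def)
  ultimately show ?thesis using d unfolding K_def[symmetric] w_def[symmetric] by auto
qed

lemma lit_true_row:
  assumes "1 \<le> q"
  shows "lit_true (row_pos (2 ^ q) x) (row_neg (2 ^ q) x) (y, b) \<longleftrightarrow>
    y div q = x div 2 ^ q \<and> odd (x mod 2 ^ q div 2 ^ (y mod q)) = b"
proof -
  have N: "((2::nat) ^ q) ^ i = 2 ^ (q * i)" for i by (simp add: power_mult)
  have u: "x mod 2 ^ q < 2 ^ q" "2 ^ q - 1 - x mod 2 ^ q < (2::nat) ^ q"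
    by (auto intro: diff_less_Suc less_imp_diff_less)
  show ?thesis
    using odd_shifted[OF u(1) assms] odd_shifted[OF u(2) assms] odd_complement[OF u(1), of "y mod q"]
      assms by (auto simp: lit_true_def row_pos_def row_neg_def N)
qed

lemma bits_exist: "\<exists>u::nat. u < 2 ^ q \<and> (\<forall>i<q. odd (u div 2 ^ i) = P i)" for q :: nat and P :: "nat \<Rightarrow> bool"
proof (induction q)
  case (Suc q)
  then obtain u :: nat where u: "u < 2 ^ q" "\<And>i. i < q \<Longrightarrow> odd (u div 2 ^ i) = P i" by blast
  have "odd ((u + of_bool (P q) * 2 ^ q) div 2 ^ i) = P i" if "i < Suc q" for i
  proof (cases "i = q")
    case True
    then show ?thesis using u(1) by simp
  next
    case False
    then have "i < q" using that by simp
    then obtain d where "q = Suc (i + d)" using less_imp_Suc_add by blast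
    then have d: "q = i + Suc d" by simp
    have "(u + of_bool (P q) * 2 ^ q) div 2 ^ i = (u + of_bool (P q) * 2 ^ Suc d * 2 ^ i) div 2 ^ i"
      unfolding d power_add by (simp add: ac_simps)
    also have "\<dots> = u div 2 ^ i + of_bool (P q) * 2 ^ Suc d" by simp
    finally show ?thesis using u(2)[of i] d by simp
  qed
  moreover have "u + of_bool (P q) * 2 ^ q < 2 ^ Suc q" using u(1) by simp
  ultimately show ?case by blast
qed simp

text \<open>An assignment restricts to one row per block. Conversely, a literal true in a row
  concerns a variable of the block of that row, so gluing one row from each block keeps every such
  literal true.\<close>

lemma satisfiable_iff_rows:
  assumes q: "1 \<le> q" and vars: "\<forall>C\<in>set F. \<forall>(y, b)\<in>set C. y < 3 * q"
  defines "N \<equiv> 2 ^ q"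
  shows "satisfiable F \<longleftrightarrow> (\<exists>a g b. a < N \<and> N \<le> g \<and> g < 2 * N \<and> 2 * N \<le> b \<and> b < 3 * N \<and>
    (\<forall>C\<in>set F. \<exists>x\<in>{a, g, b}. clause_true (row_pos N x) (row_neg N x) C))"
proof
  assume "satisfiable F"
  then obtain \<sigma> where \<sigma>: "\<forall>C\<in>set F. \<exists>(x, b)\<in>set C. \<sigma> x = b" unfolding satisfiable_def by blast
  have "\<forall>k. \<exists>u::nat. u < 2 ^ q \<and> (\<forall>i<q. odd (u div 2 ^ i) = \<sigma> (q * k + i))"
    by (intro allI bits_exist)
  then have "\<exists>u. \<forall>k. u k < (2::nat) ^ q \<and> (\<forall>i<q. odd (u k div 2 ^ i) = \<sigma> (q * k + i))"
    by (rule choice)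
  then obtain u :: "nat \<Rightarrow> nat"
    where u: "\<And>k. u k < 2 ^ q" "\<And>k i. i < q \<Longrightarrow> odd (u k div 2 ^ i) = \<sigma> (q * k + i)"
    by blast
  define x where "x k = N * k + u k" for k
  have x: "x k div N = k" "x k mod N = u k" for k using u(1)[of k] by (auto simp: x_def N_def)
  have "\<exists>z\<in>{x 0, x 1, x 2}. clause_true (row_pos N z) (row_neg N z) C" if C: "C \<in> set F" for C
  proof -
    obtain y b where yb: "(y, b) \<in> set C" "\<sigma> y = b" using \<sigma> C by blast
    then have "y < 3 * q" using vars C by blast
    then have k: "y div q < 3" using q by (simp add: div_less_iff_less_mult)
    have "odd (u (y div q) div 2 ^ (y mod q)) = b"
      using u(2)[of "y mod q" "y div q"] q yb(2) by simp
    then have "lit_true (row_pos N (x (y div q))) (row_neg N (x (y div q))) (y, b)"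
      unfolding N_def using x[of "y div q", unfolded N_def] by (subst lit_true_row[OF q]) auto
    then have "clause_true (row_pos N (x (y div q))) (row_neg N (x (y div q))) C"
      using yb(1) by (auto simp: clause_true_def)
    moreover have "y div q = 0 \<or> y div q = 1 \<or> y div q = 2" using k by linarith
    ultimately show ?thesis by auto
  qed
  moreover have "x 0 < N" "N \<le> x 1" "x 1 < 2 * N" "2 * N \<le> x 2" "x 2 < 3 * N"
    using u(1)[of 0] u(1)[of 1] u(1)[of 2] by (simp_all add: x_def N_def)
  ultimately show "\<exists>a g b. a < N \<and> N \<le> g \<and> g < 2 * N \<and> 2 * N \<le> b \<and> b < 3 * N \<and>
      (\<forall>C\<in>set F. \<exists>x\<in>{a, g, b}. clause_true (row_pos N x) (row_neg N x) C)" by blast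
next
  assume "\<exists>a g b. a < N \<and> N \<le> g \<and> g < 2 * N \<and> 2 * N \<le> b \<and> b < 3 * N \<and>
      (\<forall>C\<in>set F. \<exists>x\<in>{a, g, b}. clause_true (row_pos N x) (row_neg N x) C)"
  then obtain a g b where ab: "a < N" "N \<le> g" "g < 2 * N" "2 * N \<le> b" "b < 3 * N"
    and good: "\<And>C. C \<in> set F \<Longrightarrow> \<exists>x\<in>{a, g, b}. clause_true (row_pos N x) (row_neg N x) C"
    by blast
  have d: "a div N = 0" "g div N = 1" "b div N = 2" using ab by (auto simp: div_nat_eqI)
  define r where "r k = (if k = 0 then a else if k = (1::nat) then g else b)" for k
  have r: "x = r (x div N)" if "x \<in> {a, g, b}" for x using that d by (auto simp: r_def)
  define \<sigma> where "\<sigma> y = odd (r (y div q) mod N div 2 ^ (y mod q))" for y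
  show "satisfiable F"
    unfolding satisfiable_def
  proof (intro exI[of _ \<sigma>] ballI)
    fix C assume "C \<in> set F"
    then obtain x where x: "x \<in> {a, g, b}" "clause_true (row_pos N x) (row_neg N x) C"
      using good by blast
    then obtain y c where yc: "(y, c) \<in> set C" "lit_true (row_pos N x) (row_neg N x) (y, c)"
      by (auto simp: clause_true_def)
    then have "y div q = x div N" "odd (x mod N div 2 ^ (y mod q)) = c"
      using lit_true_row[OF q] unfolding N_def by auto
    then have "\<sigma> y = c" using r[OF x(1)] by (simp add: \<sigma>_def)
    then show "\<exists>(x, b)\<in>set C. \<sigma> x = b" using yc(1) by blast
  qed
qed

lemma network_row_sat:
  assumes "1 \<le> N"
  shows "network N (length F + 1) (row_sat N F) (length F)"
proof
  show "row_sat N F x (length F) \<longleftrightarrow> x < 2 * N" if "x < 3 * N" for x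
  proof -
    have "x div N < 3" using that assms by (simp add: div_less_iff_less_mult)
    moreover have "x div N < 2 \<longleftrightarrow> x < 2 * N" using assms by (simp add: div_less_iff_less_mult)
    moreover have "x div N div 2 = 0 \<longleftrightarrow> x div N < 2" by (simp add: div_eq_0_iff)
    moreover have "x div N < 3 \<Longrightarrow> \<not> x div N < 2 \<Longrightarrow> x div N div 2 = 1"
      by (metis One_nat_def Suc_1 div_self less_antisym numeral_3_eq_3 zero_neq_numeral)
    ultimately show ?thesis
      by (cases "x div N < 2") (auto simp: row_sat_def row_mask_def clause_mask_hub)
  qed
qed (use assms in auto)

text \<open>The hub column is satisfied by the source \<open>a\<close>, so only the clause columns
  matter. Columns number the clauses from the end, hence the detour through
  \<open>rev F\<close>.\<close>

lemma good_iff_clauses: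
  assumes "1 \<le> N" "a < N"
  shows "network.good (length F + 1) (row_sat N F) a g b \<longleftrightarrow>
    (\<forall>C\<in>set F. \<exists>x\<in>{a, g, b}. clause_true (row_pos N x) (row_neg N x) C)"
proof -
  interpret network N "length F + 1" "row_sat N F" "length F" using network_row_sat[OF assms(1)] .
  have sat: "row_sat N F x j \<longleftrightarrow> clause_true (row_pos N x) (row_neg N x) (rev F ! j)"
    if "j < length F" for x j
    unfolding row_sat_def row_mask_def using clause_mask_bit[OF that] .
  have "good a g b \<longleftrightarrow> (\<forall>j<length F. row_sat N F a j \<or> row_sat N F g j \<or> row_sat N F b j)"
    unfolding good_def using sat_hub[of a] assms by (auto simp: less_Suc_eq)
  also have "\<dots> \<longleftrightarrow> (\<forall>j<length F. \<exists>x\<in>{a, g, b}. clause_true (row_pos N x) (row_neg N x) (rev F ! j))"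
    by (auto simp: sat)
  also have "\<dots> \<longleftrightarrow> (\<forall>C\<in>set (rev F). \<exists>x\<in>{a, g, b}. clause_true (row_pos N x) (row_neg N x) C)"
    by (metis (no_types, lifting) in_set_conv_nth length_rev)
  finally show ?thesis by simp
qed

section \<open>Evaluating the clauses under a partial assignment\<close>

text \<open>From here on \<open>B\<close> bounds bit lengths while \<open>U\<close> is the unit in
  which costs are counted; keeping them apart lets an enclosing loop enlarge the unit alone.\<close>

lemma runs_block':
  assumes "1 \<le> B" "B \<le> U" "\<forall>c\<in>set cs. stmt_okay c" "\<forall>i\<in>live cs. v i < 2 ^ B"
    "Q (final_vars cs v) (final_mem cs v m)"
  shows "runs (block cs) v m (cost cs * U) Q"
  by (rule runs_mono[OF runs_block[where Q = Q, OF assms(1,3,4,5)]]) (use assms(2) in auto)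

lemma runs_Seq':
  assumes "runs P v m (k * U) Q" "\<And>v' m'. Q v' m' \<Longrightarrow> runs P' v' m' (k' * U) Q'"
  shows "runs (Seq P P') v m ((k + k') * U) Q'"
  using runs_Seq[OF assms] by (simp add: add_mult_distrib)

lemma runs_loop':
  assumes "1 \<le> B" "B \<le> U" "x < 30"
    and "\<And>j v m. j < n \<Longrightarrow> I (Suc j) v m \<Longrightarrow> v x = Suc j \<Longrightarrow>
      runs P v m (k * U) (\<lambda>v' m'. v' x = Suc j \<and> I j (v'(x := j)) m')"
    and "I n v m" "v x = n" "n < 2 ^ B"
    and "\<And>v' m'. v' x = 0 \<Longrightarrow> I 0 v' m' \<Longrightarrow> Q v' m'"
  shows "runs (loop x P) v m ((k + 13) * ((n + 1) * U)) Q"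
proof (rule runs_mono[OF runs_loop[where I = I, OF assms(1,3-7)]])
  have "n * (k * U + 12 * B) + B \<le> n * (k * U + 12 * U) + U"
    using assms(2) by (intro add_mono mult_le_mono) auto
  also have "\<dots> \<le> (k + 13) * ((n + 1) * U)" by (simp add: algebra_simps)
  finally show "n * (k * U + 12 * B) + B \<le> (k + 13) * ((n + 1) * U)" .
qed (use assms(8) in auto)

text \<open>A loop of fewer than \<open>B\<close> rounds multiplies the unit by \<open>B\<close>, so
  the nesting depth of such loops appears as the exponent of \<open>B\<close>.\<close>

lemma runs_short_loop:
  assumes "1 \<le> B" "B \<le> U" "x < 30"
    and "\<And>j v m. j < n \<Longrightarrow> I (Suc j) v m \<Longrightarrow> v x = Suc j \<Longrightarrow>
      runs P v m (k * U) (\<lambda>v' m'. v' x = Suc j \<and> I j (v'(x := j)) m')"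
    and "I n v m" "v x = n" "n < B"
    and "\<And>v' m'. v' x = 0 \<Longrightarrow> I 0 v' m' \<Longrightarrow> Q v' m'"
  shows "runs (loop x P) v m ((k + 13) * (U * B)) Q"
proof (rule runs_mono[OF runs_loop'[where I = I, OF assms(1-6) _ assms(8)]])
  show "n < 2 ^ B" using assms(7) less_exp[of B] by (rule less_trans)
  have "(n + 1) * U \<le> B * U" using assms(7) by (intro mult_le_mono1) simp
  then have "(n + 1) * U \<le> U * B" by (simp only: mult.commute)
  then show "(k + 13) * ((n + 1) * U) \<le> (k + 13) * (U * B)" by (rule mult_le_mono2)
qed auto

lemma runs_widen: "runs P v m (k * U) Q \<Longrightarrow> U \<le> U' \<Longrightarrow> runs P v m (k * U') Q"
  by (erule runs_mono) auto

abbreviation same_except :: "nat set \<Rightarrow> (nat \<Rightarrow> nat) \<Rightarrow> (nat \<Rightarrow> nat) \<Rightarrow> bool" where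
  "same_except A v v' \<equiv> \<forall>i. i \<notin> A \<longrightarrow> v' i = v i"

text \<open>Register 0 initially holds the input length, so the pointer starts just behind the
  input.\<close>

abbreviation (input) "vPtr \<equiv> 0 :: nat"
abbreviation (input) "vD \<equiv> 2 :: nat"
abbreviation (input) "vW \<equiv> 3 :: nat"
abbreviation (input) "vNodes \<equiv> 4 :: nat"
abbreviation (input) "vM \<equiv> 5 :: nat"
abbreviation (input) "vN \<equiv> 6 :: nat"
abbreviation (input) "vX \<equiv> 7 :: nat"
abbreviation (input) "vV \<equiv> 8 :: nat"
abbreviation (input) "vPos \<equiv> 9 :: nat"
abbreviation (input) "vNeg \<equiv> 10 :: nat"
abbreviation (input) "vS \<equiv> 11 :: nat"
abbreviation (input) "vFlag \<equiv> 12 :: nat"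
abbreviation (input) "vLit \<equiv> 13 :: nat"
abbreviation (input) "vPow \<equiv> 14 :: nat"
abbreviation (input) "vCnt \<equiv> 15 :: nat"
abbreviation (input) "vLen \<equiv> 16 :: nat"
abbreviation (input) "vCl \<equiv> 17 :: nat"
abbreviation (input) "vRow \<equiv> 18 :: nat"
abbreviation (input) "vCol \<equiv> 19 :: nat"
abbreviation (input) "vT \<equiv> 20 :: nat"
abbreviation (input) "vFound \<equiv> 21 :: nat"
abbreviation (input) "vSum \<equiv> 22 :: nat"

definition "double_block = [vPow ::= Var vPow \<otimes> Num 2]"

definition "pow_code = Seq (block [vPow ::= Num 1]) (loop vCnt (block double_block))"

definition "pow_cost = cost [vPow ::= Num 1] + (cost double_block + 13)"

lemma runs_pow:
  assumes "1 \<le> B" "v vCnt < B" "v vCnt = c"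
  shows "runs pow_code v m (pow_cost * (B * B))
    (\<lambda>v' m'. m' = m \<and> v' vPow = 2 ^ c \<and> same_except {vPow, vCnt} v v')"
  unfolding pow_code_def pow_cost_def
proof (rule runs_Seq'[where Q = "\<lambda>v' m'. m' = m \<and> v' = v(vPow := 1)"])
  show "runs (block [vPow ::= Num 1]) v m (cost [vPow ::= Num 1] * (B * B))
      (\<lambda>v' m'. m' = m \<and> v' = v(vPow := 1))"
    by (rule runs_block'[OF assms(1)]) auto
  fix v1 m1 assume v1: "m1 = m \<and> v1 = v(vPow := 1)"
  show "runs (loop vCnt (block double_block)) v1 m1 ((cost double_block + 13) * (B * B))
      (\<lambda>v' m'. m' = m \<and> v' vPow = 2 ^ c \<and> same_except {vPow, vCnt} v v')"
  proof (rule runs_short_loop[OF assms(1) order_refl, where n = c and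
      I = "\<lambda>j v' m'. m' = m \<and> v' vPow = 2 ^ (c - j) \<and> same_except {vPow, vCnt} v v'"])
    fix j v2 m2
    assume j: "j < c" and I: "m2 = m \<and> v2 vPow = 2 ^ (c - Suc j) \<and> same_except {vPow, vCnt} v v2"
      and v2: "v2 vCnt = Suc j"
    have "c - j = Suc (c - Suc j)" using j by simp
    moreover have "(2::nat) ^ (c - Suc j) < 2 ^ B"
      using assms(2,3) by (intro power_strict_increasing) auto
    ultimately show "runs (block double_block) v2 m2 (cost double_block * B)
        (\<lambda>v' m'. v' vCnt = Suc j \<and> m' = m \<and> (v'(vCnt := j)) vPow = 2 ^ (c - j) \<and>
          same_except {vPow, vCnt} v (v'(vCnt := j)))"
      using I v2 by (intro runs_block'[OF assms(1)]) (auto simp: double_block_def)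
  qed (use assms v1 in auto)
qed

text \<open>The input is kept as a single number in base \<open>D\<close>, because the memory has to hold the network
  and nothing else when the flow algorithm is started.\<close>

primrec pack :: "nat \<Rightarrow> nat list \<Rightarrow> nat" where
  "pack D [] = 0"
| "pack D (x # xs) = x + D * pack D xs"

lemma pack_less: "\<forall>x\<in>set xs. x < D \<Longrightarrow> pack D xs < D ^ length xs"
proof (induction xs)
  case (Cons x xs)
  then have "Suc (pack D xs) \<le> D ^ length xs" by simp
  then have "D * Suc (pack D xs) \<le> D * D ^ length xs" by (rule mult_le_mono2)
  moreover have "x + D * pack D xs < D * Suc (pack D xs)" using Cons.prems by simp
  ultimately show ?case by simp
qed simp

text \<open>Stripping leading digits never increases the packed number, which keeps the unread rest
  of the input within \<open>B\<close> bits.\<close>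

lemma pack_append_ge: "0 < D \<Longrightarrow> pack D ys \<le> pack D (xs @ ys)"
proof (induction xs)
  case (Cons x xs)
  then have "pack D ys \<le> pack D (xs @ ys)" by simp
  also have "\<dots> \<le> D * pack D (xs @ ys)" using Cons.prems by simp
  finally show ?case by simp
qed simp

abbreviation encode_lit :: "literal \<Rightarrow> nat" where
  "encode_lit \<equiv> \<lambda>(y, b). 2 * y + of_bool b"

definition "lit_block1 = [vLit ::= Var vV \<odot> Var vD, vV ::= Var vV \<oslash> Var vD, vCnt ::= Var vLit \<oslash> Num 2]"

text \<open>Logic by truncated arithmetic: the polarity bit selects one of the two masks, and
  \<open>1 - (1 - x) * (1 - y)\<close> is the disjunction of two bits.\<close>

definition "lit_block2 = [vFlag ::= Num 1 \<ominus> (Num 1 \<ominus> Var vFlag) \<otimes> (Num 1 \<ominus>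
  ((Var vLit \<odot> Num 2) \<otimes> Var vPos \<oplus> (Num 1 \<ominus> Var vLit \<odot> Num 2) \<otimes> Var vNeg) \<oslash> Var vPow \<odot> Num 2)]"

definition "lit_code = Seq (block lit_block1) (Seq pow_code (block lit_block2))"

definition "lit_cost = cost lit_block1 + (pow_cost + cost lit_block2)"

lemma runs_lit:
  assumes B: "1 \<le> B" and D: "D \<le> B" "v vD = D" "encode_lit l < D"
    and V: "v vV = encode_lit l + D * r" "v vV < 2 ^ B"
    and small: "v vPos < 2 ^ B" "v vNeg < 2 ^ B" and flag: "v vFlag = of_bool b"
  shows "runs lit_code v m (lit_cost * (B * B)) (\<lambda>v' m'. m' = m \<and> v' vV = r \<and>
    v' vFlag = of_bool (b \<or> lit_true (v vPos) (v vNeg) l) \<and>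
    same_except {vLit, vV, vCnt, vPow, vFlag} v v')"
  unfolding lit_code_def lit_cost_def
proof -
  obtain y c where l: "l = (y, c)" by (cases l) auto
  let ?e = "encode_lit l"
  have DB: "v vD < 2 ^ B" using D by (intro le_less_trans[OF _ less_exp]) simp
  have BB: "B \<le> B * B" using B by simp
  have e: "?e div 2 = y" "?e mod 2 = of_bool c" by (auto simp: l)
  have y: "y < B" using D(1,3) by (auto simp: l)
  have vV: "v vV mod D = ?e" "v vV div D = r" using V(1) D(3) by auto
  show "runs (Seq (block lit_block1) (Seq pow_code (block lit_block2))) v m
      ((cost lit_block1 + (pow_cost + cost lit_block2)) * (B * B))
      (\<lambda>v' m'. m' = m \<and> v' vV = r \<and> v' vFlag = of_bool (b \<or> lit_true (v vPos) (v vNeg) l) \<and>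
        same_except {vLit, vV, vCnt, vPow, vFlag} v v')"
  proof (rule runs_Seq'[where Q = "\<lambda>v' m'. m' = m \<and> v' = v(vLit := ?e, vV := r, vCnt := y)"])
    show "runs (block lit_block1) v m (cost lit_block1 * (B * B))
        (\<lambda>v' m'. m' = m \<and> v' = v(vLit := ?e, vV := r, vCnt := y))"
      by (rule runs_block'[OF B BB])
        (use DB V(2) D vV e in \<open>auto simp: lit_block1_def simp del: One_nat_def split: prod.splits\<close>)
    fix v1 m1 assume v1: "m1 = m \<and> v1 = v(vLit := ?e, vV := r, vCnt := y)"
    show "runs (Seq pow_code (block lit_block2)) v1 m1 ((pow_cost + cost lit_block2) * (B * B))
        (\<lambda>v' m'. m' = m \<and> v' vV = r \<and> v' vFlag = of_bool (b \<or> lit_true (v vPos) (v vNeg) l) \<and>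
          same_except {vLit, vV, vCnt, vPow, vFlag} v v')"
    proof (rule runs_Seq')
      show "runs pow_code v1 m1 (pow_cost * (B * B))
          (\<lambda>v' m'. m' = m1 \<and> v' vPow = 2 ^ y \<and> same_except {vPow, vCnt} v1 v')"
        by (rule runs_pow[OF B]) (use v1 y in auto)
      fix v2 m2 assume v2: "m2 = m1 \<and> v2 vPow = 2 ^ y \<and> same_except {vPow, vCnt} v1 v2"
      have pow: "(2::nat) ^ y < 2 ^ B" using y by simp
      have eB: "?e < 2 ^ B" using D less_exp[of B] by linarith
      have one: "Suc 0 < 2 ^ B" using B one_less_power[of "2::nat" B] by simp
      show "runs (block lit_block2) v2 m2 (cost lit_block2 * (B * B))
          (\<lambda>v' m'. m' = m \<and> v' vV = r \<and> v' vFlag = of_bool (b \<or> lit_true (v vPos) (v vNeg) l) \<and>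
            same_except {vLit, vV, vCnt, vPow, vFlag} v v')"
        by (rule runs_block'[OF B BB])
          (use v1 v2 pow eB one small flag e in \<open>auto simp: lit_block2_def lit_true_def l mod_2_eq_odd\<close>)
    qed
  qed
qed

definition "clause_block1 = [vLen ::= Var vV \<odot> Var vD, vV ::= Var vV \<oslash> Var vD, vFlag ::= Num 0]"

definition "clause_block2 = [vS ::= Num 2 \<otimes> Var vS \<oplus> Var vFlag]"

definition "clause_code = Seq (block clause_block1) (Seq (loop vLen lit_code) (block clause_block2))"

definition "clause_cost = cost clause_block1 + ((lit_cost + 13) + cost clause_block2)"

lemma runs_clause:
  assumes B: "1 \<le> B" and D: "D \<le> B" "v vD = D" and C: "\<forall>l\<in>set C. encode_lit l < D" "length C < D"
    and V: "v vV = pack D (encode_clause C @ rest)" "v vV < 2 ^ B"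
    and small: "v vPos < 2 ^ B" "v vNeg < 2 ^ B" "v vS < 2 ^ B"
  shows "runs clause_code v m (clause_cost * (B * B * B)) (\<lambda>v' m'. m' = m \<and> v' vV = pack D rest \<and>
    v' vS = 2 * v vS + of_bool (clause_true (v vPos) (v vNeg) C) \<and>
    same_except {vLit, vV, vCnt, vPow, vFlag, vLen, vS} v v')"
  unfolding clause_code_def clause_cost_def
proof (rule runs_Seq'[where Q = "\<lambda>v' m'. m' = m \<and>
    v' = v(vLen := length C, vV := pack D (map encode_lit C @ rest), vFlag := 0)"])
  have D0: "0 < D" using C(2) by simp
  have DB: "v vD < 2 ^ B" using D by (intro le_less_trans[OF _ less_exp]) simp
  have BB: "B \<le> B * B" using B by simp
  have BBB: "B \<le> B * B * B" "B * B \<le> B * B * B" using B by simp_all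
  have vV: "v vV mod D = length C" "v vV div D = pack D (map encode_lit C @ rest)"
    using V(1) C(2) by (auto simp: encode_clause_def)
  show "runs (block clause_block1) v m (cost clause_block1 * (B * B * B)) (\<lambda>v' m'. m' = m \<and>
      v' = v(vLen := length C, vV := pack D (map encode_lit C @ rest), vFlag := 0))"
    by (rule runs_block'[OF B BBB(1)])
      (use DB V(2) D vV in \<open>auto simp: clause_block1_def\<close>)
  fix v1 m1 assume v1: "m1 = m \<and>
    v1 = v(vLen := length C, vV := pack D (map encode_lit C @ rest), vFlag := 0)"
  show "runs (Seq (loop vLen lit_code) (block clause_block2)) v1 m1
      (((lit_cost + 13) + cost clause_block2) * (B * B * B))
      (\<lambda>v' m'. m' = m \<and> v' vV = pack D rest \<and>
        v' vS = 2 * v vS + of_bool (clause_true (v vPos) (v vNeg) C) \<and>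
        same_except {vLit, vV, vCnt, vPow, vFlag, vLen, vS} v v')"
  proof (rule runs_Seq'[where Q = "\<lambda>v' m'. m' = m \<and> v' vV = pack D rest \<and>
      v' vFlag = of_bool (clause_true (v vPos) (v vNeg) C) \<and>
      same_except {vLit, vV, vCnt, vPow, vFlag, vLen} v v'"])
    show "runs (loop vLen lit_code) v1 m1 ((lit_cost + 13) * (B * B * B)) (\<lambda>v' m'. m' = m \<and>
        v' vV = pack D rest \<and> v' vFlag = of_bool (clause_true (v vPos) (v vNeg) C) \<and>
        same_except {vLit, vV, vCnt, vPow, vFlag, vLen} v v')"
    proof (rule runs_short_loop[OF B BB, where n = "length C" and I = "\<lambda>j v' m'. m' = m \<and>
        (\<exists>ys zs. C = ys @ zs \<and> length zs = j \<and> v' vV = pack D (map encode_lit zs @ rest) \<and>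
          v' vFlag = of_bool (clause_true (v vPos) (v vNeg) ys)) \<and> v' vV < 2 ^ B \<and>
        same_except {vLit, vV, vCnt, vPow, vFlag, vLen} v v'"])
      fix j v2 m2
      assume j: "j < length C" and I: "m2 = m \<and>
        (\<exists>ys zs. C = ys @ zs \<and> length zs = Suc j \<and> v2 vV = pack D (map encode_lit zs @ rest) \<and>
          v2 vFlag = of_bool (clause_true (v vPos) (v vNeg) ys)) \<and> v2 vV < 2 ^ B \<and>
        same_except {vLit, vV, vCnt, vPow, vFlag, vLen} v v2" and v2: "v2 vLen = Suc j"
      obtain ys l zs where ys: "C = ys @ l # zs" "length zs = j"
        "v2 vV = encode_lit l + D * pack D (map encode_lit zs @ rest)"
        "v2 vFlag = of_bool (clause_true (v vPos) (v vNeg) ys)"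
        using I by (auto simp: length_Suc_conv)
      have "runs lit_code v2 m2 (lit_cost * (B * B)) (\<lambda>v' m'. m' = m2 \<and>
        v' vV = pack D (map encode_lit zs @ rest) \<and>
        v' vFlag = of_bool (clause_true (v vPos) (v vNeg) ys \<or> lit_true (v2 vPos) (v2 vNeg) l) \<and>
        same_except {vLit, vV, vCnt, vPow, vFlag} v2 v')"
        by (rule runs_lit[OF B D(1)]) (use ys C D I small in auto)
      then show "runs lit_code v2 m2 (lit_cost * (B * B)) (\<lambda>v' m'. v' vLen = Suc j \<and> m' = m \<and>
        (\<exists>ys zs. C = ys @ zs \<and> length zs = j \<and> (v'(vLen := j)) vV = pack D (map encode_lit zs @ rest) \<and>
          (v'(vLen := j)) vFlag = of_bool (clause_true (v vPos) (v vNeg) ys)) \<and>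
        (v'(vLen := j)) vV < 2 ^ B \<and>
        same_except {vLit, vV, vCnt, vPow, vFlag, vLen} v (v'(vLen := j)))"
      proof (rule runs_mono[OF _ order_refl])
        fix v' m' assume v': "m' = m2 \<and> v' vV = pack D (map encode_lit zs @ rest) \<and>
          v' vFlag = of_bool (clause_true (v vPos) (v vNeg) ys \<or> lit_true (v2 vPos) (v2 vNeg) l) \<and>
          same_except {vLit, vV, vCnt, vPow, vFlag} v2 v'"
        have "pack D (map encode_lit zs @ rest) \<le> v2 vV"
          using D0 by (simp add: ys(3) trans_le_add2)
        moreover have "v' vV = pack D (map encode_lit zs @ rest)" "v2 vV < 2 ^ B"
          using I v' by blast+
        ultimately have "v' vV < 2 ^ B" by linarith
        moreover have "C = (ys @ [l]) @ zs" using ys by simp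
        moreover have "clause_true (v vPos) (v vNeg) (ys @ [l]) \<longleftrightarrow>
            clause_true (v vPos) (v vNeg) ys \<or> lit_true (v vPos) (v vNeg) l"
          by (auto simp: clause_true_def)
        ultimately show "v' vLen = Suc j \<and> m' = m \<and>
          (\<exists>ys zs. C = ys @ zs \<and> length zs = j \<and> (v'(vLen := j)) vV = pack D (map encode_lit zs @ rest) \<and>
            (v'(vLen := j)) vFlag = of_bool (clause_true (v vPos) (v vNeg) ys)) \<and>
          (v'(vLen := j)) vV < 2 ^ B \<and>
          same_except {vLit, vV, vCnt, vPow, vFlag, vLen} v (v'(vLen := j))"
          using v' I v2 ys(2) by (intro conjI exI[of _ "ys @ [l]"] exI[of _ zs]) auto
      qed
    next
      have "pack D (map encode_lit C @ rest) \<le> v vV" using D0 V by (simp add: encode_clause_def trans_le_add2)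
      then have "pack D (map encode_lit C @ rest) < 2 ^ B" using V(2) by simp
      then show "m1 = m \<and>
        (\<exists>ys zs. C = ys @ zs \<and> length zs = length C \<and> v1 vV = pack D (map encode_lit zs @ rest) \<and>
          v1 vFlag = of_bool (clause_true (v vPos) (v vNeg) ys)) \<and> v1 vV < 2 ^ B \<and>
        same_except {vLit, vV, vCnt, vPow, vFlag, vLen} v v1"
        using v1 by (intro conjI exI[of _ "[]"] exI[of _ C]) (auto simp: clause_true_def)
    qed (use v1 C D in auto)
    fix v2 m2 assume v2: "m2 = m \<and> v2 vV = pack D rest \<and>
      v2 vFlag = of_bool (clause_true (v vPos) (v vNeg) C) \<and>
      same_except {vLit, vV, vCnt, vPow, vFlag, vLen} v v2"
    have "(2::nat) ^ 1 \<le> 2 ^ B" using B by (intro power_increasing) auto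
    then show "runs (block clause_block2) v2 m2 (cost clause_block2 * (B * B * B))
      (\<lambda>v' m'. m' = m \<and> v' vV = pack D rest \<and>
        v' vS = 2 * v vS + of_bool (clause_true (v vPos) (v vNeg) C) \<and>
        same_except {vLit, vV, vCnt, vPow, vFlag, vLen, vS} v v')"
      by (intro runs_block'[OF B BBB(1)]) (use v2 small in \<open>auto simp: clause_block2_def\<close>)
  qed
qed

definition "eval_block = [vV ::= Var vW, vCl ::= Var vM]"

definition "eval_code = Seq (block eval_block) (loop vCl clause_code)"

definition "eval_cost = cost eval_block + (clause_cost + 13)"

definition fits :: "nat \<Rightarrow> cnf \<Rightarrow> bool" where
  "fits D F \<longleftrightarrow> (\<forall>C\<in>set F. length C < D \<and> (\<forall>l\<in>set C. encode_lit l < D))"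

lemma runs_eval:
  assumes B: "1 \<le> B" and D: "D \<le> B" "0 < D" "v vD = D" and F: "fits D F" "length F + 1 < B"
    and W: "v vW = pack D (concat (map encode_clause F))" "v vW < 2 ^ B" "v vM = length F"
    and small: "v vPos < 2 ^ B" "v vNeg < 2 ^ B" "v vS \<le> 1"
  shows "runs eval_code v m (eval_cost * (B * B * B * B)) (\<lambda>v' m'. m' = m \<and>
    v' vS = clause_mask (v vPos) (v vNeg) (v vS) F \<and>
    same_except {vLit, vV, vCnt, vPow, vFlag, vLen, vS, vCl} v v')"
  unfolding eval_code_def eval_cost_def
proof (rule runs_Seq'[where Q = "\<lambda>v' m'. m' = m \<and> v' = v(vV := v vW, vCl := length F)"])
  have m: "length F < 2 ^ B" using F(2) less_exp[of B] by linarith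
  have BBB: "B \<le> B * B * B" "B \<le> B * B * B * B" using B by simp_all
  show "runs (block eval_block) v m (cost eval_block * (B * B * B * B))
      (\<lambda>v' m'. m' = m \<and> v' = v(vV := v vW, vCl := length F))"
    by (rule runs_block'[OF B BBB(2)]) (use W m in \<open>auto simp: eval_block_def\<close>)
  fix v1 m1 assume v1: "m1 = m \<and> v1 = v(vV := v vW, vCl := length F)"
  let ?ok = "same_except {vLit, vV, vCnt, vPow, vFlag, vLen, vS, vCl} v"
  let ?I = "\<lambda>j v' m'. m' = m \<and> (\<exists>ys zs. F = ys @ zs \<and> length zs = j \<and>
      v' vV = pack D (concat (map encode_clause zs)) \<and>
      v' vS = clause_mask (v vPos) (v vNeg) (v vS) ys) \<and> v' vV < 2 ^ B \<and> ?ok v'"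
  show "runs (loop vCl clause_code) v1 m1 ((clause_cost + 13) * (B * B * B * B)) (\<lambda>v' m'. m' = m \<and>
    v' vS = clause_mask (v vPos) (v vNeg) (v vS) F \<and> ?ok v')"
  proof (rule runs_short_loop[OF B BBB(1), where n = "length F" and I = ?I])
    fix j v2 m2
    assume j: "j < length F" and I: "?I (Suc j) v2 m2" and v2: "v2 vCl = Suc j"
    obtain ys C zs where ys: "F = ys @ C # zs" "length zs = j"
      "v2 vV = pack D (encode_clause C @ concat (map encode_clause zs))"
      "v2 vS = clause_mask (v vPos) (v vNeg) (v vS) ys"
      using I by (auto simp: length_Suc_conv)
    have "v2 vS < 2 ^ (length ys + 1)" unfolding ys(4) by (rule clause_mask_less[OF small(3)])
    also have "\<dots> \<le> 2 ^ B" using F(2) ys(1) by (intro power_increasing) auto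
    finally have S: "v2 vS < 2 ^ B" .
    have "runs clause_code v2 m2 (clause_cost * (B * B * B)) (\<lambda>v' m'. m' = m2 \<and>
        v' vV = pack D (concat (map encode_clause zs)) \<and>
        v' vS = 2 * v2 vS + of_bool (clause_true (v2 vPos) (v2 vNeg) C) \<and>
        same_except {vLit, vV, vCnt, vPow, vFlag, vLen, vS} v2 v')"
      by (rule runs_clause[OF B D(1)]) (use ys F D I S small in \<open>auto simp: fits_def\<close>)
    then show "runs clause_code v2 m2 (clause_cost * (B * B * B))
        (\<lambda>v' m'. v' vCl = Suc j \<and> ?I j (v'(vCl := j)) m')"
    proof (rule runs_mono[OF _ order_refl])
      fix v' m' assume v': "m' = m2 \<and> v' vV = pack D (concat (map encode_clause zs)) \<and>
        v' vS = 2 * v2 vS + of_bool (clause_true (v2 vPos) (v2 vNeg) C) \<and>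
        same_except {vLit, vV, vCnt, vPow, vFlag, vLen, vS} v2 v'"
      have "v' vV \<le> v2 vV" using v' ys(3) pack_append_ge[OF D(2)] by simp
      then have "v' vV < 2 ^ B" using I by simp
      moreover have "F = (ys @ [C]) @ zs" using ys by simp
      ultimately show "v' vCl = Suc j \<and> ?I j (v'(vCl := j)) m'"
        using v' I v2 ys(2,4) by (intro conjI exI[of _ "ys @ [C]"] exI[of _ zs]) auto
    qed
  next
    show "?I (length F) v1 m1"
      using v1 W by (intro conjI exI[of _ "[]"] exI[of _ F]) auto
  qed (use v1 F in auto)
qed

text \<open>For a block number \<open>g < 3\<close> the sum
  \<open>(1 - g) + (g mod 2) * N + (g div 2) * (N * N)\<close> equals \<open>N ^ g\<close>, so the
  shift into the block needs no loop.\<close>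

definition "row_block = [
  vPos ::= (Var vX \<odot> Var vN) \<otimes> ((Num 1 \<ominus> Var vX \<oslash> Var vN) \<oplus> (Var vX \<oslash> Var vN \<odot> Num 2) \<otimes> Var vN \<oplus>
    (Var vX \<oslash> Var vN \<oslash> Num 2) \<otimes> (Var vN \<otimes> Var vN)),
  vNeg ::= (Var vN \<ominus> Num 1 \<ominus> Var vX \<odot> Var vN) \<otimes> ((Num 1 \<ominus> Var vX \<oslash> Var vN) \<oplus>
    (Var vX \<oslash> Var vN \<odot> Num 2) \<otimes> Var vN \<oplus> (Var vX \<oslash> Var vN \<oslash> Num 2) \<otimes> (Var vN \<otimes> Var vN)),
  vS ::= Num 1 \<ominus> Var vX \<oslash> Var vN \<oslash> Num 2]"

definition "row_code = Seq (block row_block) eval_code"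

definition "row_cost = cost row_block + eval_cost"

abbreviation "scratch \<equiv> {vLit, vV, vCnt, vPow, vFlag, vLen, vS, vCl, vPos, vNeg}"

lemma runs_row:
  assumes B: "1 \<le> B" and D: "D \<le> B" "0 < D" "v vD = D" and F: "fits D F" "length F + 1 < B"
    and W: "v vW = pack D (concat (map encode_clause F))" "v vW < 2 ^ B" "v vM = length F"
    and N: "v vN = N" "1 \<le> N" "N * N * N < 2 ^ B" and x: "v vX = x" "x < 3 * N" "x < 2 ^ B"
  shows "runs row_code v m (row_cost * (B * B * B * B))
    (\<lambda>v' m'. m' = m \<and> v' vS = row_mask N F x \<and> same_except scratch v v')"
  unfolding row_code_def row_cost_def
proof (rule runs_Seq'[where Q = "\<lambda>v' m'. m' = m \<and>
    v' = v(vPos := row_pos N x, vNeg := row_neg N x, vS := 1 - x div N div 2)"])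
  have BB: "B \<le> B * B * B * B" using B by simp
  have g: "x div N < 3" using x N by (simp add: div_less_iff_less_mult)
  have G: "(1 - x div N) + (x div N mod 2) * N + (x div N div 2) * (N * N) = N ^ (x div N)"
  proof -
    have "x div N = 0 \<or> x div N = 1 \<or> x div N = 2" using g by linarith
    then show ?thesis by (elim disjE) (simp_all add: power2_eq_square)
  qed
  have "N ^ (x div N) \<le> N ^ 2" using N(2) g by (intro power_increasing) auto
  then have "u * N ^ (x div N) < 2 ^ B" if "u \<le> N" for u
    using mult_le_mono[OF that, of "N ^ (x div N)" "N ^ 2"] N(3)
    by (simp add: power2_eq_square mult.assoc)
  then have pn: "row_pos N x < 2 ^ B" "row_neg N x < 2 ^ B"
    unfolding row_pos_def row_neg_def using N(2) by (auto simp: less_imp_le)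
  have "N \<le> N * N" "N * N \<le> N * N * N" using N(2) by simp_all
  then have NB: "N < 2 ^ B" using N by linarith
  show "runs (block row_block) v m (cost row_block * (B * B * B * B)) (\<lambda>v' m'. m' = m \<and>
      v' = v(vPos := row_pos N x, vNeg := row_neg N x, vS := 1 - x div N div 2))"
    by (rule runs_block'[OF B BB])
      (use N x NB G in \<open>auto simp: row_block_def row_pos_def row_neg_def simp del: One_nat_def\<close>)
  fix v1 m1 assume v1: "m1 = m \<and>
    v1 = v(vPos := row_pos N x, vNeg := row_neg N x, vS := 1 - x div N div 2)"
  have "runs eval_code v1 m1 (eval_cost * (B * B * B * B)) (\<lambda>v' m'. m' = m1 \<and>
    v' vS = clause_mask (v1 vPos) (v1 vNeg) (v1 vS) F \<and>
    same_except {vLit, vV, vCnt, vPow, vFlag, vLen, vS, vCl} v1 v')"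
    by (rule runs_eval[OF B D(1,2)]) (use v1 D F W pn in auto)
  then show "runs eval_code v1 m1 (eval_cost * (B * B * B * B))
    (\<lambda>v' m'. m' = m \<and> v' vS = row_mask N F x \<and> same_except scratch v v')"
    by (rule runs_mono) (use v1 in \<open>auto simp: row_mask_def\<close>)
qed

section \<open>Writing the network\<close>

definition memof :: "nat list \<Rightarrow> nat \<Rightarrow> nat" where
  "memof l i = (if i < length l then l ! i else 0)"

lemma memof_snoc: "i = length l \<Longrightarrow> (memof l)(i := x) = memof (l @ [x])"
  by (auto simp: memof_def nth_append fun_eq_iff)

definition "read_block1 = [vD ::= Num 2 \<otimes> Var vD \<oplus> Var vPtr \<oplus> Num 1, vW ::= Num 0]"

definition "read_block2 = [vW ::= Var vW \<otimes> Var vD \<oplus> Var vV, Put (Var vPtr \<ominus> Num 1) (Num 0)]"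

text \<open>Horner's scheme from the last cell to the first, which makes the first number the lowest
  digit. Each cell is erased after reading, so memory ends up all zero and the pointer is back at 0
  for writing.\<close>

definition "read_code = Seq (fetch vD (Num 0)) (Seq (block read_block1)
  (loop vPtr (Seq (fetch vV (Var vPtr \<ominus> Num 1)) (block read_block2))))"

definition "read_cost = fetch_cost (Num 0) + (cost read_block1 +
  (fetch_cost (Var vPtr \<ominus> Num 1) + cost read_block2 + 13))"

lemma memof_take_Suc: "k < length xs \<Longrightarrow> (memof (take (Suc k) xs))(k := 0) = memof (take k xs)"
  by (auto simp: memof_def fun_eq_iff)

lemma runs_read:
  assumes B: "1 \<le> B" and xs: "xs \<noteq> []" "length xs < B" "hd xs = n" "\<forall>x\<in>set xs. x < 2 ^ B"
    and D: "D = 2 * n + length xs + 1" "D < 2 ^ B" "pack D xs < 2 ^ B"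
    and v: "v vPtr = length xs"
  shows "runs read_code v (memof xs) (read_cost * (B * B)) (\<lambda>v' m'. m' = memof [] \<and>
    v' vPtr = 0 \<and> v' vW = pack D xs \<and> v' vD = D)"
  unfolding read_code_def read_cost_def
proof (rule runs_Seq'[where Q = "\<lambda>v' m'. m' = memof xs \<and> v' = v(vD := n)"])
  have BB: "B \<le> B * B" using B by simp
  have x0: "memof xs 0 = n" using xs(1,3) by (simp add: memof_def hd_conv_nth)
  have n: "n < 2 ^ B" using xs(1,3,4) hd_in_set by blast
  have L: "length xs < 2 ^ B" using xs(2) less_exp[of B] by linarith
  show "runs (fetch vD (Num 0)) v (memof xs) (fetch_cost (Num 0) * (B * B))
      (\<lambda>v' m'. m' = memof xs \<and> v' = v(vD := n))"
    by (rule runs_widen[OF runs_fetch BB]) (use B n x0 in auto)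
  fix v1 m1 assume v1: "m1 = memof xs \<and> v1 = v(vD := n)"
  show "runs (Seq (block read_block1) (loop vPtr (Seq (fetch vV (Var vPtr \<ominus> Num 1)) (block read_block2))))
      v1 m1 ((cost read_block1 + (fetch_cost (Var vPtr \<ominus> Num 1) + cost read_block2 + 13)) * (B * B))
      (\<lambda>v' m'. m' = memof [] \<and> v' vPtr = 0 \<and> v' vW = pack D xs \<and> v' vD = D)"
  proof (rule runs_Seq'[where Q = "\<lambda>v' m'. m' = memof xs \<and> v' vPtr = length xs \<and> v' vD = D \<and> v' vW = 0"])
    show "runs (block read_block1) v1 m1 (cost read_block1 * (B * B))
        (\<lambda>v' m'. m' = memof xs \<and> v' vPtr = length xs \<and> v' vD = D \<and> v' vW = 0)"
      by (rule runs_block'[OF B BB]) (use v v1 n L D(1) in \<open>auto simp: read_block1_def\<close>)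
    fix v2 m2 assume v2: "m2 = memof xs \<and> v2 vPtr = length xs \<and> v2 vD = D \<and> v2 vW = 0"
    show "runs (loop vPtr (Seq (fetch vV (Var vPtr \<ominus> Num 1)) (block read_block2))) v2 m2
        ((fetch_cost (Var vPtr \<ominus> Num 1) + cost read_block2 + 13) * (B * B))
        (\<lambda>v' m'. m' = memof [] \<and> v' vPtr = 0 \<and> v' vW = pack D xs \<and> v' vD = D)"
    proof (rule runs_short_loop[OF B order_refl, where n = "length xs" and
        I = "\<lambda>j v' m'. m' = memof (take j xs) \<and> v' vD = D \<and> v' vW = pack D (drop j xs)"])
      fix j v3 m3
      assume j: "j < length xs" and I: "m3 = memof (take (Suc j) xs) \<and> v3 vD = D \<and>
        v3 vW = pack D (drop (Suc j) xs)" and v3: "v3 vPtr = Suc j"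
      have x: "m3 j = xs ! j" using I j by (auto simp: memof_def)
      have xj: "xs ! j < 2 ^ B" using xs(4) j by simp
      have jB: "Suc j < 2 ^ B" using j L by linarith
      have "pack D (drop (Suc j) xs) \<le> pack D xs"
        using pack_append_ge[of D "drop (Suc j) xs" "take (Suc j) xs"] D(1) by simp
      then have WB: "v3 vW < 2 ^ B" using I D(3) by simp
      have m: "m3(j := 0) = memof (take j xs)" using I memof_take_Suc[OF j] by simp
      have W: "pack D (drop j xs) = pack D (drop (Suc j) xs) * D + xs ! j"
        using j by (simp add: Cons_nth_drop_Suc[symmetric] mult.commute)
      show "runs (Seq (fetch vV (Var vPtr \<ominus> Num 1)) (block read_block2)) v3 m3
        ((fetch_cost (Var vPtr \<ominus> Num 1) + cost read_block2) * B)
        (\<lambda>v' m'. v' vPtr = Suc j \<and> m' = memof (take j xs) \<and> (v'(vPtr := j)) vD = D \<and>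
          (v'(vPtr := j)) vW = pack D (drop j xs))"
      proof (rule runs_Seq'[where Q = "\<lambda>v' m'. m' = m3 \<and> v' = v3(vV := xs ! j)"])
        show "runs (fetch vV (Var vPtr \<ominus> Num 1)) v3 m3 (fetch_cost (Var vPtr \<ominus> Num 1) * B)
            (\<lambda>v' m'. m' = m3 \<and> v' = v3(vV := xs ! j))"
          by (rule runs_fetch[OF B]) (use v3 x xj jB in auto)
        fix v4 m4 assume v4: "m4 = m3 \<and> v4 = v3(vV := xs ! j)"
        show "runs (block read_block2) v4 m4 (cost read_block2 * B)
          (\<lambda>v' m'. v' vPtr = Suc j \<and> m' = memof (take j xs) \<and> (v'(vPtr := j)) vD = D \<and>
            (v'(vPtr := j)) vW = pack D (drop j xs))"
          by (rule runs_block'[OF B order_refl])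
            (use v4 v3 I xj jB WB D(2) m W in \<open>auto simp: read_block2_def\<close>)
      qed
    qed (use v2 xs in auto)
  qed
qed

definition emit :: "exp \<Rightarrow> stmt list" where
  "emit e = [Put (Var vPtr) e, vPtr ::= Var vPtr \<oplus> Num 1]"

definition "fill_code e = loop vRow (block (emit e))"

definition "fill_cost e = cost (emit e) + 13"

lemma runs_fill:
  assumes B: "1 \<le> B" and e: "stmt_okay (Put (Var vPtr) e)" "vPtr \<notin> exp_vars e" "vRow \<notin> exp_vars e"
    "\<forall>i\<in>exp_vars e. v i < 2 ^ B" "val e v = c"
    and v: "v vPtr = length l" "m = memof l" "v vRow = n" "length l + n < 2 ^ B" and U: "(n + 1) * B \<le> U"
  shows "runs (fill_code e) v m (fill_cost e * U) (\<lambda>v' m'. m' = memof (l @ replicate n c) \<and>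
    v' vPtr = length l + n \<and> same_except {vPtr, vRow} v v')"
  unfolding fill_code_def fill_cost_def
proof (rule runs_widen[OF _ U], rule runs_loop'[OF B order_refl, where I = "\<lambda>j v' m'.
    m' = memof (l @ replicate (n - j) c) \<and> v' vPtr = length l + (n - j) \<and> same_except {vPtr, vRow} v v'"])
  fix j v1 m1
  assume j: "j < n" and I: "m1 = memof (l @ replicate (n - Suc j) c) \<and>
    v1 vPtr = length l + (n - Suc j) \<and> same_except {vPtr, vRow} v v1" and v1: "v1 vRow = Suc j"
  have "i \<noteq> vPtr \<and> i \<noteq> vRow" if "i \<in> exp_vars e" for i using that e(2,3) by metis
  then have i: "v1 i = v i" if "i \<in> exp_vars e" for i using that I by simp
  then have ev: "val e v1 = c" using e(5) val_cong[of e v1 v] by simp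
  have nj: "n - j = Suc (n - Suc j)" using j by simp
  have m: "m1(length l + (n - Suc j) := c) = memof (l @ replicate (n - j) c)"
    using I nj by (simp add: memof_snoc replicate_append_same)
  have p: "v1 vPtr < 2 ^ B" using I v(4) by linarith
  show "runs (block (emit e)) v1 m1 (cost (emit e) * B) (\<lambda>v' m'. v' vRow = Suc j \<and>
    m' = memof (l @ replicate (n - j) c) \<and> (v'(vRow := j)) vPtr = length l + (n - j) \<and>
    same_except {vPtr, vRow} v (v'(vRow := j)))"
    by (rule runs_block'[OF B order_refl])
      (use e(1,4) i ev m nj I v1 p in \<open>auto simp: emit_def\<close>)
qed (use v in auto)

section \<open>Size parameters of the reduction for a fixed formula\<close>

locale sat_instance =
  fixes k n :: nat and F :: cnf
  assumes kcnf: "k_cnf k n F" and F: "F \<noteq> []"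
begin

text \<open>The \<open>+ 1\<close> makes \<open>q\<close> positive and lets three blocks cover all
  \<open>n\<close> variables; it costs at most a factor 2 in \<open>N\<close>.\<close>

definition "q = n div 3 + 1"
definition "N = (2::nat) ^ q"
definition "M = length F + 1"
definition "input = encode_cnf n F"
text \<open>A base above every number in the input: literal codes are below \<open>2 * n\<close>,
  and all lengths are below that of the input.\<close>

definition "D = 2 * n + length input + 1"
text \<open>The packed input is below \<open>D ^ D \<le> 2 ^ (D * D)\<close>, so it has at most
  \<open>B\<close> bits; the 20 leaves room for numerical factors.\<close>

definition "B = (D + 20) * (D + 20)"
definition "W = pack D (concat (map encode_clause F))"

lemma N_ge_1: "1 \<le> N" by (simp add: N_def)

sublocale network N M "row_sat N F" "length F"
  unfolding M_def by (rule network_row_sat[OF N_ge_1])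

lemma input_eq: "input = n # length F # concat (map encode_clause F)"
  by (simp add: input_def encode_cnf_def)

lemma length_clauses: "length F \<le> length (concat (map encode_clause F))"
  by (induction F) (auto simp: encode_clause_def)

lemma M_less: "M < length input"
  using length_clauses by (simp add: input_eq M_def)

lemma B_ge: "D + 20 \<le> B" "D * D \<le> B"
  by (simp_all add: B_def algebra_simps)

lemma B_ge_1: "1 \<le> B" using B_ge(1) by simp

lemma D_le: "D \<le> B" using B_ge(1) by simp

lemma D_pos: "0 < D" by (simp add: D_def)

lemma lit_bound: "C \<in> set F \<Longrightarrow> l \<in> set C \<Longrightarrow> encode_lit l < 2 * n"
  using kcnf by (cases l) (fastforce simp: k_cnf_def)

lemma clause_length_less: "C \<in> set F \<Longrightarrow> length C < length input"
proof -
  assume "C \<in> set F"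
  then have "length (encode_clause C) \<le> length (concat (map encode_clause F))"
    by (auto simp: length_concat comp_def intro: member_le_sum_list)
  then show ?thesis by (simp add: encode_clause_def input_eq)
qed

lemma fits: "fits D F"
  using lit_bound clause_length_less by (force simp: fits_def D_def)

lemma input_less: "\<forall>x\<in>set input. x < D"
proof -
  have "x < D" if "C \<in> set F" "x \<in> set (encode_clause C)" for C x
    using that fits by (auto simp: encode_clause_def fits_def)
  moreover have "length F < D" using M_less by (simp add: D_def M_def)
  ultimately show ?thesis by (auto simp: input_eq D_def)
qed

lemma pack_input: "pack D input = n + D * (length F + D * W)"
  by (simp add: input_eq W_def)

lemma pack_input_less: "pack D input < 2 ^ B"
proof -
  have "pack D input < D ^ length input" by (rule pack_less[OF input_less])
  also have "\<dots> \<le> (2 ^ D) ^ length input" by (intro power_mono less_imp_le[OF less_exp]) simp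
  also have "\<dots> \<le> (2 ^ D) ^ D" by (intro power_increasing) (auto simp: D_def)
  also have "\<dots> \<le> 2 ^ B" unfolding power_mult[symmetric] using B_ge by (intro power_increasing) auto
  finally show ?thesis .
qed

lemma W_less: "W < 2 ^ B"
proof -
  have "W \<le> D * W" "D * W \<le> D * (D * W)" "D * (D * W) \<le> pack D input"
    unfolding pack_input using D_pos by (simp_all add: distrib_left)
  then show ?thesis using pack_input_less by linarith
qed

text \<open>\<open>N * N * N * M\<close> dominates all sizes in the network, so the individual
  bounds follow from this one by linear arithmetic.\<close>

lemma big: "16 * (N * N * N * M) < 2 ^ B"
proof -
  have "16 * (N * N * N * M) < 16 * (N * N * N * 2 ^ M)"
    using N_ge_1 less_exp[of M] by simp
  also have "\<dots> = 2 ^ (4 + q + q + q + M)"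
    unfolding power_add N_def by simp
  also have "\<dots> \<le> 2 ^ B"
    using B_ge(1) M_less by (intro power_increasing) (auto simp: q_def D_def)
  finally show ?thesis .
qed

lemma M_less_B: "M < B"
  using B_ge(1) M_less by (simp add: D_def)

lemma bounds:
  "N * N * N < 2 ^ B" "N < 2 ^ B" "M < 2 ^ B" "nodes < 2 ^ B" "2 + nodes + 6 * N * M < 2 ^ B"
  "2 * N * N * (M + 1) + 2 * N < 2 ^ B"
proof -
  have M: "1 \<le> M" by (simp add: M_def)
  define a where "a = N * M"
  define b where "b = N * N"
  define c where "c = N * N * M"
  define d where "d = N * N * N * M"
  have 1: "N \<le> a" "M \<le> a" using N_ge_1 M by (simp_all add: a_def)
  have 2: "N \<le> b" "b \<le> c" "a \<le> c" using N_ge_1 M by (simp_all add: a_def b_def c_def)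
  have 3: "c \<le> d" "N * N * N \<le> d" using N_ge_1 M by (simp_all add: c_def d_def)
  have n: "nodes = 3 * N + M + 3 * a" by (simp add: nodes_def a_def)
  have t: "2 * N * N * (M + 1) = 2 * c + 2 * b" by (simp add: b_def c_def algebra_simps)
  have big': "16 * d < 2 ^ B" using big by (simp add: d_def)
  note all = 1 2 3 n t big' N_ge_1 M
  show "N * N * N < 2 ^ B" "N < 2 ^ B" "M < 2 ^ B" "nodes < 2 ^ B"
    "2 * N * N * (M + 1) + 2 * N < 2 ^ B" using all by linarith+
  have "6 * N * M = 6 * a" by (simp add: a_def)
  then show "2 + nodes + 6 * N * M < 2 ^ B" using all by linarith
qed

text \<open>The values that stay fixed once set up. \<open>vM\<close> holds the number of clauses,
  one less than the number \<open>M\<close> of columns, which includes the hub.\<close>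

definition env :: "(nat \<Rightarrow> nat) \<Rightarrow> bool" where
  "env v \<longleftrightarrow> v vD = D \<and> v vW = W \<and> v vM = length F \<and> v vN = N \<and> v vNodes = nodes"

abbreviation "B4 \<equiv> B * B * B * B"

lemma B_le_B4: "B \<le> B4" "B * B \<le> B4"
  using B_ge_1 by simp_all

lemma runs_row_env:
  assumes "env v" "v vX = x" "x < 3 * N"
  shows "runs row_code v m (row_cost * B4)
    (\<lambda>v' m'. m' = m \<and> v' vS = row_mask N F x \<and> same_except scratch v v')"
proof (rule runs_row[OF B_ge_1 D_le D_pos _ fits])
  have "3 * N < 2 ^ B" using bounds(4) by (simp add: nodes_def)
  then show "x < 2 ^ B" using assms(3) by linarith
qed (use assms M_less_B W_less N_ge_1 bounds in \<open>auto simp: env_def W_def M_def\<close>)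

lemma row_mask_bound: "row_mask N F x < 2 ^ B"
proof -
  have "row_mask N F x < 2 ^ M"
    unfolding row_mask_def M_def by (rule clause_mask_less) simp
  also have "\<dots> \<le> 2 ^ B" using M_less_B by (intro power_increasing) auto
  finally show ?thesis .
qed

end

section \<open>Program text for writing the network and for scanning the flow values\<close>

definition "setup_block1 = [vCnt ::= Var vW \<odot> Var vD \<oslash> Num 3 \<oplus> Num 1, vW ::= Var vW \<oslash> Var vD,
  vM ::= Var vW \<odot> Var vD, vW ::= Var vW \<oslash> Var vD]"

definition "setup_block2 = [vN ::= Var vPow, vNodes ::= Num 3 \<otimes> Var vN \<oplus> (Var vM \<oplus> Num 1) \<oplus>
  Num 3 \<otimes> Var vN \<otimes> (Var vM \<oplus> Num 1)]"

definition "setup_code = Seq (block setup_block1) (Seq pow_code (block setup_block2))"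

definition "setup_cost = cost setup_block1 + (pow_cost + cost setup_block2)"

definition "header_block = emit (Var vNodes) @
  emit (Num 3 \<otimes> Var vN \<otimes> (Var vM \<oplus> Num 1)) @ [vRow ::= Num 2 \<otimes> Var vN]"

definition "caps_block1 = [vRow ::= Var vN]"

definition "caps_block2 = [vRow ::= (Var vM \<oplus> Num 1) \<oplus> Num 3 \<otimes> Var vN \<otimes> (Var vM \<oplus> Num 1)]"

definition "header_code = Seq (block header_block) (Seq (fill_code (Num 1)) (Seq (block caps_block1)
  (Seq (fill_code (Num 2 \<otimes> Var vN)) (Seq (block caps_block2) (fill_code (Num 2 \<otimes> Var vN \<otimes> Var vN))))))"

definition "header_cost = cost header_block + (fill_cost (Num 1) + (cost caps_block1 +
  (fill_cost (Num 2 \<otimes> Var vN) + (cost caps_block2 + fill_cost (Num 2 \<otimes> Var vN \<otimes> Var vN)))))"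

abbreviation (input) "column \<equiv> Var vM \<oplus> Num 1 \<ominus> Var vCol"

text \<open>\<open>1 - x div N\<close> is 1 exactly for sources, so the second assignment to
  \<open>vFlag\<close> turns the satisfaction bit into \<open>wired\<close>. The target is then
  selected by multiplication with this bit, without branching.\<close>

definition "edge_block = [vFlag ::= Var vS \<odot> Num 2, vS ::= Var vS \<oslash> Num 2,
  vFlag ::= (Num 1 \<ominus> Var vX \<oslash> Var vN) \<otimes> Var vFlag \<oplus>
    (Num 1 \<ominus> (Num 1 \<ominus> Var vX \<oslash> Var vN)) \<otimes> (Num 1 \<ominus> Var vFlag)] @
  emit (Var vX) @
  emit (Var vFlag \<otimes> (Num 3 \<otimes> Var vN \<oplus> column) \<oplus> (Num 1 \<ominus> Var vFlag) \<otimes>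
    (Num 3 \<otimes> Var vN \<oplus> (Var vM \<oplus> Num 1) \<oplus> (Var vX \<otimes> (Var vM \<oplus> Num 1) \<oplus> column)))"

definition "edges_block1 = [vRow ::= Num 3 \<otimes> Var vN]"

definition "edges_block2 = [vX ::= Num 3 \<otimes> Var vN \<ominus> Var vRow]"

definition "edges_block3 = [vCol ::= Var vM \<oplus> Num 1]"

definition "row_edges_code = Seq (block edges_block2) (Seq row_code (Seq (block edges_block3)
  (loop vCol (block edge_block))))"

definition "row_edges_cost = cost edges_block2 + (row_cost + (cost edges_block3 + (cost edge_block + 13)))"

definition "edges_code = Seq (block edges_block1) (loop vRow row_edges_code)"

definition "edges_cost = cost edges_block1 + (row_edges_cost + 13)"

definition "build_code = Seq read_code (Seq setup_code (Seq header_code edges_code))"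

definition "build_cost = read_cost + (setup_cost + (header_cost + edges_cost))"

definition "count_block = [vSum ::= Var vSum \<oplus> (Var vV \<odot> Num 2) \<otimes> (Num 1 \<ominus> Var vS \<odot> Num 2),
  vV ::= Var vV \<oslash> Num 2, vS ::= Var vS \<oslash> Num 2]"

definition "pair_block1 = [vX ::= Var vN \<oplus> (Var vN \<ominus> Var vCol)]"

text \<open>The sum starts at 1 because the threshold counts one more than the direct
  columns.\<close>

definition "pair_block2 = [vSum ::= Num 1, vV ::= Var vT, vCl ::= Var vM \<oplus> Num 1]"

definition "pair_address = (Var vN \<ominus> Var vRow) \<otimes> Var vNodes \<oplus> Var vX"

text \<open>\<open>1 - (c - threshold)\<close> in truncated arithmetic is 1 exactly if
  \<open>c\<close> is at most the threshold; the outer part is a disjunction with the flag so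
  far.\<close>

definition "pair_block3 = [vFound ::= Num 1 \<ominus> (Num 1 \<ominus> Var vFound) \<otimes>
  (Num 1 \<ominus> (Num 1 \<ominus> (Var vV \<ominus> Num 2 \<otimes> Var vN \<otimes> Var vN \<otimes> Var vSum)))]"

definition "pair_code = Seq (block pair_block1) (Seq row_code (Seq (block pair_block2)
  (Seq (loop vCl (block count_block)) (Seq (fetch vV pair_address) (block pair_block3)))))"

definition "pair_cost = cost pair_block1 + (row_cost + (cost pair_block2 +
  ((cost count_block + 13) + (fetch_cost pair_address + cost pair_block3))))"

definition "scan_block1 = [vFound ::= Num 0, vRow ::= Var vN]"

definition "scan_block2 = [vX ::= Var vN \<ominus> Var vRow]"

definition "scan_block3 = [vT ::= Var vS, vCol ::= Var vN]"

definition "scan_block4 = [Put (Num 0) (Var vFound)]"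

definition "scan_row_code = Seq (block scan_block2) (Seq row_code (Seq (block scan_block3) (loop vCol pair_code)))"

definition "scan_row_cost = cost scan_block2 + (row_cost + (cost scan_block3 + (pair_cost + 13)))"

definition "scan_code = Seq (block scan_block1) (Seq (loop vRow scan_row_code) (block scan_block4))"

definition "scan_cost = cost scan_block1 + ((scan_row_cost + 13) + cost scan_block4)"

section \<open>Correctness and cost of writing the network\<close>

context sat_instance
begin

definition "network_code = encode_network nodes edges caps"

definition row_edges :: "nat \<Rightarrow> nat \<Rightarrow> nat list" where
  "row_edges x i = concat (map (\<lambda>j. [x, target x j]) [0..<i])"

lemma length_row_edges: "length (row_edges x i) = 2 * i"
  by (simp add: row_edges_def length_concat comp_def sum_list_triv)

lemma length_rows: "length (concat (map (\<lambda>x. row_edges x M) [0..<i])) = i * (2 * M)"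
  by (simp add: length_concat comp_def length_row_edges sum_list_triv)

lemma concat_map_concat: "concat (map f (concat xss)) = concat (map (\<lambda>xs. concat (map f xs)) xss)"
  by (induction xss) auto

lemma network_code_eq: "network_code = (nodes # 3 * N * M # caps) @
    concat (map (\<lambda>x. row_edges x M) [0..<3 * N])"
proof -
  have "concat (map (\<lambda>(u, v). [u, v]) edges) = concat (map (\<lambda>x. row_edges x M) [0..<3 * N])"
    by (simp add: edges_def row_edges_def concat_map_concat comp_def)
  then show ?thesis by (simp add: network_code_def encode_network_def length_edges)
qed

lemma length_network_code: "length network_code = 2 + nodes + 6 * N * M"
  by (simp add: network_code_eq length_caps length_rows)

lemma runs_setup:
  assumes "v vW = pack D input" "v vD = D" "v vPtr = 0"
  shows "runs setup_code v m (setup_cost * (B * B))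
    (\<lambda>v' m'. m' = m \<and> env v' \<and> v' vPtr = 0)"
  unfolding setup_code_def setup_cost_def
proof (rule runs_Seq'[where Q = "\<lambda>v' m'. m' = m \<and> v' = v(vCnt := q, vM := length F, vW := W)"])
  have BB: "B \<le> B * B" using B_ge_1 by simp
  have DB: "D < 2 ^ B" using D_le by (intro le_less_trans[OF _ less_exp])
  have n: "n < D" "length F < D" using M_less by (simp_all add: D_def M_def)
  have 1: "pack D input mod D = n" "pack D input div D = length F + D * W"
    "(length F + D * W) mod D = length F" "(length F + D * W) div D = W"
    using n D_pos by (simp_all add: pack_input)
  show "runs (block setup_block1) v m (cost setup_block1 * (B * B))
      (\<lambda>v' m'. m' = m \<and> v' = v(vCnt := q, vM := length F, vW := W))"
    by (rule runs_block'[OF B_ge_1 BB])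
      (use assms pack_input_less DB 1 in \<open>auto simp: setup_block1_def q_def simp del: One_nat_def\<close>)
  fix v1 m1 assume v1: "m1 = m \<and> v1 = v(vCnt := q, vM := length F, vW := W)"
  have qB: "q < B" using B_ge(1) by (simp add: q_def D_def)
  show "runs (Seq pow_code (block setup_block2)) v1 m1 ((pow_cost + cost setup_block2) * (B * B))
      (\<lambda>v' m'. m' = m \<and> env v' \<and> v' vPtr = 0)"
  proof (rule runs_Seq')
    show "runs pow_code v1 m1 (pow_cost * (B * B))
        (\<lambda>v' m'. m' = m1 \<and> v' vPow = 2 ^ q \<and> same_except {vPow, vCnt} v1 v')"
      by (rule runs_pow[OF B_ge_1]) (use v1 qB in auto)
    fix v2 m2 assume v2: "m2 = m1 \<and> v2 vPow = 2 ^ q \<and> same_except {vPow, vCnt} v1 v2"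
    have "length F < 2 ^ B" using bounds(3) by (simp add: M_def)
    moreover have "3 * N + (length F + 1) + 3 * N * (length F + 1) = nodes"
      unfolding nodes_def by (simp add: M_def)
    moreover have "v2 vPow = N" using v2 by (simp add: N_def)
    ultimately show "runs (block setup_block2) v2 m2 (cost setup_block2 * (B * B))
        (\<lambda>v' m'. m' = m \<and> env v' \<and> v' vPtr = 0)"
      by (intro runs_block'[OF B_ge_1 BB])
        (use v1 v2 assms bounds(2) in
          \<open>auto simp: setup_block2_def env_def simp del: One_nat_def\<close>)
  qed
qed

lemma env_bounds: "env v \<Longrightarrow> v vD < 2 ^ B \<and> v vM < 2 ^ B \<and> v vN < 2 ^ B \<and> v vNodes < 2 ^ B \<and> v vW < 2 ^ B"
proof -
  assume env: "env v"
  have "D < 2 ^ B" using D_le by (intro le_less_trans[OF _ less_exp])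
  moreover have "length F < 2 ^ B" using bounds(3) by (simp add: M_def)
  ultimately show ?thesis using env bounds(2,4) W_less by (simp add: env_def)
qed

lemma env_cong: "env v \<Longrightarrow> v' vD = v vD \<Longrightarrow> v' vW = v vW \<Longrightarrow> v' vM = v vM \<Longrightarrow> v' vN = v vN \<Longrightarrow>
    v' vNodes = v vNodes \<Longrightarrow> env v'"
  by (simp add: env_def)

text \<open>The unit for writing the network: linear in the number of nodes, with \<open>B4\<close>
  paying for the evaluation of the formula on one row.\<close>

abbreviation "U \<equiv> (nodes + 1) * B4"

lemma U_bounds: "B \<le> U" "B4 \<le> U" "x \<le> nodes \<Longrightarrow> (x + 1) * B \<le> U"
proof -
  show "B4 \<le> U" by simp
  then show "B \<le> U" using B_le_B4(1) by (rule order_trans[rotated])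
  show "(x + 1) * B \<le> U" if "x \<le> nodes" using B_le_B4(1) that by (intro mult_le_mono) auto
qed

lemma runs_header:
  assumes env: "env v" and v: "v vPtr = 0" "m = memof []"
  shows "runs header_code v m (header_cost * U) (\<lambda>v' m'. m' = memof (nodes # 3 * N * M # caps) \<and>
    v' vPtr = length (nodes # 3 * N * M # caps) \<and> env v')"
  unfolding header_code_def header_cost_def
proof (rule runs_Seq'[where Q = "\<lambda>v' m'. m' = memof [nodes, 3 * N * M] \<and> v' = v(vPtr := 2, vRow := 2 * N)"])
  have len: "2 + nodes < 2 ^ B" using bounds(5) by linarith
  have n: "nodes = 3 * N + M + 3 * N * M" by (simp add: nodes_def)
  have MF: "length F + 1 = M" by (simp add: M_def)
  have "(memof [])(0 := nodes, Suc 0 := 3 * N * M) = memof [nodes, 3 * N * M]"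
    by (subst memof_snoc, simp)+ simp
  then show "runs (block header_block) v m (cost header_block * U)
      (\<lambda>v' m'. m' = memof [nodes, 3 * N * M] \<and> v' = v(vPtr := 2, vRow := 2 * N))"
    by (intro runs_block'[OF B_ge_1 U_bounds(1)])
      (use env_bounds[OF env] env v MF in \<open>auto simp: header_block_def emit_def env_def\<close>)
  fix v1 m1 assume 1: "m1 = memof [nodes, 3 * N * M] \<and> v1 = v(vPtr := 2, vRow := 2 * N)"
  show "runs (Seq (fill_code (Num 1)) (Seq (block caps_block1) (Seq (fill_code (Num 2 \<otimes> Var vN))
      (Seq (block caps_block2) (fill_code (Num 2 \<otimes> Var vN \<otimes> Var vN)))))) v1 m1
      ((fill_cost (Num 1) + (cost caps_block1 + (fill_cost (Num 2 \<otimes> Var vN) +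
        (cost caps_block2 + fill_cost (Num 2 \<otimes> Var vN \<otimes> Var vN))))) * U)
      (\<lambda>v' m'. m' = memof (nodes # 3 * N * M # caps) \<and>
        v' vPtr = length (nodes # 3 * N * M # caps) \<and> env v')"
  proof (rule runs_Seq')
    let ?l1 = "[nodes, 3 * N * M] @ replicate (2 * N) 1"
    show "runs (fill_code (Num 1)) v1 m1 (fill_cost (Num 1) * U) (\<lambda>v' m'. m' = memof ?l1 \<and>
        v' vPtr = length [nodes, 3 * N * M] + 2 * N \<and> same_except {vPtr, vRow} v1 v')"
      by (rule runs_fill[OF B_ge_1 _ _ _ _ _ _ _ _ _ U_bounds(3)]) (use 1 n len in auto)
    fix v2 m2 assume 2: "m2 = memof ?l1 \<and>
        v2 vPtr = length [nodes, 3 * N * M] + 2 * N \<and> same_except {vPtr, vRow} v1 v2"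
    have env2: "env v2" using env_cong[OF env, of v2] 1 2 by simp
    show "runs (Seq (block caps_block1) (Seq (fill_code (Num 2 \<otimes> Var vN))
      (Seq (block caps_block2) (fill_code (Num 2 \<otimes> Var vN \<otimes> Var vN))))) v2 m2
      ((cost caps_block1 + (fill_cost (Num 2 \<otimes> Var vN) +
        (cost caps_block2 + fill_cost (Num 2 \<otimes> Var vN \<otimes> Var vN)))) * U)
      (\<lambda>v' m'. m' = memof (nodes # 3 * N * M # caps) \<and>
        v' vPtr = length (nodes # 3 * N * M # caps) \<and> env v')"
    proof (rule runs_Seq'[where Q = "\<lambda>v' m'. m' = m2 \<and> v' = v2(vRow := N)"])
      show "runs (block caps_block1) v2 m2 (cost caps_block1 * U) (\<lambda>v' m'. m' = m2 \<and> v' = v2(vRow := N))"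
        by (rule runs_block'[OF B_ge_1 U_bounds(1)])
          (use env_bounds[OF env2] env2 in \<open>auto simp: caps_block1_def env_def\<close>)
      fix v3 m3 assume 3: "m3 = m2 \<and> v3 = v2(vRow := N)"
      have env3: "env v3" using env_cong[OF env2, of v3] 3 by simp
      let ?l2 = "?l1 @ replicate N (2 * N)"
      show "runs (Seq (fill_code (Num 2 \<otimes> Var vN)) (Seq (block caps_block2)
          (fill_code (Num 2 \<otimes> Var vN \<otimes> Var vN)))) v3 m3
        ((fill_cost (Num 2 \<otimes> Var vN) + (cost caps_block2 + fill_cost (Num 2 \<otimes> Var vN \<otimes> Var vN))) * U)
        (\<lambda>v' m'. m' = memof (nodes # 3 * N * M # caps) \<and>
          v' vPtr = length (nodes # 3 * N * M # caps) \<and> env v')"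
      proof (rule runs_Seq')
        show "runs (fill_code (Num 2 \<otimes> Var vN)) v3 m3 (fill_cost (Num 2 \<otimes> Var vN) * U)
          (\<lambda>v' m'. m' = memof ?l2 \<and> v' vPtr = length ?l1 + N \<and> same_except {vPtr, vRow} v3 v')"
          by (rule runs_fill[OF B_ge_1 _ _ _ _ _ _ _ _ _ U_bounds(3)])
            (use 2 3 n len env3 env_bounds[OF env3] in \<open>auto simp: env_def\<close>)
        fix v4 m4 assume 4: "m4 = memof ?l2 \<and> v4 vPtr = length ?l1 + N \<and> same_except {vPtr, vRow} v3 v4"
        have env4: "env v4" using env_cong[OF env3, of v4] 4 by simp
        show "runs (Seq (block caps_block2) (fill_code (Num 2 \<otimes> Var vN \<otimes> Var vN))) v4 m4
          ((cost caps_block2 + fill_cost (Num 2 \<otimes> Var vN \<otimes> Var vN)) * U)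
          (\<lambda>v' m'. m' = memof (nodes # 3 * N * M # caps) \<and>
            v' vPtr = length (nodes # 3 * N * M # caps) \<and> env v')"
        proof (rule runs_Seq'[where Q = "\<lambda>v' m'. m' = m4 \<and> v' = v4(vRow := M + 3 * N * M)"])
          show "runs (block caps_block2) v4 m4 (cost caps_block2 * U)
              (\<lambda>v' m'. m' = m4 \<and> v' = v4(vRow := M + 3 * N * M))"
            by (rule runs_block'[OF B_ge_1 U_bounds(1)])
              (use env_bounds[OF env4] env4 MF in \<open>auto simp: caps_block2_def env_def\<close>)
          fix v5 m5 assume 5: "m5 = m4 \<and> v5 = v4(vRow := M + 3 * N * M)"
          have env5: "env v5" using env_cong[OF env4, of v5] 5 by simp
          let ?l3 = "?l2 @ replicate (M + 3 * N * M) (2 * N * N)"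
          have l3: "?l3 = nodes # 3 * N * M # caps" by (simp add: caps_def)
          have "runs (fill_code (Num 2 \<otimes> Var vN \<otimes> Var vN)) v5 m5 (fill_cost (Num 2 \<otimes> Var vN \<otimes> Var vN) * U)
            (\<lambda>v' m'. m' = memof ?l3 \<and> v' vPtr = length ?l2 + (M + 3 * N * M) \<and> same_except {vPtr, vRow} v5 v')"
            by (rule runs_fill[OF B_ge_1 _ _ _ _ _ _ _ _ _ U_bounds(3)])
              (use 4 5 n len env5 env_bounds[OF env5] in \<open>auto simp: env_def\<close>)
          then show "runs (fill_code (Num 2 \<otimes> Var vN \<otimes> Var vN)) v5 m5 (fill_cost (Num 2 \<otimes> Var vN \<otimes> Var vN) * U)
            (\<lambda>v' m'. m' = memof (nodes # 3 * N * M # caps) \<and>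
              v' vPtr = length (nodes # 3 * N * M # caps) \<and> env v')"
          proof (rule runs_mono[OF _ order_refl])
            fix v' m' assume 6: "m' = memof ?l3 \<and> v' vPtr = length ?l2 + (M + 3 * N * M) \<and>
              same_except {vPtr, vRow} v5 v'"
            have "env v'" using env_cong[OF env5, of v'] 6 by simp
            moreover have "length ?l2 + (M + 3 * N * M) = length ?l3" by simp
            ultimately show "m' = memof (nodes # 3 * N * M # caps) \<and>
              v' vPtr = length (nodes # 3 * N * M # caps) \<and> env v'"
              using 6 unfolding l3 by simp
          qed
        qed
      qed
    qed
  qed
qed

lemma runs_row_edges:
  assumes env: "env v" and x: "x < 3 * N" "v vRow = 3 * N - x" and v: "m = memof l" "v vPtr = length l"
    and l: "length l + 2 * M < 2 ^ B"
  shows "runs row_edges_code v m (row_edges_cost * B4) (\<lambda>v' m'. m' = memof (l @ row_edges x M) \<and>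
    v' vPtr = length l + 2 * M \<and> env v' \<and> v' vRow = v vRow)"
  unfolding row_edges_code_def row_edges_cost_def
proof (rule runs_Seq'[where Q = "\<lambda>v' m'. m' = m \<and> v' = v(vX := x)"])
  note U4 = runs_block'[OF B_ge_1 B_le_B4(1)]
  have N3: "3 * N < 2 ^ B" using bounds(4) by (simp add: nodes_def)
  have MF: "length F + 1 = M" by (simp add: M_def)
  show "runs (block edges_block2) v m (cost edges_block2 * B4) (\<lambda>v' m'. m' = m \<and> v' = v(vX := x))"
    by (rule U4) (use env env_bounds[OF env] x N3 in \<open>auto simp: edges_block2_def env_def\<close>)
  fix v1 m1 assume 1: "m1 = m \<and> v1 = v(vX := x)"
  have env1: "env v1" using env_cong[OF env, of v1] 1 by simp
  show "runs (Seq row_code (Seq (block edges_block3) (loop vCol (block edge_block)))) v1 m1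
      ((row_cost + (cost edges_block3 + (cost edge_block + 13))) * B4)
      (\<lambda>v' m'. m' = memof (l @ row_edges x M) \<and> v' vPtr = length l + 2 * M \<and> env v' \<and> v' vRow = v vRow)"
  proof (rule runs_Seq'[OF runs_row_env[OF env1 _ x(1)]])
    show "v1 vX = x" using 1 by simp
    fix v2 m2 assume 2: "m2 = m1 \<and> v2 vS = row_mask N F x \<and> same_except scratch v1 v2"
    have env2: "env v2" using env_cong[OF env1, of v2] 2 by simp
    show "runs (Seq (block edges_block3) (loop vCol (block edge_block))) v2 m2
      ((cost edges_block3 + (cost edge_block + 13)) * B4)
      (\<lambda>v' m'. m' = memof (l @ row_edges x M) \<and> v' vPtr = length l + 2 * M \<and> env v' \<and> v' vRow = v vRow)"
    proof (rule runs_Seq'[where Q = "\<lambda>v' m'. m' = m2 \<and> v' = v2(vCol := M)"])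
      show "runs (block edges_block3) v2 m2 (cost edges_block3 * B4) (\<lambda>v' m'. m' = m2 \<and> v' = v2(vCol := M))"
        by (rule U4) (use env2 env_bounds[OF env2] MF in \<open>auto simp: edges_block3_def env_def\<close>)
      fix v3 m3 assume 3: "m3 = m2 \<and> v3 = v2(vCol := M)"
      have env3: "env v3" using env_cong[OF env2, of v3] 3 by simp
      let ?I = "\<lambda>j v' m'. m' = memof (l @ row_edges x (M - j)) \<and> v' vPtr = length l + 2 * (M - j) \<and>
        v' vS = row_mask N F x div 2 ^ (M - j) \<and> v' vX = x \<and> env v' \<and> v' vRow = v vRow"
      show "runs (loop vCol (block edge_block)) v3 m3 ((cost edge_block + 13) * B4)
        (\<lambda>v' m'. m' = memof (l @ row_edges x M) \<and> v' vPtr = length l + 2 * M \<and> env v' \<and> v' vRow = v vRow)"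
      proof (rule runs_widen[OF runs_short_loop[OF B_ge_1 order_refl, where n = M and I = ?I] B_le_B4(2)])
        fix j v4 m4 assume j: "j < M" and I: "?I (Suc j) v4 m4" and v4: "v4 vCol = Suc j"
        define i where "i = M - Suc j"
        have i: "M - j = Suc i" "i < M" "length F + 1 - Suc j = i" using j MF by (simp_all add: i_def)
        have S: "v4 vS = row_mask N F x div 2 ^ i" using I by (simp add: i_def)
        have SB: "v4 vS < 2 ^ B" unfolding S by (rule le_less_trans[OF div_le_dividend row_mask_bound])
        have S2: "v4 vS div 2 = row_mask N F x div 2 ^ Suc i"
          unfolding S by (simp add: div_mult2_eq mult.commute[of 2])
        have ptr: "v4 vPtr = length l + 2 * i" using I by (simp add: i_def)
        then have pB: "v4 vPtr < 2 ^ B" using l i(2) by linarith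
        have xB: "x < 2 ^ B" using x(1) N3 by linarith
        have jB: "Suc j < 2 ^ B" using j bounds(3) by linarith
        have sat: "v4 vS mod 2 = of_bool (row_sat N F x i)"
          unfolding S row_sat_def by (simp add: mod_2_eq_odd)
        have low: "1 - x div N = of_bool (x < N)"
          using N_ge_1 by (auto simp: div_eq_0_iff Suc_le_eq div_greater_zero_iff)
        have t: "of_bool (wired x i) * (3 * N + i) + (1 - of_bool (wired x i)) * (3 * N + M + (x * M + i)) = target x i"
          by (simp add: target_def)
        have w: "of_bool (x < N) * of_bool (row_sat N F x i) + (1 - of_bool (x < N)) * (1 - of_bool (row_sat N F x i))
            = (of_bool (wired x i) :: nat)"
          by (simp add: wired_def)
        have mem: "m4(length l + 2 * i := x, length l + 2 * i + 1 := target x i) =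
            memof (l @ row_edges x (Suc i))"
          using I by (simp add: memof_snoc length_row_edges i_def[symmetric])
            (simp add: row_edges_def)
        have fv: "final_vars edge_block v4 = v4(vFlag := of_bool (wired x i),
            vS := row_mask N F x div 2 ^ Suc i, vPtr := length l + 2 * Suc i)"
          using I ptr sat low w S2 by (auto simp: edge_block_def emit_def env_def fun_eq_iff simp del: One_nat_def power_Suc)
        have fm: "final_mem edge_block v4 m4 = memof (l @ row_edges x (Suc i))"
          using I ptr sat low w S2 t mem v4 i(3) MF
          by (simp add: edge_block_def emit_def env_def del: One_nat_def power_Suc)
        have lv: "\<forall>i\<in>live edge_block. v4 i < 2 ^ B"
          using I SB pB xB jB v4 env_bounds[of v4] by (auto simp: edge_block_def emit_def)
        show "runs (block edge_block) v4 m4 (cost edge_block * B)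
            (\<lambda>v' m'. v' vCol = Suc j \<and> ?I j (v'(vCol := j)) m')"
        proof (rule runs_block'[OF B_ge_1 order_refl _ lv])
          show "\<forall>c\<in>set edge_block. stmt_okay c" by (simp add: edge_block_def emit_def)
          show "final_vars edge_block v4 vCol = Suc j \<and>
            ?I j ((final_vars edge_block v4)(vCol := j)) (final_mem edge_block v4 m4)"
            unfolding fv fm i(1) using I v4 by (simp add: env_def)
        qed
      next
        show "?I M v3 m3" using 1 2 3 v env3 by (simp add: row_edges_def)
      qed (use 3 M_less_B in auto)
    qed
  qed
qed

lemma runs_edges:
  assumes env: "env v" and v: "m = memof (nodes # 3 * N * M # caps)"
    "v vPtr = length (nodes # 3 * N * M # caps)"
  shows "runs edges_code v m (edges_cost * U)
    (\<lambda>v' m'. m' = memof network_code \<and> v' vPtr = length network_code \<and> env v')"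
  unfolding edges_code_def edges_cost_def
proof (rule runs_Seq'[where Q = "\<lambda>v' m'. m' = m \<and> v' = v(vRow := 3 * N)"])
  have N3: "3 * N \<le> nodes" by (simp add: nodes_def)
  show "runs (block edges_block1) v m (cost edges_block1 * U) (\<lambda>v' m'. m' = m \<and> v' = v(vRow := 3 * N))"
    by (rule runs_block'[OF B_ge_1 U_bounds(1)])
      (use env env_bounds[OF env] in \<open>auto simp: edges_block1_def env_def\<close>)
  fix v1 m1 assume 1: "m1 = m \<and> v1 = v(vRow := 3 * N)"
  let ?l = "\<lambda>i. (nodes # 3 * N * M # caps) @ concat (map (\<lambda>x. row_edges x M) [0..<i])"
  have len: "length (?l i) = 2 + nodes + i * (2 * M)" for i
    by (simp add: length_caps length_rows)
  let ?I = "\<lambda>j v' m'. m' = memof (?l (3 * N - j)) \<and> v' vPtr = length (?l (3 * N - j)) \<and> env v'"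
  \<comment> \<open>\<open>B4\<close> already includes the \<open>M < B\<close> columns of a row, so
    only the number of rows is left to count.\<close>
  have le: "(3 * N + 1) * B4 \<le> U" using N3 by (intro mult_le_mono) auto
  show "runs (loop vRow row_edges_code) v1 m1 ((row_edges_cost + 13) * U)
    (\<lambda>v' m'. m' = memof network_code \<and> v' vPtr = length network_code \<and> env v')"
  proof (rule runs_widen[OF runs_loop'[OF B_ge_1 B_le_B4(1), where n = "3 * N" and I = ?I] le])
    fix j v2 m2 assume j: "j < 3 * N" and I: "?I (Suc j) v2 m2" and v2: "v2 vRow = Suc j"
    let ?x = "3 * N - Suc j"
    have x: "?x < 3 * N" "3 * N - ?x = Suc j" "3 * N - j = Suc ?x" using j by auto
    have "length (?l ?x) + 2 * M = length (?l (Suc ?x))" unfolding len by simp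
    also have "\<dots> \<le> length (?l (3 * N))" unfolding len using x(1) by (intro add_mono mult_le_mono1) auto
    also have "\<dots> < 2 ^ B" unfolding len using bounds(5) by simp
    finally have lB: "length (?l ?x) + 2 * M < 2 ^ B" .
    have "runs row_edges_code v2 m2 (row_edges_cost * B4) (\<lambda>v' m'. m' = memof (?l ?x @ row_edges ?x M) \<and>
        v' vPtr = length (?l ?x) + 2 * M \<and> env v' \<and> v' vRow = v2 vRow)"
      using I v2 x by (intro runs_row_edges[OF _ x(1) _ _ _ lB]) auto
    then show "runs row_edges_code v2 m2 (row_edges_cost * B4)
        (\<lambda>v' m'. v' vRow = Suc j \<and> ?I j (v'(vRow := j)) m')"
      by (rule runs_mono) (use v2 in \<open>auto simp: x(3) env_def length_row_edges\<close>)
  next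
    show "3 * N < 2 ^ B" using N3 bounds(4) by linarith
    show "?I (3 * N) v1 m1" using 1 v env by (auto simp: env_def)
  qed (use 1 in \<open>auto simp: network_code_eq\<close>)
qed

lemma runs_build:
  assumes v: "v vPtr = length input"
  shows "runs build_code v (memof input) (build_cost * U)
    (\<lambda>v' m'. m' = memof network_code \<and> v' vPtr = length network_code \<and> env v')"
  unfolding build_code_def build_cost_def
proof (rule runs_Seq')
  have BB: "B * B \<le> U" using B_le_B4(2) U_bounds(2) by (rule order_trans)
  have DB: "D < 2 ^ B" using D_le by (intro le_less_trans[OF _ less_exp])
  have L: "length input < B" using B_ge(1) by (simp add: D_def)
  have less: "\<forall>x\<in>set input. x < 2 ^ B" using input_less DB by (meson less_trans)
  show "runs read_code v (memof input) (read_cost * U) (\<lambda>v' m'. m' = memof [] \<and>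
      v' vPtr = 0 \<and> v' vW = pack D input \<and> v' vD = D)"
    using less DB pack_input_less v L
    by (intro runs_widen[OF runs_read[OF B_ge_1, where n = n] BB]) (auto simp: input_eq D_def)
  fix v1 m1 assume 1: "m1 = memof [] \<and> v1 vPtr = 0 \<and> v1 vW = pack D input \<and> v1 vD = D"
  show "runs (Seq setup_code (Seq header_code edges_code)) v1 m1
      ((setup_cost + (header_cost + edges_cost)) * U)
      (\<lambda>v' m'. m' = memof network_code \<and> v' vPtr = length network_code \<and> env v')"
  proof (rule runs_Seq'[OF runs_widen[OF runs_setup BB]])
    fix v2 m2 assume 2: "m2 = m1 \<and> env v2 \<and> v2 vPtr = 0"
    show "runs (Seq header_code edges_code) v2 m2 ((header_cost + edges_cost) * U)
      (\<lambda>v' m'. m' = memof network_code \<and> v' vPtr = length network_code \<and> env v')"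
      by (rule runs_Seq'[OF runs_header runs_edges]) (use 1 2 in auto)
  qed (use 1 in auto)
qed

end

section \<open>Reading off satisfiability from the flow values\<close>

lemma ex_less_minus_Suc: "j < n \<Longrightarrow> (\<exists>i<n - j. P i) \<longleftrightarrow> (\<exists>i<n - Suc j. P i) \<or> P (n - Suc j)"
  for n :: nat
proof -
  assume "j < n"
  then have "n - j = Suc (n - Suc j)" by simp
  then show ?thesis by (auto simp: less_Suc_eq)
qed

context sat_instance
begin

lemma runs_count:
  assumes v: "v vSum = 1" "v vV = row_mask N F a" "v vS = row_mask N F g" "v vCl = M"
  shows "runs (loop vCl (block count_block)) v m ((cost count_block + 13) * B4)
    (\<lambda>v' m'. m' = m \<and> v' vSum = card (direct a g) + 1 \<and> same_except {vSum, vV, vS, vCl} v v')"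
proof -
  let ?c = "\<lambda>i. card {j. j < i \<and> row_sat N F a j \<and> \<not> row_sat N F g j}"
  let ?I = "\<lambda>j v' m'. m' = m \<and> v' vSum = ?c (M - j) + 1 \<and> v' vV = row_mask N F a div 2 ^ (M - j) \<and>
    v' vS = row_mask N F g div 2 ^ (M - j) \<and> same_except {vSum, vV, vS, vCl} v v'"
  have c_le: "?c i \<le> i" for i
    using card_mono[of "{..<i}" "{j. j < i \<and> row_sat N F a j \<and> \<not> row_sat N F g j}"] by auto
  have c_Suc: "?c (Suc i) = ?c i + of_bool (row_sat N F a i) * (1 - of_bool (row_sat N F g i))" for i
  proof -
    have *: "{j. j < Suc i \<and> row_sat N F a j \<and> \<not> row_sat N F g j} =
        {j. j < i \<and> row_sat N F a j \<and> \<not> row_sat N F g j} \<union>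
        (if row_sat N F a i \<and> \<not> row_sat N F g i then {i} else {})"
      by (auto simp: less_Suc_eq)
    then show ?thesis by (subst *, subst card_Un_disjoint) auto
  qed
  show ?thesis
  proof (rule runs_widen[OF runs_short_loop[OF B_ge_1 order_refl, where n = M and I = ?I] B_le_B4(2)])
    fix j v1 m1 assume j: "j < M" and I: "?I (Suc j) v1 m1" and v1: "v1 vCl = Suc j"
    define i where "i = M - Suc j"
    have i: "M - j = Suc i" "i < M" using j by (simp_all add: i_def)
    have V: "v1 vV = row_mask N F a div 2 ^ i" "v1 vS = row_mask N F g div 2 ^ i" "v1 vSum = ?c i + 1"
      using I by (simp_all add: i_def)
    have same: "m1 = m" "same_except {vSum, vV, vS, vCl} v v1" using I by blast+
    have B: "v1 vV < 2 ^ B" "v1 vS < 2 ^ B"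
      unfolding V by (rule le_less_trans[OF div_le_dividend row_mask_bound])+
    have "?c i + 1 \<le> M" using c_le[of i] i(2) by linarith
    then have "v1 vSum < 2 ^ B" using bounds(3) V(3) by linarith
    moreover have "x div 2 ^ i div 2 = x div 2 ^ Suc i" for x :: nat
      by (simp add: div_mult2_eq mult.commute[of 2])
    moreover have "row_mask N F x div 2 ^ i mod 2 = of_bool (row_sat N F x i)" for x
      by (simp add: row_sat_def mod_2_eq_odd)
    ultimately show "runs (block count_block) v1 m1 (cost count_block * B)
        (\<lambda>v' m'. v' vCl = Suc j \<and> ?I j (v'(vCl := j)) m')"
      unfolding i(1) using same v1 V B
      by (intro runs_block'[OF B_ge_1 order_refl])
        (auto simp: count_block_def c_Suc simp del: One_nat_def power_Suc)
  next
    show "?I M v m" using v by simp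
    show "m' = m \<and> v' vSum = card (direct a g) + 1 \<and> same_except {vSum, vV, vS, vCl} v v'"
      if "v' vCl = 0" "?I 0 v' m'" for v' m'
      using that(2) by (simp add: direct_def)
  qed (use v M_less_B in auto)
qed

text \<open>For a source \<open>a\<close> and a sink \<open>g\<close>, this will mean that the two
  rows extend to a satisfying assignment.\<close>

abbreviation "hit m a g \<equiv> m (a * nodes + g) \<le> threshold a g"

lemma runs_pair:
  assumes env: "env v" and a: "a < N" "v vRow = N - a" and g: "g < N" "v vCol = N - g"
    and T: "v vT = row_mask N F a" and found: "v vFound = of_bool b"
    and m: "m (a * nodes + (N + g)) \<le> threshold a (N + g) + 2 * N"
  shows "runs pair_code v m (pair_cost * B4) (\<lambda>v' m'. m' = m \<and>
    v' vFound = of_bool (b \<or> hit m a (N + g)) \<and>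
    same_except (scratch \<union> {vX, vSum, vFound}) v v')"
  unfolding pair_code_def pair_cost_def
proof (rule runs_Seq'[where Q = "\<lambda>v' m'. m' = m \<and> v' = v(vX := N + g)"])
  note U4 = runs_block'[OF B_ge_1 B_le_B4(1)]
  let ?ok = "same_except (scratch \<union> {vX, vSum, vFound}) v"
  have MF: "length F + 1 = M" by (simp add: M_def)
  have row: "N - g < 2 ^ B" "N - a < 2 ^ B" using bounds(2) by linarith+
  show "runs (block pair_block1) v m (cost pair_block1 * B4) (\<lambda>v' m'. m' = m \<and> v' = v(vX := N + g))"
    by (rule U4) (use env env_bounds[OF env] g row in \<open>auto simp: pair_block1_def env_def\<close>)
  fix v1 m1 assume 1: "m1 = m \<and> v1 = v(vX := N + g)"
  have env1: "env v1" using env_cong[OF env, of v1] 1 by simp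
  have x: "N + g < 3 * N" using g(1) by simp
  show "runs (Seq row_code (Seq (block pair_block2) (Seq (loop vCl (block count_block))
      (Seq (fetch vV pair_address) (block pair_block3))))) v1 m1
      ((row_cost + (cost pair_block2 + ((cost count_block + 13) +
        (fetch_cost pair_address + cost pair_block3)))) * B4)
      (\<lambda>v' m'. m' = m \<and> v' vFound = of_bool (b \<or> hit m a (N + g)) \<and> ?ok v')"
  proof (rule runs_Seq'[OF runs_row_env[OF env1 _ x]])
    show "v1 vX = N + g" using 1 by simp
    fix v2 m2 assume 2: "m2 = m1 \<and> v2 vS = row_mask N F (N + g) \<and> same_except scratch v1 v2"
    have env2: "env v2" using env_cong[OF env1, of v2] 2 by simp
    show "runs (Seq (block pair_block2) (Seq (loop vCl (block count_block))
      (Seq (fetch vV pair_address) (block pair_block3)))) v2 m2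
      ((cost pair_block2 + ((cost count_block + 13) + (fetch_cost pair_address + cost pair_block3))) * B4)
      (\<lambda>v' m'. m' = m \<and> v' vFound = of_bool (b \<or> hit m a (N + g)) \<and> ?ok v')"
    proof (rule runs_Seq'[where Q = "\<lambda>v' m'. m' = m2 \<and> v' = v2(vSum := 1, vV := v vT, vCl := M)"])
      show "runs (block pair_block2) v2 m2 (cost pair_block2 * B4)
          (\<lambda>v' m'. m' = m2 \<and> v' = v2(vSum := 1, vV := v vT, vCl := M))"
        by (rule U4) (use 1 2 T row_mask_bound[of a] env2 env_bounds[OF env2] MF in
            \<open>auto simp: pair_block2_def env_def\<close>)
      fix v3 m3 assume 3: "m3 = m2 \<and> v3 = v2(vSum := 1, vV := v vT, vCl := M)"
      show "runs (Seq (loop vCl (block count_block)) (Seq (fetch vV pair_address) (block pair_block3))) v3 m3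
        (((cost count_block + 13) + (fetch_cost pair_address + cost pair_block3)) * B4)
        (\<lambda>v' m'. m' = m \<and> v' vFound = of_bool (b \<or> hit m a (N + g)) \<and> ?ok v')"
      proof (rule runs_Seq'[OF runs_count[where a = a and g = "N + g"]])
        fix v4 m4 assume 4: "m4 = m3 \<and> v4 vSum = card (direct a (N + g)) + 1 \<and>
          same_except {vSum, vV, vS, vCl} v3 v4"
        have v4: "v4 vRow = N - a" "v4 vX = N + g" "v4 vN = N" "v4 vNodes = nodes"
          "v4 vFound = of_bool b" "m4 = m"
          using 1 2 3 4 a found env2 by (auto simp: env_def)
        have addr: "val pair_address v4 = a * nodes + (N + g)"
          using v4 a by (simp add: pair_address_def)
        have "card (direct a (N + g)) \<le> card {..<M}"
          by (intro card_mono) (auto simp: direct_def)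
        then have d: "card (direct a (N + g)) + 1 \<le> M + 1" by simp
        then have "threshold a (N + g) \<le> 2 * N * N * (M + 1)"
          unfolding threshold_def by (rule mult_le_mono2)
        \<comment> \<open>Under logarithmic cost a memory cell is cheap to read only if its content
          is known to be small; this is the use of the upper bound on the stored flow value.\<close>
        then have mB: "m (a * nodes + (N + g)) < 2 ^ B" using m bounds(6) by linarith
        have "1 * (M + 1) \<le> 2 * N * N * (M + 1)" using N_ge_1 by (intro mult_le_mono1) simp
        then have "M + 1 < 2 ^ B"
          unfolding mult_1 by (intro le_less_trans[OF trans_le_add1 bounds(6)])
        moreover have "v4 vSum = card (direct a (N + g)) + 1" using 4 by blast
        ultimately have sB: "v4 vSum < 2 ^ B" using d by linarith
        have xB: "N + g < 2 ^ B" using bounds(4) g(1) by (simp add: nodes_def)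
        show "runs (Seq (fetch vV pair_address) (block pair_block3)) v4 m4
          ((fetch_cost pair_address + cost pair_block3) * B4)
          (\<lambda>v' m'. m' = m \<and> v' vFound = of_bool (b \<or> hit m a (N + g)) \<and> ?ok v')"
        proof (rule runs_Seq'[where Q = "\<lambda>v' m'. m' = m \<and> v' = v4(vV := m (a * nodes + (N + g)))"])
          show "runs (fetch vV pair_address) v4 m4 (fetch_cost pair_address * B4)
            (\<lambda>v' m'. m' = m \<and> v' = v4(vV := m (a * nodes + (N + g))))"
          proof (rule runs_widen[OF runs_fetch B_le_B4(1)])
            show "stmt_okay (vV ::= pair_address)" by (simp add: pair_address_def)
            show "\<forall>i\<in>exp_vars pair_address. v4 i < 2 ^ B"
              using v4 row xB bounds(2,4) by (simp add: pair_address_def)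
          qed (use B_ge_1 addr mB v4(6) in auto)
          fix v5 m5 assume 5: "m5 = m \<and> v5 = v4(vV := m (a * nodes + (N + g)))"
          have "(1 - (m (a * nodes + (N + g)) - 2 * N * N * v4 vSum)) = of_bool (hit m a (N + g))"
            using 4 by (simp add: threshold_def)
          moreover have "v4 vFound < 2 ^ B"
            using v4(5) B_ge_1 one_less_power[of "2::nat" B] by simp
          moreover have "same_except (scratch \<union> {vX, vSum}) v v4" using 1 2 3 4 by auto
          ultimately show "runs (block pair_block3) v5 m5 (cost pair_block3 * B4)
            (\<lambda>v' m'. m' = m \<and> v' vFound = of_bool (b \<or> hit m a (N + g)) \<and> ?ok v')"
            using v4 5 sB mB bounds(2)
            by (intro U4) (auto simp: pair_block3_def simp del: One_nat_def)
        qed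
      qed (use 1 2 3 T in auto)
    qed
  qed
qed

lemma runs_scan_row:
  assumes env: "env v" and a: "a < N" "v vRow = N - a" and found: "v vFound = of_bool b"
    and m: "\<And>g. g < N \<Longrightarrow> m (a * nodes + (N + g)) \<le> threshold a (N + g) + 2 * N"
  shows "runs scan_row_code v m (scan_row_cost * ((N + 1) * B4)) (\<lambda>v' m'. m' = m \<and> env v' \<and>
    v' vRow = v vRow \<and> v' vFound = of_bool (b \<or> (\<exists>g<N. hit m a (N + g))))"
  unfolding scan_row_code_def scan_row_cost_def
proof (rule runs_Seq'[where Q = "\<lambda>v' m'. m' = m \<and> v' = v(vX := a)"])
  have UB: "B \<le> (N + 1) * B4" "B4 \<le> (N + 1) * B4" using B_le_B4(1) by (simp_all add: trans_le_add1)
  note UN = runs_block'[OF B_ge_1 UB(1)]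
  show "runs (block scan_block2) v m (cost scan_block2 * ((N + 1) * B4)) (\<lambda>v' m'. m' = m \<and> v' = v(vX := a))"
    by (rule UN) (use env env_bounds[OF env] a bounds(2) in \<open>auto simp: scan_block2_def env_def\<close>)
  fix v1 m1 assume 1: "m1 = m \<and> v1 = v(vX := a)"
  have env1: "env v1" using env_cong[OF env, of v1] 1 by simp
  have x: "a < 3 * N" using a(1) by simp
  let ?Q = "\<lambda>v' m'. m' = m \<and> env v' \<and> v' vRow = v vRow \<and>
    v' vFound = of_bool (b \<or> (\<exists>g<N. hit m a (N + g)))"
  show "runs (Seq row_code (Seq (block scan_block3) (loop vCol pair_code))) v1 m1
      ((row_cost + (cost scan_block3 + (pair_cost + 13))) * ((N + 1) * B4)) ?Q"
  proof (rule runs_Seq'[OF runs_widen[OF runs_row_env[OF env1 _ x] UB(2)]])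
    show "v1 vX = a" using 1 by simp
    fix v2 m2 assume 2: "m2 = m1 \<and> v2 vS = row_mask N F a \<and> same_except scratch v1 v2"
    have env2: "env v2" using env_cong[OF env1, of v2] 2 by simp
    show "runs (Seq (block scan_block3) (loop vCol pair_code)) v2 m2
      ((cost scan_block3 + (pair_cost + 13)) * ((N + 1) * B4)) ?Q"
    proof (rule runs_Seq'[where Q = "\<lambda>v' m'. m' = m2 \<and> v' = v2(vT := row_mask N F a, vCol := N)"])
      show "runs (block scan_block3) v2 m2 (cost scan_block3 * ((N + 1) * B4))
          (\<lambda>v' m'. m' = m2 \<and> v' = v2(vT := row_mask N F a, vCol := N))"
        by (rule UN) (use 2 row_mask_bound[of a] env2 env_bounds[OF env2] in
            \<open>auto simp: scan_block3_def env_def\<close>)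
      fix v3 m3 assume 3: "m3 = m2 \<and> v3 = v2(vT := row_mask N F a, vCol := N)"
      have env3: "env v3" using env_cong[OF env2, of v3] 3 by simp
      let ?I = "\<lambda>j v' m'. m' = m \<and> env v' \<and> v' vRow = v vRow \<and> v' vT = row_mask N F a \<and>
        v' vFound = of_bool (b \<or> (\<exists>g<N - j. hit m a (N + g)))"
      show "runs (loop vCol pair_code) v3 m3 ((pair_cost + 13) * ((N + 1) * B4)) ?Q"
      proof (rule runs_loop'[OF B_ge_1 B_le_B4(1), where n = N and I = ?I])
        fix j v4 m4 assume j: "j < N" and I: "?I (Suc j) v4 m4" and v4: "v4 vCol = Suc j"
        define g where "g = N - Suc j"
        have g: "g < N" "N - g = Suc j" using j by (simp_all add: g_def)
        let ?b = "b \<or> (\<exists>g<N - Suc j. hit m a (N + g))"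
        have "runs pair_code v4 m4 (pair_cost * B4) (\<lambda>v' m'. m' = m4 \<and>
            v' vFound = of_bool (?b \<or> hit m4 a (N + g)) \<and>
            same_except (scratch \<union> {vX, vSum, vFound}) v4 v')"
          by (rule runs_pair[OF _ a(1) _ g(1)]) (use I v4 g a m[OF g(1)] in auto)
        then show "runs pair_code v4 m4 (pair_cost * B4)
            (\<lambda>v' m'. v' vCol = Suc j \<and> ?I j (v'(vCol := j)) m')"
        proof (rule runs_mono[OF _ order_refl])
          fix v' m' assume v': "m' = m4 \<and> v' vFound = of_bool (?b \<or> hit m4 a (N + g)) \<and>
            same_except (scratch \<union> {vX, vSum, vFound}) v4 v'"
          have "env v4" using I by blast
          then have "env (v'(vCol := j))" by (rule env_cong) (use v' in auto)
          then show "v' vCol = Suc j \<and> ?I j (v'(vCol := j)) m'"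
            using v' I v4 ex_less_minus_Suc[OF j, of "\<lambda>g. hit m a (N + g)"] by (simp add: g_def)
        qed
      next
        show "?I N v3 m3" using 1 2 3 env3 found by auto
      qed (use 3 bounds(2) in auto)
    qed
  qed
qed

text \<open>All \<open>N * N\<close> pairs are inspected, each with a fresh evaluation of the sink
  row. This is affordable since the exponent left for the flow algorithm will be at least 2.\<close>

lemma runs_scan:
  assumes env: "env v"
    and m: "\<And>a g. a < N \<Longrightarrow> g < N \<Longrightarrow> m (a * nodes + (N + g)) \<le> threshold a (N + g) + 2 * N"
  shows "runs scan_code v m (scan_cost * ((N + 1) * ((N + 1) * B4)))
    (\<lambda>v' m'. m' 0 = of_bool (\<exists>a<N. \<exists>g<N. hit m a (N + g)))"
  unfolding scan_code_def scan_cost_def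
proof (rule runs_Seq'[where Q = "\<lambda>v' m'. m' = m \<and> v' = v(vFound := 0, vRow := N)"])
  have "B4 \<le> (N + 1) * B4" "(N + 1) * B4 \<le> (N + 1) * ((N + 1) * B4)" by simp_all
  then have UB: "B \<le> (N + 1) * B4" "B \<le> (N + 1) * ((N + 1) * B4)"
    using B_le_B4(1) by linarith+
  note UN = runs_block'[OF B_ge_1 UB(2)]
  show "runs (block scan_block1) v m (cost scan_block1 * ((N + 1) * ((N + 1) * B4)))
      (\<lambda>v' m'. m' = m \<and> v' = v(vFound := 0, vRow := N))"
    by (rule UN) (use env env_bounds[OF env] in \<open>auto simp: scan_block1_def env_def\<close>)
  fix v1 m1 assume 1: "m1 = m \<and> v1 = v(vFound := 0, vRow := N)"
  have env1: "env v1" using env_cong[OF env, of v1] 1 by simp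
  let ?hit = "\<lambda>a. \<exists>g<N. hit m a (N + g)"
  show "runs (Seq (loop vRow scan_row_code) (block scan_block4)) v1 m1
      (((scan_row_cost + 13) + cost scan_block4) * ((N + 1) * ((N + 1) * B4)))
      (\<lambda>v' m'. m' 0 = of_bool (\<exists>a<N. ?hit a))"
  proof (rule runs_Seq'[where Q = "\<lambda>v' m'. v' vFound = of_bool (\<exists>a<N. ?hit a)"])
    let ?I = "\<lambda>j v' m'. m' = m \<and> env v' \<and> v' vFound = of_bool (\<exists>a<N - j. ?hit a)"
    show "runs (loop vRow scan_row_code) v1 m1 ((scan_row_cost + 13) * ((N + 1) * ((N + 1) * B4)))
        (\<lambda>v' m'. v' vFound = of_bool (\<exists>a<N. ?hit a))"
    proof (rule runs_loop'[OF B_ge_1 UB(1), where n = N and I = ?I])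
      fix j v2 m2 assume j: "j < N" and I: "?I (Suc j) v2 m2" and v2: "v2 vRow = Suc j"
      define a where "a = N - Suc j"
      have a: "a < N" "N - a = Suc j" using j by (simp_all add: a_def)
      have "runs scan_row_code v2 m2 (scan_row_cost * ((N + 1) * B4)) (\<lambda>v' m'. m' = m2 \<and> env v' \<and>
          v' vRow = v2 vRow \<and> v' vFound = of_bool ((\<exists>a<N - Suc j. ?hit a) \<or> (\<exists>g<N. hit m2 a (N + g))))"
        by (rule runs_scan_row[OF _ a(1)]) (use I v2 a m[OF a(1)] in auto)
      then show "runs scan_row_code v2 m2 (scan_row_cost * ((N + 1) * B4))
          (\<lambda>v' m'. v' vRow = Suc j \<and> ?I j (v'(vRow := j)) m')"
      proof (rule runs_mono[OF _ order_refl])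
        fix v' m' assume v': "m' = m2 \<and> env v' \<and> v' vRow = v2 vRow \<and>
          v' vFound = of_bool ((\<exists>a<N - Suc j. ?hit a) \<or> (\<exists>g<N. hit m2 a (N + g)))"
        have "env (v'(vRow := j))" using v' by (simp add: env_def)
        then show "v' vRow = Suc j \<and> ?I j (v'(vRow := j)) m'"
          using v' I v2 ex_less_minus_Suc[OF j, of ?hit] by (simp add: a_def)
      qed
    next
      show "?I N v1 m1" using 1 env1 by simp
    qed (use 1 bounds(2) in auto)
    fix v2 m2 :: "nat \<Rightarrow> nat" assume v2: "v2 vFound = of_bool (\<exists>a<N. ?hit a)"
    then have "v2 vFound < 2 ^ B" using B_ge_1 one_less_power[of "2::nat" B] by simp
    then show "runs (block scan_block4) v2 m2 (cost scan_block4 * ((N + 1) * ((N + 1) * B4)))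
        (\<lambda>v' m'. m' 0 = of_bool (\<exists>a<N. ?hit a))"
      using v2 by (intro UN) (auto simp: scan_block4_def)
  qed
qed

end

section \<open>The reduction\<close>

text \<open>Register 60 is register 0 of the shifted algorithm and must receive the length of its
  input; register 61 is still zero, so the addition is a copy.\<close>

definition sat_program :: "program \<Rightarrow> program" where
  "sat_program P = Seq build_code (Seq (Arith Plus 60 vPtr 61) (Seq (shift P) scan_code))"

lemma runsD:
  assumes "runs P (vars s) (mem s) c Q"
  obtains t s' where "exec P s t s'" "t \<le> c" "\<And>i. 60 \<le> i \<Longrightarrow> reg s' i = reg s i" "Q (vars s') (mem s')"
  using assms unfolding runs_def by blast

lemma mem_initial_state: "mem (initial_state xs) = memof xs"
  by (auto simp: initial_state_def memof_def fun_eq_iff)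

context sat_instance
begin

lemma satisfiable_iff_hit:
  assumes "all_pairs_output nodes edges caps m"
  shows "(\<exists>a<N. \<exists>g<N. hit m a (N + g)) \<longleftrightarrow> satisfiable F"
    and "a < N \<Longrightarrow> g < N \<Longrightarrow> m (a * nodes + (N + g)) \<le> threshold a (N + g) + 2 * N"
proof -
  have flow: "decode_value (m (a * nodes + (N + g))) = flow_between a (N + g)"
    if "a < N" "g < N" for a g
  proof -
    have "a < nodes" "N + g < nodes" "a \<noteq> N + g" using that by (auto simp: nodes_def)
    then show ?thesis using assms unfolding all_pairs_output_def by blast
  qed
  show "m (a * nodes + (N + g)) \<le> threshold a (N + g) + 2 * N" if "a < N" "g < N"
    using decode_flow(2)[OF that(1) _ _ flow[OF that]] that(2) by simp
  have hit: "hit m a (N + g) \<longleftrightarrow> (\<exists>b. 2 * N \<le> b \<and> b < 3 * N \<and> good a (N + g) b)"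
    if "a < N" "g < N" for a g
    using decode_flow(1)[OF that(1) _ _ flow[OF that]] that(2) by simp
  have vars: "\<forall>C\<in>set F. \<forall>(y, b)\<in>set C. y < 3 * q"
  proof -
    have "n \<le> 3 * q" by (simp add: q_def)
    then show ?thesis using kcnf by (fastforce simp: k_cnf_def)
  qed
  have "1 \<le> q" by (simp add: q_def)
  then have "satisfiable F \<longleftrightarrow> (\<exists>a g b. a < N \<and> N \<le> g \<and> g < 2 * N \<and> 2 * N \<le> b \<and> b < 3 * N \<and>
      (\<forall>C\<in>set F. \<exists>x\<in>{a, g, b}. clause_true (row_pos N x) (row_neg N x) C))"
    using satisfiable_iff_rows[OF _ vars] unfolding N_def by blast
  also have "\<dots> \<longleftrightarrow> (\<exists>a g b. a < N \<and> N \<le> g \<and> g < 2 * N \<and> 2 * N \<le> b \<and> b < 3 * N \<and> good a g b)"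
    using good_iff_clauses[OF N_ge_1, of _ F] unfolding M_def by blast
  also have "\<dots> \<longleftrightarrow> (\<exists>a<N. \<exists>g<N. \<exists>b. 2 * N \<le> b \<and> b < 3 * N \<and> good a (N + g) b)"
  proof -
    have "(\<exists>g. N \<le> g \<and> g < 2 * N \<and> R g) \<longleftrightarrow> (\<exists>g<N. R (N + g))" for R
    proof
      assume "\<exists>g. N \<le> g \<and> g < 2 * N \<and> R g"
      then obtain g where "N \<le> g" "g < 2 * N" "R g" by blast
      then show "\<exists>g<N. R (N + g)" by (intro exI[of _ "g - N"]) auto
    next
      assume "\<exists>g<N. R (N + g)"
      then obtain g where "g < N" "R (N + g)" by blast
      then show "\<exists>g. N \<le> g \<and> g < 2 * N \<and> R g" by (intro exI[of _ "N + g"]) auto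
    qed
    from this[of "\<lambda>g. \<exists>b. 2 * N \<le> b \<and> b < 3 * N \<and> good a g b" for a] show ?thesis by blast
  qed
  also have "\<dots> \<longleftrightarrow> (\<exists>a<N. \<exists>g<N. hit m a (N + g))" using hit by blast
  finally show "(\<exists>a<N. \<exists>g<N. hit m a (N + g)) \<longleftrightarrow> satisfiable F" by blast
qed

definition "overhead = build_cost * U + 2 * B + scan_cost * ((N + 1) * ((N + 1) * B4))"

lemma sat_program_correct:
  assumes "solves_all_pairs_max_flow 1 1 P T"
  shows "computes_within (sat_program P) (encode_cnf n F) (real overhead + T nodes)
    (\<lambda>m. m 0 = of_bool (satisfiable F))"
proof -
  let ?s0 = "initial_state input"
  have "vars ?s0 vPtr = length input" by (simp add: vars_def initial_state_def)
  then have "runs build_code (vars ?s0) (mem ?s0) (build_cost * U)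
      (\<lambda>v' m'. m' = memof network_code \<and> v' vPtr = length network_code \<and> env v')"
    unfolding mem_initial_state by (rule runs_build)
  then obtain t1 s1 where 1: "exec build_code ?s0 t1 s1" "t1 \<le> build_cost * U"
    "\<And>i. 60 \<le> i \<Longrightarrow> reg s1 i = reg ?s0 i"
    "mem s1 = memof network_code" "vars s1 vPtr = length network_code" "env (vars s1)"
    by (elim runsD) blast
  have ptr: "reg s1 0 = length network_code" using 1(5) by (simp add: vars_def)
  have high: "reg s1 i = 0" if "60 \<le> i" for i using 1(3)[OF that] that by (simp add: initial_state_def)
  let ?s2 = "s1\<lparr>reg := (reg s1)(60 := arith Plus (reg s1 vPtr) (reg s1 61))\<rparr>"
  have 2: "exec (Arith Plus 60 vPtr 61) s1 (bits (reg s1 vPtr) + bits (reg s1 61)) ?s2"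
    by (rule exec.Arith)
  have t2: "bits (reg s1 vPtr) + bits (reg s1 61) \<le> 2 * B"
  proof -
    have "bits (length network_code) \<le> B"
      using bounds(5) B_ge_1 by (intro bits_le) (simp_all add: length_network_code)
    then show ?thesis using ptr high[of 61] B_ge_1 by simp
  qed
  \<comment> \<open>Memory holds the encoded network and zeros elsewhere, and the upper registers
    are untouched apart from 60: exactly the initial state that the algorithm expects.\<close>
  have emb: "embeds ?s2 (initial_state network_code)"
    using ptr high 1(4) mem_initial_state[of network_code]
    by (auto simp: embeds_def) (auto simp: initial_state_def)
  have "computes_within P network_code (T nodes) (all_pairs_output nodes edges caps)"
    using assms simple edges_le_nodes length_caps set_caps
    unfolding solves_all_pairs_max_flow_def network_code_def by blast
  then obtain t3 s where s: "exec P (initial_state network_code) t3 s" "real t3 \<le> T nodes"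
    "all_pairs_output nodes edges caps (mem s)"
    unfolding computes_within_def by blast
  obtain s3 where 3: "exec (shift P) ?s2 t3 s3" "embeds s3 s" "\<forall>i<60. reg s3 i = reg ?s2 i"
    using exec_shift[OF s(1) emb] by blast
  have "vars s3 = vars s1" using 3(3) by (auto simp: vars_def fun_eq_iff)
  then have env3: "env (vars s3)" using 1(6) by simp
  have out: "all_pairs_output nodes edges caps (mem s3)" using s(3) 3(2) by (simp add: embeds_def)
  have scan: "runs scan_code (vars s3) (mem s3) (scan_cost * ((N + 1) * ((N + 1) * B4)))
      (\<lambda>v' m'. m' 0 = of_bool (\<exists>a<N. \<exists>g<N. hit (mem s3) a (N + g)))"
    by (rule runs_scan[OF env3]) (rule satisfiable_iff_hit(2)[OF out])
  obtain t4 s4 where 4: "exec scan_code s3 t4 s4" "t4 \<le> scan_cost * ((N + 1) * ((N + 1) * B4))"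
    "mem s4 0 = of_bool (\<exists>a<N. \<exists>g<N. hit (mem s3) a (N + g))"
    using runsD[OF scan] by blast
  have "exec (sat_program P) ?s0 (t1 + ((bits (reg s1 vPtr) + bits (reg s1 61)) + (t3 + t4))) s4"
    unfolding sat_program_def by (intro exec.Seq[OF 1(1)] exec.Seq[OF 2] exec.Seq[OF 3(1) 4(1)])
  moreover have "real (t1 + ((bits (reg s1 vPtr) + bits (reg s1 61)) + (t3 + t4))) \<le>
      real overhead + T nodes"
  proof -
    have "t1 + (bits (reg s1 vPtr) + bits (reg s1 61)) + t4 \<le> overhead"
      unfolding overhead_def using 1(2) t2 4(2) by linarith
    then have "real (t1 + (bits (reg s1 vPtr) + bits (reg s1 61)) + t4) \<le> real overhead"
      by (rule of_nat_mono)
    then show ?thesis using s(2) by simp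
  qed
  moreover have "mem s4 0 = of_bool (satisfiable F)"
    using 4(3) satisfiable_iff_hit(1)[OF out] by simp
  ultimately show ?thesis unfolding computes_within_def input_def by blast
qed

section \<open>Running time in terms of \<open>n\<close>, \<open>k\<close> and the number of
  clauses\<close>

lemma poly_bounds:
  shows "real N \<le> 2 * 2 powr (real n / 3)"
    and "nodes + 1 \<le> 16 * (N * length F)"
    and "B \<le> ((k + 26) * (n + 1) * length F) ^ 2"
proof -
  have m: "1 \<le> length F" using F by (simp add: Suc_le_eq)
  have "real N = 2 * 2 powr real (n div 3)"
    by (simp add: N_def q_def powr_realpow)
  also have "\<dots> \<le> 2 * 2 powr (real n / 3)"
    using of_nat_div_le_of_nat[of n 3] by simp
  finally show "real N \<le> 2 * 2 powr (real n / 3)" .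
  have "N \<le> N * length F" "length F \<le> N * length F" "1 \<le> N * length F"
    using m N_ge_1 by simp_all
  moreover have "nodes = 3 * N + M + 3 * (N * M)" by (simp add: nodes_def)
  moreover have "N * M = N * length F + N" "M = length F + 1" by (simp_all add: M_def)
  ultimately show "nodes + 1 \<le> 16 * (N * length F)" by linarith
  have len: "length input \<le> 2 + (k + 1) * length F"
  proof -
    have "\<forall>C\<in>set G. length C \<le> k \<Longrightarrow> length (concat (map encode_clause G)) \<le> (k + 1) * length G" for G
      by (induction G) (auto simp: encode_clause_def)
    then show ?thesis using kcnf by (simp add: input_eq k_cnf_def)
  qed
  let ?z = "(n + 1) * length F"
  have "n * 1 \<le> ?z" "1 * length F \<le> ?z" "1 * 1 \<le> ?z" using m by (intro mult_le_mono; simp)+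
  then have z: "n \<le> ?z" "length F \<le> ?z" "1 \<le> ?z" by (simp_all only: mult_1 mult_1_right)
  \<comment> \<open>The input has length at most \<open>2 + (k + 1) * length F\<close>, so
    \<open>D + 20\<close> is at most \<open>(k + 1) * length F + 2 * n + 23\<close>; the
    coefficients add up to \<open>k + 26\<close>.\<close>
  have "D + 20 \<le> (k + 1) * ?z + 2 * ?z + 23 * ?z"
    using mult_le_mono2[OF z(2), of "k + 1"] mult_le_mono2[OF z(1), of 2] mult_le_mono2[OF z(3), of 23]
      len unfolding D_def mult_1_right by linarith
  also have "\<dots> = (k + 26) * (n + 1) * length F" by (simp add: algebra_simps)
  finally show "B \<le> ((k + 26) * (n + 1) * length F) ^ 2"
    unfolding B_def power2_eq_square by (intro mult_le_mono)
qed

text \<open>\<open>B4\<close> is at most the eighth power of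
  \<open>(k + 26) * (n + 1) * length F\<close>, and the number of nodes contributes the ninth factor
  \<open>length F\<close>. Building is linear and scanning quadratic in \<open>N\<close>; both are
  charged to the square.\<close>

lemma overhead_le:
  "real overhead \<le> real (32 * build_cost + 2 + 16 * scan_cost) * real (k + 26) ^ 8 *
     (2 powr (real n / 3)) ^ 2 * real (n + 1) ^ 8 * real (length F) ^ 9"
proof -
  define X where "X = 2 powr (real n / 3)"
  define m where "m = real (length F)"
  define z where "z = real (k + 26) * real (n + 1) * m"
  have X: "1 \<le> X" unfolding X_def by (intro ge_one_powr_ge_zero) auto
  have m: "1 \<le> m" using F by (simp add: m_def Suc_le_eq)
  have N: "real N \<le> 2 * X" using poly_bounds(1) by (simp add: X_def)
  have B: "real B \<le> z ^ 2"
    using of_nat_mono[OF poly_bounds(3), where 'a = real]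
    by (simp only: z_def m_def of_nat_mult[symmetric] of_nat_power[symmetric])
  have "1 * 1 * 1 \<le> z" unfolding z_def using m by (intro mult_mono) auto
  then have z: "1 \<le> z" by simp
  have B4: "real B4 \<le> z ^ 8"
  proof -
    have "real B4 = real B ^ 4" by (simp add: power4_eq_xxxx)
    also have "\<dots> \<le> (z ^ 2) ^ 4" using B by (intro power_mono) auto
    finally show ?thesis by (simp add: power_mult[symmetric])
  qed
  have "real (nodes + 1) \<le> 16 * (real N * m)"
    using of_nat_mono[OF poly_bounds(2), where 'a = real] by (simp add: m_def)
  also have "\<dots> \<le> 16 * (2 * X * m)" using N m by (intro mult_left_mono mult_right_mono) auto
  also have "\<dots> \<le> 32 * (X ^ 2 * m)"
    using X m by (simp add: power2_eq_square)
  finally have nodes: "real (nodes + 1) \<le> 32 * (X ^ 2 * m)" .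
  have "real (N + 1) \<le> 4 * X" using N X by simp
  then have "real (N + 1) ^ 2 \<le> (4 * X) ^ 2" by (intro power_mono) auto
  also have "\<dots> \<le> 16 * (X ^ 2 * m)" using X m by (simp add: power_mult_distrib)
  finally have N2: "real (N + 1) ^ 2 \<le> 16 * (X ^ 2 * m)" .
  have B1: "real B \<le> X ^ 2 * m * z ^ 8"
  proof -
    have "real B \<le> real B4" using B_le_B4(1) by (simp only: of_nat_le_iff)
    also have "\<dots> = 1 * 1 * real B4" by simp
    also have "\<dots> \<le> X ^ 2 * m * z ^ 8"
      using X m B4 by (intro mult_mono) auto
    finally show ?thesis .
  qed
  have "real overhead = build_cost * (real (nodes + 1) * real B4) + 2 * real B +
      scan_cost * (real (N + 1) ^ 2 * real B4)"
    unfolding overhead_def by (simp only: of_nat_add of_nat_mult power2_eq_square mult.assoc of_nat_numeral)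
  also have "\<dots> \<le> build_cost * (32 * (X ^ 2 * m) * z ^ 8) + 2 * (X ^ 2 * m * z ^ 8) +
      scan_cost * (16 * (X ^ 2 * m) * z ^ 8)"
    using nodes N2 B4 B1 X m by (intro add_mono mult_left_mono mult_mono) auto
  also have "\<dots> = real (32 * build_cost + 2 + 16 * scan_cost) * (X ^ 2 * m * z ^ 8)"
    by (simp add: algebra_simps)
  also have "z ^ 8 = real (k + 26) ^ 8 * real (n + 1) ^ 8 * m ^ 8"
    by (simp only: z_def power_mult_distrib)
  also have "real (32 * build_cost + 2 + 16 * scan_cost) *
      (X ^ 2 * m * (real (k + 26) ^ 8 * real (n + 1) ^ 8 * m ^ 8)) =
      real (32 * build_cost + 2 + 16 * scan_cost) * real (k + 26) ^ 8 *
      X ^ 2 * real (n + 1) ^ 8 * (m * m ^ 8)"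
    by (simp only: ac_simps)
  also have "m * m ^ 8 = m ^ 9" using power_Suc[of m 8] by simp
  finally show ?thesis by (simp only: X_def m_def)
qed

end

text \<open>The finitely many exceptions are paid for by adding the sum of their absolute values to
  the constant; this works because \<open>\<epsilon>' \<le> 1\<close> keeps the power of
  \<open>n\<close> at least 1.\<close>

lemma bigo_bound_everywhere:
  fixes T :: "nat \<Rightarrow> real"
  assumes "T \<in> O(\<lambda>n. real n powr (3 - \<epsilon>))" "\<epsilon>' \<le> \<epsilon>" "\<epsilon>' \<le> 1"
  obtains c where "0 \<le> c" "\<And>n. 1 \<le> n \<Longrightarrow> T n \<le> c * real n powr (3 - \<epsilon>')"
proof -
  obtain c where c: "c > 0" "\<forall>\<^sub>F n in at_top. norm (T n) \<le> c * norm (real n powr (3 - \<epsilon>))"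
    using assms(1) by (elim landau_o.bigE) blast
  then obtain n0 where n0: "\<And>n. n0 \<le> n \<Longrightarrow> \<bar>T n\<bar> \<le> c * real n powr (3 - \<epsilon>)"
    by (auto simp: eventually_at_top_linorder)
  let ?s = "\<Sum>i<n0. \<bar>T i\<bar>"
  have s: "0 \<le> ?s" by (intro sum_nonneg) auto
  show ?thesis
  proof (rule that[of "c + ?s"])
    fix n :: nat assume n: "1 \<le> n"
    have p: "1 \<le> real n powr (3 - \<epsilon>')" using n assms(3) by (intro ge_one_powr_ge_zero) auto
    show "T n \<le> (c + ?s) * real n powr (3 - \<epsilon>')"
    proof (cases "n0 \<le> n")
      case True
      have "T n \<le> c * real n powr (3 - \<epsilon>)" using n0[OF True] by linarith
      also have "\<dots> \<le> (c + ?s) * real n powr (3 - \<epsilon>')"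
        using n s c assms(2) by (intro mult_mono powr_mono) auto
      finally show ?thesis .
    next
      case False
      then have "\<bar>T n\<bar> \<le> ?s" by (intro member_le_sum) auto
      then have "T n \<le> (c + ?s) * 1" using c(1) unfolding mult_1_right by linarith
      also have "\<dots> \<le> (c + ?s) * real n powr (3 - \<epsilon>')"
        using p c s by (intro mult_left_mono) auto
      finally show ?thesis .
    qed
  qed (use c s in auto)
qed

text \<open>Multiplied by the decaying exponential the polynomial tends to 0, so the product is
  bounded over all \<open>n\<close>.\<close>

lemma poly_le_exp:
  assumes "0 < (\<delta>::real)"
  obtains c where "0 \<le> c" "\<And>n::nat. real (n + 1) ^ 8 \<le> c * 2 powr (\<delta> * real n)"
proof -
  have "(\<lambda>n::nat. (real n + 1) ^ 8 * 2 powr (- (\<delta> * real n))) \<longlonglongrightarrow> 0"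
    using assms by real_asymp
  then have "Bseq (\<lambda>n::nat. (real n + 1) ^ 8 * 2 powr (- (\<delta> * real n)))"
    by (intro convergent_imp_Bseq convergentI)
  then obtain c where c: "c > 0" "\<And>n::nat. \<bar>(real n + 1) ^ 8 * 2 powr (- (\<delta> * real n))\<bar> \<le> c"
    by (auto simp: Bseq_def)
  have "real (n + 1) ^ 8 \<le> c * 2 powr (\<delta> * real n)" for n :: nat
  proof -
    have "(real n + 1) ^ 8 * 2 powr (- (\<delta> * real n)) \<le> c" using c(2)[of n] by linarith
    then show ?thesis by (simp add: powr_minus field_simps)
  qed
  then show ?thesis using c(1) by (intro that[of c]) auto
qed

theorem sat_from_all_pairs_max_flow:
  assumes solves: "solves_all_pairs_max_flow 1 1 P T" and "0 < \<epsilon>"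
    and T: "T \<in> O(\<lambda>n. real n powr (3 - \<epsilon>))"
  shows "\<exists>\<delta>>0. \<forall>k. \<exists>K d. solves_k_sat k (sat_program P)
    (\<lambda>n m. K * 2 powr ((1 - \<delta>) * real n) * real m ^ d)"
proof -
  \<comment> \<open>Capping at 1 keeps the exponent \<open>3 - \<epsilon>'\<close> at least 2, so
    that the quadratic overhead is dominated by \<open>Y\<close>.\<close>
  define \<epsilon>' where "\<epsilon>' = min \<epsilon> 1"
  have \<epsilon>': "0 < \<epsilon>'" "\<epsilon>' \<le> \<epsilon>" "\<epsilon>' \<le> 1" using assms(2) by (auto simp: \<epsilon>'_def)
  obtain c where c: "0 \<le> c" "\<And>n. 1 \<le> n \<Longrightarrow> T n \<le> c * real n powr (3 - \<epsilon>')"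
    using bigo_bound_everywhere[OF T \<epsilon>'(2,3)] by blast
  \<comment> \<open>The flow algorithm saves \<open>\<epsilon>' / 3\<close> in the exponent; one
    half of it pays for the polynomial in \<open>n\<close>, the other half is the final
    \<open>\<delta>\<close>.\<close>
  obtain c' where c': "0 \<le> c'" "\<And>n::nat. real (n + 1) ^ 8 \<le> c' * 2 powr (\<epsilon>' / 6 * real n)"
    using poly_le_exp[of "\<epsilon>' / 6"] \<epsilon>'(1) by auto
  have "\<exists>K d. solves_k_sat k (sat_program P)
      (\<lambda>n m. K * 2 powr ((1 - \<epsilon>' / 6) * real n) * real m ^ d)" for k
  proof -
    \<comment> \<open>The constant may depend on the clause width \<open>k\<close>, unlike the
      program and \<open>\<delta>\<close>.\<close>
    define K0 where "K0 = real (32 * build_cost + 2 + 16 * scan_cost) * real (k + 26) ^ 8"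
    define K1 where "K1 = c * 32 ^ 3"
    have K: "0 \<le> K0" "0 \<le> K1" using c by (auto simp: K0_def K1_def)
    have "computes_within (sat_program P) (encode_cnf n F)
        ((K0 + K1) * c' * 2 powr ((1 - \<epsilon>' / 6) * real n) * real (length F) ^ 9)
        (\<lambda>m. m 0 = of_bool (satisfiable F))" if F: "k_cnf k n F" "F \<noteq> []" for n F
    proof -
      interpret sat_instance k n F by unfold_locales (use F in auto)
      define X where "X = 2 powr (real n / 3)"
      define m where "m = real (length F)"
      define Y where "Y = X powr (3 - \<epsilon>')"
      define e where "e = real (n + 1) ^ 8"
      have X: "1 \<le> X" unfolding X_def by (intro ge_one_powr_ge_zero) auto
      have m: "1 \<le> m" using F by (simp add: m_def Suc_le_eq)
      have e: "1 \<le> e" unfolding e_def by simp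
      have "X ^ 2 = X powr 2" using X by (simp add: powr_numeral)
      also have "\<dots> \<le> Y" unfolding Y_def using X \<epsilon>' by (intro powr_mono) auto
      finally have X2: "X ^ 2 \<le> Y" .
      have over: "real overhead \<le> K0 * Y * e * m ^ 9"
      proof -
        have "real overhead \<le> K0 * X ^ 2 * e * m ^ 9"
          using overhead_le by (simp add: K0_def X_def m_def e_def)
        also have "\<dots> \<le> K0 * Y * e * m ^ 9"
          using X2 K e m by (intro mult_right_mono mult_left_mono) auto
        finally show ?thesis .
      qed
      have "T nodes \<le> c * real nodes powr (3 - \<epsilon>')"
        using N_ge_1 by (intro c(2)) (simp add: nodes_def)
      also have "\<dots> \<le> c * (32 * X * m) powr (3 - \<epsilon>')"
      proof (intro mult_left_mono powr_mono2)
        have "real nodes \<le> 16 * (real N * m)"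
          using of_nat_mono[OF poly_bounds(2), where 'a = real] by (simp add: m_def)
        also have "\<dots> \<le> 16 * (2 * X * m)"
          using poly_bounds(1) m by (intro mult_left_mono mult_right_mono) (auto simp: X_def)
        finally show "real nodes \<le> 32 * X * m" by simp
      qed (use c \<epsilon>' in auto)
      also have "(32 * X * m) powr (3 - \<epsilon>') = 32 powr (3 - \<epsilon>') * Y * m powr (3 - \<epsilon>')"
        using X m by (simp add: powr_mult Y_def)
      also have "c * \<dots> \<le> c * (32 ^ 3 * Y * m ^ 3)"
      proof -
        have "(32::real) powr (3 - \<epsilon>') \<le> 32 powr 3" "m powr (3 - \<epsilon>') \<le> m powr 3"
          using m \<epsilon>' by (intro powr_mono; simp)+
        then have "(32::real) powr (3 - \<epsilon>') \<le> 32 ^ 3" "m powr (3 - \<epsilon>') \<le> m ^ 3"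
          using m by (simp_all add: powr_numeral)
        then show ?thesis using c m by (intro mult_left_mono mult_mono) (auto simp: Y_def)
      qed
      also have "\<dots> = K1 * Y * 1 * m ^ 3" by (simp add: K1_def)
      also have "\<dots> \<le> K1 * Y * e * m ^ 9"
        using K m e by (intro mult_mono power_increasing) (auto simp: Y_def)
      finally have "real overhead + T nodes \<le> (K0 + K1) * Y * e * m ^ 9"
        using over by (simp add: distrib_right)
      also have "\<dots> \<le> (K0 + K1) * Y * (c' * 2 powr (\<epsilon>' / 6 * real n)) * m ^ 9"
        using K m c'(2)[of n] by (intro mult_right_mono mult_left_mono) (auto simp: Y_def e_def)
      also have "Y = 2 powr ((1 - \<epsilon>' / 3) * real n)"
        by (simp add: Y_def X_def powr_powr algebra_simps diff_divide_distrib)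
      also have "(K0 + K1) * 2 powr ((1 - \<epsilon>' / 3) * real n) * (c' * 2 powr (\<epsilon>' / 6 * real n)) * m ^ 9 =
          (K0 + K1) * c' * (2 powr ((1 - \<epsilon>' / 3) * real n) * 2 powr (\<epsilon>' / 6 * real n)) * m ^ 9"
        by (simp only: ac_simps)
      also have "2 powr ((1 - \<epsilon>' / 3) * real n) * 2 powr (\<epsilon>' / 6 * real n) = 2 powr ((1 - \<epsilon>' / 6) * real n)"
        unfolding powr_add[symmetric] by (rule arg_cong[where f = "\<lambda>x. 2 powr x"]) (simp add: field_simps)
      finally have "real overhead + T nodes \<le>
          (K0 + K1) * c' * 2 powr ((1 - \<epsilon>' / 6) * real n) * real (length F) ^ 9"
        by (simp add: m_def)
      then show ?thesis
        using sat_program_correct[OF solves] unfolding computes_within_def by (meson order_trans)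
    qed
    then show ?thesis unfolding solves_k_sat_def by blast
  qed
  then show ?thesis using \<epsilon>'(1) by (intro exI[of _ "\<epsilon>' / 6"]) auto
qed

theorem theorem1:
  assumes SETH
  shows "\<exists>a b :: nat. \<not> (\<exists>\<epsilon>::real. \<epsilon> > 0 \<and>
           (\<exists>P T. solves_all_pairs_max_flow a b P T \<and> T \<in> O(\<lambda>n. real n powr (3 - \<epsilon>))))"
\<comment> \<open>Both constants can be 1: there is one leaf position for every edge, so nodes
  outnumber edges, and the largest capacity \<open>2 * N * N\<close> is at most
  \<open>nodes * nodes\<close>.\<close>
proof (intro exI[of _ 1] notI)
  assume "\<exists>\<epsilon>::real. \<epsilon> > 0 \<and>
    (\<exists>P T. solves_all_pairs_max_flow 1 1 P T \<and> T \<in> O(\<lambda>n. real n powr (3 - \<epsilon>)))"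
  then obtain \<delta> P where \<delta>: "\<delta> > 0" and "\<And>k. \<exists>K d. solves_k_sat k (sat_program P)
      (\<lambda>n m. K * 2 powr ((1 - \<delta>) * real n) * real m ^ d)"
    using sat_from_all_pairs_max_flow by blast
  then show False using assms unfolding SETH_def by blast
qed

end
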